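(* Consider, at a vertex with variable indexed without subscript and its four neighbors indexed by $k=1,\dots,4$, the spherical and the hyperbolic ring equations $$\prod_{k=1}^4\frac{\operatorname{sn}\big(\frac{\beta-\beta_k+iK'}{2},q\big)}{\operatorname{sn}\big(\frac{\beta+\beta_k+iK'}{2},q\big)}=1,\qquad \prod_{k=1}^4\frac{\operatorname{sn}\big(\frac{\gamma-\gamma_k+iK'}{2},q\big)}{\operatorname{sn}\big(\frac{\gamma+\gamma_k-iK'}{2},q\big)}=1.$$ With $\beta=K-u$ and $\gamma=K-u$ respectively, in the limit $$\sqrt{1-q^2}=\epsilon\to0,\qquad u_k-u=\mathcal{O}(\epsilon),\qquad \sum_{k=1}^4(u_k-u)=\mathcal{O}(\epsilon^2),$$ these discrete equations approximate the elliptic sinh-Gordon equations $$\Delta u+\sinh 2u=0\qquad\text{and}\qquad \Delta u-\sinh2u=0$$ respectively. If $u(x,y)$ is a solution of $\Delta u+\sinh2u=0$ or of $\Delta u-\sinh 2u=0$, then the rings with the radii $$r_{m,n}=\epsilon\sinh u(x,y),\quad r_{m\pm1,n}=\epsilon\sinh u(x\pm\epsilon,y),\quad r_{m,n\pm1}=\epsilon\sinh u(x,y\pm\epsilon),$$ $$R_{m,n}=\epsilon\cosh u(x,y),\quad R_{m\pm1,n}=\epsilon\cosh u(x\pm\epsilon,y),\quad R_{m,n\pm1}=\epsilon\cosh u(x,y\pm\epsilon)$$ satisfy the spherical, respectively hyperbolic, ring equation up to $\mathcal{O}(\epsilon)$. They form infinitesimal spherical, respectively hyperbolic, ring flowers.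
   Context: A ring is a pair of concentric circles (in $S^2$ or in the hyperbolic plane) with signed inner radius $r$ and outer radius $R$. Rings with common parameter $q<1$ are encoded as follows, with Jacobi elliptic functions of modulus $q$ and complete elliptic integrals $K,K'$: in the spherical case $q\cos r=\cos R$ and $\cos r=\operatorname{sn}\beta$, $\sin r=\operatorname{cn}\beta$, $\sin R=\operatorname{dn}\beta$; in the hyperbolic case $\cosh r=q\cosh R$ and $\cosh R=\frac1{q\operatorname{sn}\gamma}$, $\tanh R=\operatorname{dn}\gamma$, $\sinh r=\frac{\operatorname{cn}\gamma}{\operatorname{sn}\gamma}$. For $\beta=K-u$ (resp. $\gamma=K-u$) and $q'=\sqrt{1-q^2}=\epsilon\to0$ one has, to leading order, $r\sim\epsilon\sinh u$, $R\sim\epsilon\cosh u$. In this statement the square grid of ring centers is indexed so that the four neighbors of the ring $(m,n)$ are $(m\pm1,n)$ and $(m,n\pm1)$, with mesh size $\epsilon$. $\Delta=\partial_x^2+\partial_y^2$. "Approximate" is meant in the usual sense of numerical mathematics (consistency of a difference scheme): substituting values of a smooth function $u$ on the $\epsilon$-grid, the equations $\epsilon^{-2}\arg(\text{left-hand side})=0$ (the left-hand side has modulus one, and is taken near $1$) become the differential equations as $\epsilon\to0$; "up to $\mathcal{O}(\epsilon)$" refers to the residual in these normalized equations. Ring flower: a central ring with four neighboring rings, each intersecting the central ring orthogonally (the outer circle of each ring intersects the inner circle of the other orthogonally), such that cyclically consecutive neighbors touch each other, alternately by their outer circles at a point of the inner circle of the central ring and by their inner circles at a point of the outer circle of the central ring.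 The spherical (hyperbolic) ring equation is the condition that five rings form a spherical (hyperbolic) ring flower. *)

theory Defs
  imports "HOL-Analysis.Analysis" "HOL-Library.Landau_Symbols"
begin

section \<open>Jacobi elliptic functions of modulus \<open>q\<close>\<close>

definition ellipticF :: "real \<Rightarrow> real \<Rightarrow> real" where
  "ellipticF \<phi> q = (LBINT t=0..\<phi>. 1 / sqrt (1 - q\<^sup>2 * (sin t)\<^sup>2))"

definition ellipticK :: "real \<Rightarrow> real" where
  "ellipticK q = ellipticF (pi / 2) q"

definition compl_modulus :: "real \<Rightarrow> real" where
  "compl_modulus q = sqrt (1 - q\<^sup>2)"

definition ellipticK' :: "real \<Rightarrow> real" where
  "ellipticK' q = ellipticK (compl_modulus q)"

text \<open>For \<open>\<bar>q\<bar> < 1\<close> the map \<open>\<phi> \<mapsto> ellipticF \<phi> q\<close> is an increasing bijection of the real line,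
  and the amplitude is its inverse.\<close>

definition jacobi_am :: "real \<Rightarrow> real \<Rightarrow> real" where
  "jacobi_am x q = (THE \<phi>. ellipticF \<phi> q = x)"

definition sn :: "real \<Rightarrow> real \<Rightarrow> real" where
  "sn x q = sin (jacobi_am x q)"

definition cn :: "real \<Rightarrow> real \<Rightarrow> real" where
  "cn x q = cos (jacobi_am x q)"

definition dn :: "real \<Rightarrow> real \<Rightarrow> real" where
  "dn x q = sqrt (1 - q\<^sup>2 * (sn x q)\<^sup>2)"

text \<open>The meromorphic function sn of a complex argument \<open>x + \<i> y\<close>, by Jacobi's imaginary
  transformation and the addition theorem; the functions of \<open>y\<close> have the complementary modulus.\<close>

definition csn :: "complex \<Rightarrow> real \<Rightarrow> complex" where
  "csn z q =
    (let x = Re z; y = Im z; q' = compl_modulus q;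
         s = sn x q; c = cn x q; d = dn x q;
         s' = sn y q'; c' = cn y q'; d' = dn y q'
     in Complex (s * d') (c * d * s' * c') / of_real (c'\<^sup>2 + q\<^sup>2 * s\<^sup>2 * s'\<^sup>2))"


section \<open>Rings and ring equations\<close>

text \<open>In the ring equations, index \<open>0\<close> is the central vertex and \<open>1, \<dots>, 4\<close> are its neighbors.\<close>

definition spherical_ring_lhs :: "real \<Rightarrow> (nat \<Rightarrow> real) \<Rightarrow> complex" where
  "spherical_ring_lhs q \<beta> =
    (\<Prod>k=1..4. csn ((of_real (\<beta> 0 - \<beta> k) + \<i> * of_real (ellipticK' q)) / 2) q
             / csn ((of_real (\<beta> 0 + \<beta> k) + \<i> * of_real (ellipticK' q)) / 2) q)"

definition hyperbolic_ring_lhs :: "real \<Rightarrow> (nat \<Rightarrow> real) \<Rightarrow> complex" where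
  "hyperbolic_ring_lhs q \<gamma> =
    (\<Prod>k=1..4. csn ((of_real (\<gamma> 0 - \<gamma> k) + \<i> * of_real (ellipticK' q)) / 2) q
             / csn ((of_real (\<gamma> 0 + \<gamma> k) - \<i> * of_real (ellipticK' q)) / 2) q)"

definition spherical_ring_param :: "real \<Rightarrow> real \<Rightarrow> real \<Rightarrow> real \<Rightarrow> bool" where
  "spherical_ring_param q \<beta> r R \<longleftrightarrow>
     q * cos r = cos R \<and> cos r = sn \<beta> q \<and> sin r = cn \<beta> q \<and> sin R = dn \<beta> q"

definition hyperbolic_ring_param :: "real \<Rightarrow> real \<Rightarrow> real \<Rightarrow> real \<Rightarrow> bool" where
  "hyperbolic_ring_param q \<gamma> r R \<longleftrightarrow>
     cosh r = q * cosh R \<and> cosh R = 1 / (q * sn \<gamma> q) \<and> tanh R = dn \<gamma> q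
     \<and> sinh r = cn \<gamma> q / sn \<gamma> q"


section \<open>Ring flowers in the sphere\<close>

text \<open>
  The center of the circle of signed radius \<open>\<rho>\<close> passing through the point \<open>p\<close> of the unit
  sphere with unit normal \<open>n\<close> (a tangent vector of the sphere at \<open>p\<close>, pointing away from the
  center if \<open>\<rho> > 0\<close>). Keeping track of the normal gives tangency and orthogonality a
  meaning also for circles of zero or negative radius.
\<close>

definition sph_center :: "real^3 \<Rightarrow> real^3 \<Rightarrow> real \<Rightarrow> real^3" where
  "sph_center p n \<rho> = cos \<rho> *\<^sub>R p - sin \<rho> *\<^sub>R n"

definition sph_dist :: "real^3 \<Rightarrow> real^3 \<Rightarrow> real" where
  "sph_dist a b = arccos (a \<bullet> b)"

text \<open>
  The circle \<open>(c0, \<rho>0)\<close> has a contact element \<open>(p, n)\<close> such that the circles of radii \<open>\<rho>1\<close> and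
  \<open>\<rho>2\<close> touching each other at \<open>p\<close> with opposite normals \<open>\<plusminus> p \<times> n\<close>, hence orthogonally to the
  first circle, have centers \<open>c1\<close> and \<open>c2\<close>, up to an error \<open>\<tau>\<close>; they lie in
  counterclockwise order around \<open>c0\<close>.
\<close>

definition sph_touch ::
  "real \<Rightarrow> real^3 \<Rightarrow> real \<Rightarrow> real^3 \<Rightarrow> real \<Rightarrow> real^3 \<Rightarrow> real \<Rightarrow> bool" where
  "sph_touch \<tau> c0 \<rho>0 c1 \<rho>1 c2 \<rho>2 \<longleftrightarrow>
     (\<exists>p n. norm p = 1 \<and> norm n = 1 \<and> p \<bullet> n = 0 \<and>
        c0 = sph_center p n \<rho>0 \<and>
        sph_dist c1 (sph_center p (cross3 p n) \<rho>1) \<le> \<tau> \<and>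
        sph_dist c2 (sph_center p (- cross3 p n) \<rho>2) \<le> \<tau>)"

text \<open>
  Rings \<open>0\<close> (central) and \<open>1, \<dots>, 4\<close> with inner radii \<open>r\<close> and outer radii \<open>R\<close> form a ring flower
  up to an error \<open>\<tau>\<close> in the positions of the neighbors; \<open>\<tau> = 0\<close> gives ring flowers.
\<close>

definition spherical_ring_flower_upto :: "real \<Rightarrow> (nat \<Rightarrow> real) \<Rightarrow> (nat \<Rightarrow> real) \<Rightarrow> bool" where
  "spherical_ring_flower_upto \<tau> r R \<longleftrightarrow>
     (\<exists>c :: nat \<Rightarrow> real^3. (\<forall>k\<le>4. norm (c k) = 1) \<and>
        sph_touch \<tau> (c 0) (r 0) (c 1) (R 1) (c 2) (R 2) \<and>
        sph_touch \<tau> (c 0) (R 0) (c 2) (r 2) (c 3) (r 3) \<and>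
        sph_touch \<tau> (c 0) (r 0) (c 3) (R 3) (c 4) (R 4) \<and>
        sph_touch \<tau> (c 0) (R 0) (c 4) (r 4) (c 1) (r 1))"

definition spherical_ring_flower :: "(nat \<Rightarrow> real) \<Rightarrow> (nat \<Rightarrow> real) \<Rightarrow> bool" where
  "spherical_ring_flower r R \<longleftrightarrow> spherical_ring_flower_upto 0 r R"

text \<open>
  For rings whose radii are of order \<open>\<epsilon>\<close>, a position error \<open>O(\<epsilon>^4)\<close> is an angular error
  \<open>O(\<epsilon>^3)\<close> around the central vertex, that is, an error \<open>O(\<epsilon>)\<close> after the normalization by
  \<open>\<epsilon>^-2\<close>. (Rings with radii \<open>\<epsilon> sinh u\<close>, \<open>\<epsilon> cosh u\<close> for an arbitrary smooth \<open>u\<close> only satisfy this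
  with \<open>\<epsilon>^3\<close> in place of \<open>\<epsilon>^4\<close>.)
\<close>

definition infinitesimal_spherical_ring_flower ::
  "(real \<Rightarrow> nat \<Rightarrow> real) \<Rightarrow> (real \<Rightarrow> nat \<Rightarrow> real) \<Rightarrow> bool" where
  "infinitesimal_spherical_ring_flower r R \<longleftrightarrow>
     (\<forall>k\<le>4. (\<lambda>\<epsilon>. r \<epsilon> k) \<in> O[at_right 0](\<lambda>\<epsilon>. \<epsilon>) \<and> (\<lambda>\<epsilon>. R \<epsilon> k) \<in> O[at_right 0](\<lambda>\<epsilon>. \<epsilon>)) \<and>
     (\<exists>C. \<forall>\<^sub>F \<epsilon> in at_right 0. spherical_ring_flower_upto (C * \<epsilon> ^ 4) (r \<epsilon>) (R \<epsilon>))"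


section \<open>Ring flowers in the hyperbolic plane\<close>

text \<open>The hyperboloid model.\<close>

definition lorentz :: "real^3 \<Rightarrow> real^3 \<Rightarrow> real" where
  "lorentz a b = a$1 * b$1 + a$2 * b$2 - a$3 * b$3"

definition hyp_plane :: "(real^3) set" where
  "hyp_plane = {p. lorentz p p = -1 \<and> p$3 > 0}"

definition hyp_dist :: "real^3 \<Rightarrow> real^3 \<Rightarrow> real" where
  "hyp_dist a b = arcosh (- lorentz a b)"

text \<open>The Lorentzian cross product: it is Lorentz orthogonal to both factors, and for a
  unit tangent vector \<open>n\<close> at \<open>p\<close> it is \<open>n\<close> rotated counterclockwise by a right angle.\<close>

definition lorentz_cross :: "real^3 \<Rightarrow> real^3 \<Rightarrow> real^3" where
  "lorentz_cross a b = vector [cross3 a b $ 1, cross3 a b $ 2, - (cross3 a b $ 3)]"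

definition hyp_center :: "real^3 \<Rightarrow> real^3 \<Rightarrow> real \<Rightarrow> real^3" where
  "hyp_center p n \<rho> = cosh \<rho> *\<^sub>R p - sinh \<rho> *\<^sub>R n"

definition hyp_touch ::
  "real \<Rightarrow> real^3 \<Rightarrow> real \<Rightarrow> real^3 \<Rightarrow> real \<Rightarrow> real^3 \<Rightarrow> real \<Rightarrow> bool" where
  "hyp_touch \<tau> c0 \<rho>0 c1 \<rho>1 c2 \<rho>2 \<longleftrightarrow>
     (\<exists>p n. p \<in> hyp_plane \<and> lorentz n n = 1 \<and> lorentz p n = 0 \<and>
        c0 = hyp_center p n \<rho>0 \<and>
        hyp_dist c1 (hyp_center p (lorentz_cross p n) \<rho>1) \<le> \<tau> \<and>
        hyp_dist c2 (hyp_center p (- lorentz_cross p n) \<rho>2) \<le> \<tau>)"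

definition hyperbolic_ring_flower_upto :: "real \<Rightarrow> (nat \<Rightarrow> real) \<Rightarrow> (nat \<Rightarrow> real) \<Rightarrow> bool" where
  "hyperbolic_ring_flower_upto \<tau> r R \<longleftrightarrow>
     (\<exists>c :: nat \<Rightarrow> real^3. (\<forall>k\<le>4. c k \<in> hyp_plane) \<and>
        hyp_touch \<tau> (c 0) (r 0) (c 1) (R 1) (c 2) (R 2) \<and>
        hyp_touch \<tau> (c 0) (R 0) (c 2) (r 2) (c 3) (r 3) \<and>
        hyp_touch \<tau> (c 0) (r 0) (c 3) (R 3) (c 4) (R 4) \<and>
        hyp_touch \<tau> (c 0) (R 0) (c 4) (r 4) (c 1) (r 1))"

definition hyperbolic_ring_flower :: "(nat \<Rightarrow> real) \<Rightarrow> (nat \<Rightarrow> real) \<Rightarrow> bool" where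
  "hyperbolic_ring_flower r R \<longleftrightarrow> hyperbolic_ring_flower_upto 0 r R"

definition infinitesimal_hyperbolic_ring_flower ::
  "(real \<Rightarrow> nat \<Rightarrow> real) \<Rightarrow> (real \<Rightarrow> nat \<Rightarrow> real) \<Rightarrow> bool" where
  "infinitesimal_hyperbolic_ring_flower r R \<longleftrightarrow>
     (\<forall>k\<le>4. (\<lambda>\<epsilon>. r \<epsilon> k) \<in> O[at_right 0](\<lambda>\<epsilon>. \<epsilon>) \<and> (\<lambda>\<epsilon>. R \<epsilon> k) \<in> O[at_right 0](\<lambda>\<epsilon>. \<epsilon>)) \<and>
     (\<exists>C. \<forall>\<^sub>F \<epsilon> in at_right 0. hyperbolic_ring_flower_upto (C * \<epsilon> ^ 4) (r \<epsilon>) (R \<epsilon>))"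


section \<open>Smooth functions of two variables\<close>

definition partial_x :: "(real \<times> real \<Rightarrow> real) \<Rightarrow> real \<times> real \<Rightarrow> real" where
  "partial_x u = (\<lambda>(x, y). deriv (\<lambda>t. u (t, y)) x)"

definition partial_y :: "(real \<times> real \<Rightarrow> real) \<Rightarrow> real \<times> real \<Rightarrow> real" where
  "partial_y u = (\<lambda>(x, y). deriv (\<lambda>t. u (x, t)) y)"

definition laplacian :: "(real \<times> real \<Rightarrow> real) \<Rightarrow> real \<times> real \<Rightarrow> real" where
  "laplacian u z = partial_x (partial_x u) z + partial_y (partial_y u) z"

primrec Ck_on :: "nat \<Rightarrow> (real \<times> real) set \<Rightarrow> (real \<times> real \<Rightarrow> real) \<Rightarrow> bool" where
  "Ck_on 0 D u \<longleftrightarrow> continuous_on D u"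
| "Ck_on (Suc k) D u \<longleftrightarrow> u differentiable_on D \<and> Ck_on k D (partial_x u) \<and> Ck_on k D (partial_y u)"

definition smooth_on :: "(real \<times> real) set \<Rightarrow> (real \<times> real \<Rightarrow> real) \<Rightarrow> bool" where
  "smooth_on D u \<longleftrightarrow> (\<forall>k. Ck_on k D u)"

text \<open>The values of \<open>u\<close> at a vertex and its four neighbors, in counterclockwise order.\<close>

definition stencil :: "(real \<times> real \<Rightarrow> real) \<Rightarrow> real \<Rightarrow> real \<Rightarrow> real \<Rightarrow> nat \<Rightarrow> real" where
  "stencil u x y \<epsilon> k =
     (if k = 0 then u (x, y)
      else if k = 1 then u (x + \<epsilon>, y)
      else if k = 2 then u (x, y + \<epsilon>)
      else if k = 3 then u (x - \<epsilon>, y)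
      else u (x, y - \<epsilon>))"

end

theory Submission
  imports Defs "HOL-Real_Asymp.Real_Asymp"
begin

text \<open>
  \<^bold>\<open>Ring equations.\<close> On the line \<open>Im z = \<plusminus>K'/2\<close> the elliptic sine is algebraic in the real elliptic
  functions \<open>s, c, d\<close> of the real part: up to a positive factor it is \<open>s (1 + q) \<plusminus> \<i> c d\<close>, and its
  modulus is the constant \<open>1 / sqrt q\<close> (\<open>csn_half_lattice\<close>, \<open>cmod_csn_half_lattice\<close>). Hence every factor
  of a ring equation is unimodular, and its argument is expressed by two arctangents. For
  \<open>q = sqrt (1 - \<epsilon>\<^sup>2)\<close> the elliptic functions degenerate to hyperbolic ones: the amplitude differs from
  the Gudermannian \<open>arctan (sinh v)\<close> by \<open>O(\<epsilon>\<^sup>2)\<close> (\<open>jacobi_am_near_gudermannian\<close>). The numerator, taken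
  at the half difference of the variables, contributes \<open>u\<^sub>k - u\<close> to the argument, up to \<open>O(\<epsilon>\<^sup>3)\<close>.
  The denominator is taken close to \<open>K\<close>, where cn and dn are of order \<open>\<epsilon>\<close>; it contributes
  \<open>\<epsilon>\<^sup>2 sinh (2 u) / 4\<close>, with the sign of the geometry. So the four factors together have the argument
  \<open>- (\<Sum> (u\<^sub>k - u) \<plusminus> \<epsilon>\<^sup>2 sinh (2 u)) + O(\<epsilon>\<^sup>3)\<close> (\<open>Arg_ring_lhs_agree\<close>), and on the stencil of a smooth
  function the sum is \<open>\<epsilon>\<^sup>2 \<Delta>u + O(\<epsilon>\<^sup>3)\<close>.

  \<^bold>\<open>Ring flowers.\<close> Seen from the center of the central ring, the angle between a touching point and the
  center of an adjacent neighbor is \<open>arctan (tan r\<^sub>k / sin R)\<close> or \<open>\<pi>/2 - arctan (sin r / tan R\<^sub>k)\<close>, with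
  hyperbolic functions of the radii in the hyperbolic plane. Placing the neighbors one after
  another leaves two errors: the distance of a neighbor from the center is prescribed twice, and the
  eight angles have to add up to \<open>2 \<pi>\<close>. The radii \<open>\<epsilon> sinh u\<close> and \<open>\<epsilon> cosh u\<close> satisfy \<open>R\<^sup>2 - r\<^sup>2 = \<epsilon>\<^sup>2\<close>, so
  the two distances agree up to \<open>O(\<epsilon>\<^sup>4)\<close> (\<open>center_distance_agree\<close>); and the angle defect is
  again \<open>\<Sum> (u\<^sub>k - u) \<plusminus> \<epsilon>\<^sup>2 sinh (2 u) + O(\<epsilon>\<^sup>3)\<close> (\<open>ring_angle_agree\<close>), which the differential equation
  reduces to \<open>O(\<epsilon>\<^sup>3)\<close>. At distance \<open>O(\<epsilon>)\<close> from the center this is a position error \<open>O(\<epsilon>\<^sup>4)\<close>. Sphere and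
  hyperbolic plane are treated together, with the curvature \<open>\<kappa> = \<plusminus>1\<close> as a parameter.
\<close>

section \<open>Jacobi elliptic functions\<close>

lemma compl_modulus_square:
  assumes "\<bar>k\<bar> \<le> 1" shows "(compl_modulus k)\<^sup>2 = 1 - k\<^sup>2"
  using assms by (simp add: compl_modulus_def abs_square_le_1)

lemma compl_modulus_bounds:
  assumes "0 < k" "k < 1" shows "0 < compl_modulus k" "compl_modulus k < 1"
  using assms by (auto simp: compl_modulus_def abs_square_less_1)

lemma compl_modulus_compl_modulus:
  assumes "0 \<le> k" "k \<le> 1" shows "compl_modulus (compl_modulus k) = k"
proof -
  have "(compl_modulus k)\<^sup>2 = 1 - k\<^sup>2" using assms by (intro compl_modulus_square) auto
  then show ?thesis using assms by (simp add: compl_modulus_def[of "compl_modulus k"])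
qed

lemma one_minus_modulus_sin_pos:
  fixes k :: real assumes "0 \<le> k" "k < 1" shows "0 < 1 - k\<^sup>2 * (sin t)\<^sup>2"
proof -
  have "k\<^sup>2 * (sin t)\<^sup>2 \<le> k\<^sup>2" by (simp add: abs_square_le_1 mult_left_le)
  also have "k\<^sup>2 < 1" using assms by (simp add: abs_square_less_1)
  finally show ?thesis by simp
qed

lemma ellipticF_0 [simp]: "ellipticF 0 k = 0"
  by (simp add: ellipticF_def flip: zero_ereal_def)

lemma has_field_derivative_ellipticF:
  assumes k: "0 \<le> k" "k < 1"
  shows "((\<lambda>\<phi>. ellipticF \<phi> k) has_field_derivative 1 / sqrt (1 - k\<^sup>2 * (sin \<phi>)\<^sup>2)) (at \<phi>)"
proof -
  define M where "M = \<bar>\<phi>\<bar> + 1"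
  have "((\<lambda>u. LBINT t=ereal 0..ereal u. 1 / sqrt (1 - k\<^sup>2 * (sin t)\<^sup>2)) has_vector_derivative
      1 / sqrt (1 - k\<^sup>2 * (sin \<phi>)\<^sup>2)) (at \<phi> within {-M..M})"
  proof (rule interval_integral_FTC2)
    have "1 - k\<^sup>2 * (sin t)\<^sup>2 \<noteq> 0" for t
      using one_minus_modulus_sin_pos[OF k, of t] by simp
    then show "continuous_on {-M..M} (\<lambda>t. 1 / sqrt (1 - k\<^sup>2 * (sin t)\<^sup>2))"
      by (intro continuous_intros ballI) (simp only: real_sqrt_eq_0_iff, blast)
  qed (auto simp: M_def)
  moreover have "\<phi> \<in> interior {-M..M}" by (auto simp: M_def)
  ultimately show ?thesis
    unfolding ellipticF_def zero_ereal_def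
    by (simp only: at_within_interior has_real_derivative_iff_has_vector_derivative)
qed

text \<open>
  The integrand is at least one. This makes the elliptic integral a bijection of the real line, and
  turns a bound for the residual of an approximate amplitude into a bound for its error.
\<close>

lemma ellipticF_expanding:
  assumes k: "0 \<le> k" "k < 1" and "x \<le> y"
  shows "y - x \<le> ellipticF y k - ellipticF x k"
proof -
  have "1 \<le> 1 / sqrt (1 - k\<^sup>2 * (sin t)\<^sup>2)" for t
    using one_minus_modulus_sin_pos[OF k, of t] by simp
  then have "\<exists>d. ((\<lambda>\<phi>. ellipticF \<phi> k - \<phi>) has_field_derivative d) (at t) \<and> 0 \<le> d" for t
    by (intro exI[of _ "1 / sqrt (1 - k\<^sup>2 * (sin t)\<^sup>2) - 1"])
       (auto intro!: derivative_eq_intros has_field_derivative_ellipticF[OF k])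
  then have "ellipticF x k - x \<le> ellipticF y k - y"
    using DERIV_nonneg_imp_nondecreasing[OF \<open>x \<le> y\<close>, of "\<lambda>\<phi>. ellipticF \<phi> k - \<phi>"] by blast
  then show ?thesis by simp
qed

lemma ellipticF_expanding_abs:
  assumes k: "0 \<le> k" "k < 1"
  shows "\<bar>y - x\<bar> \<le> \<bar>ellipticF y k - ellipticF x k\<bar>"
  using ellipticF_expanding[OF k, of x y] ellipticF_expanding[OF k, of y x]
  by (cases "x \<le> y") simp_all

lemma ellipticF_inject:
  assumes k: "0 \<le> k" "k < 1"
  shows "ellipticF x k = ellipticF y k \<longleftrightarrow> x = y"
proof
  assume "ellipticF x k = ellipticF y k"
  with ellipticF_expanding_abs[OF k, of x y] show "x = y" by simp
qed simp

lemma ellipticF_surj: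
  assumes k: "0 \<le> k" "k < 1"
  shows "\<exists>\<phi>. ellipticF \<phi> k = x"
proof -
  have "continuous_on {-\<bar>x\<bar>..\<bar>x\<bar>} (\<lambda>\<phi>. ellipticF \<phi> k)"
    by (rule DERIV_continuous_on, rule has_field_derivative_at_within, rule has_field_derivative_ellipticF[OF k])
  moreover have "ellipticF (-\<bar>x\<bar>) k \<le> x" "x \<le> ellipticF \<bar>x\<bar> k"
    using ellipticF_expanding[OF k, of "-\<bar>x\<bar>" 0] ellipticF_expanding[OF k, of 0 "\<bar>x\<bar>"] by auto
  ultimately have "\<exists>\<phi>\<ge>-\<bar>x\<bar>. \<phi> \<le> \<bar>x\<bar> \<and> ellipticF \<phi> k = x"
    by (intro IVT'[where f="\<lambda>\<phi>. ellipticF \<phi> k"]) simp_all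
  then show ?thesis by blast
qed

lemma ellipticF_jacobi_am:
  assumes k: "0 \<le> k" "k < 1"
  shows "ellipticF (jacobi_am x k) k = x"
proof -
  obtain \<phi> where \<phi>: "ellipticF \<phi> k = x" using ellipticF_surj[OF k] by blast
  have "jacobi_am x k = \<phi>"
    unfolding jacobi_am_def
  proof (rule the_equality[where P="\<lambda>\<phi>. ellipticF \<phi> k = x", OF \<phi>])
    show "\<psi> = \<phi>" if "ellipticF \<psi> k = x" for \<psi>
      using that \<phi> ellipticF_inject[OF k, of \<psi> \<phi>] by simp
  qed
  then show ?thesis using \<phi> by simp
qed

lemma jacobi_am_eqI:
  assumes k: "0 \<le> k" "k < 1" and "ellipticF \<phi> k = x"
  shows "jacobi_am x k = \<phi>"
  using ellipticF_jacobi_am[OF k, of x] ellipticF_inject[OF k, of "jacobi_am x k" \<phi>] assms(3) by simp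

lemma ellipticF_minus:
  assumes k: "0 \<le> k" "k < 1"
  shows "ellipticF (-x) k = - ellipticF x k"
proof -
  have "((\<lambda>x. ellipticF (-x) k + ellipticF x k) has_field_derivative 0) (at x)" for x
    by (rule derivative_eq_intros DERIV_chain2[OF has_field_derivative_ellipticF[OF k], of uminus]
          has_field_derivative_ellipticF[OF k] refl | simp)+
  then have "ellipticF (-x) k + ellipticF x k = ellipticF (-0) k + ellipticF 0 k"
    by (intro DERIV_isconst_all) auto
  then show ?thesis by simp
qed

lemma jacobi_am_minus:
  assumes k: "0 \<le> k" "k < 1"
  shows "jacobi_am (-x) k = - jacobi_am x k"
  by (rule jacobi_am_eqI[OF k]) (simp add: ellipticF_minus[OF k] ellipticF_jacobi_am[OF k])

text \<open>
  The substitution \<open>tan \<phi> tan \<phi>* = 1 / k'\<close> reverses the elliptic integral: the sum of the integrals up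
  to \<open>\<phi>\<close> and \<open>\<phi>*\<close> has derivative zero. Writing \<open>\<phi>*\<close> as \<open>\<pi>/2 - arctan (k' tan \<phi>)\<close> keeps \<open>\<phi> = 0\<close> in the
  domain; there the sum is \<open>K\<close>.
\<close>

lemma ellipticF_reflect:
  assumes k: "0 < k" "k < 1" and \<phi>: "-(pi/2) < \<phi>" "\<phi> < pi/2"
  shows "ellipticF (pi / 2 - arctan (compl_modulus k * tan \<phi>)) k = ellipticK k - ellipticF \<phi> k"
proof -
  define k' where "k' = compl_modulus k"
  have k': "0 < k'" "k'\<^sup>2 = 1 - k\<^sup>2"
    using k compl_modulus_bounds[of k] compl_modulus_square[of k] by (auto simp: k'_def)
  have k0: "0 \<le> k" using k by simp
  define g where "g = (\<lambda>t. ellipticF (pi / 2 - arctan (k' * tan t)) k + ellipticF t k)"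
  have D: "(g has_field_derivative 0) (at t)" if t: "t \<in> {-(pi/2)<..<pi/2}" for t
  proof -
    define D where "D = 1 - k\<^sup>2 * (sin t)\<^sup>2"
    have D: "0 < D" unfolding D_def by (rule one_minus_modulus_sin_pos[OF k0 k(2)])
    have c: "0 < cos t" using t by (simp add: cos_gt_zero_pi)
    have D_eq: "D = (cos t)\<^sup>2 + k'\<^sup>2 * (sin t)\<^sup>2"
      unfolding D_def k'(2) by (simp add: cos_squared_eq algebra_simps)
    have 1: "1 + (k' * tan t)\<^sup>2 = D / (cos t)\<^sup>2"
      using c by (simp add: D_eq tan_def field_simps power_mult_distrib)
    have 2: "1 - k\<^sup>2 * (sin (pi / 2 - arctan (k' * tan t)))\<^sup>2 = k'\<^sup>2 / D"
    proof -
      have "(sin (pi / 2 - arctan (k' * tan t)))\<^sup>2 = (cos (arctan (k' * tan t)))\<^sup>2"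
        by (simp add: cos_sin_eq)
      also have "\<dots> = 1 / (1 + (k' * tan t)\<^sup>2)"
        by (simp add: cos_arctan power_divide add_nonneg_nonneg)
      also have "\<dots> = (cos t)\<^sup>2 / D" by (simp only: 1) simp
      finally have "1 - k\<^sup>2 * (sin (pi / 2 - arctan (k' * tan t)))\<^sup>2 = (D - k\<^sup>2 * (cos t)\<^sup>2) / D"
        using D by (simp add: field_simps)
      also have "D - k\<^sup>2 * (cos t)\<^sup>2 = k'\<^sup>2" unfolding D_def k'(2) by (simp add: cos_squared_eq algebra_simps)
      finally show ?thesis .
    qed
    have e: "(cos t)\<^sup>2 * (k' * inverse ((cos t)\<^sup>2)) = k'" using c by (simp add: field_simps)
    have "((\<lambda>t. k' * tan t) has_field_derivative k' * inverse ((cos t)\<^sup>2)) (at t)"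
      using c by (intro DERIV_cmult DERIV_tan) simp
    from DERIV_diff[OF DERIV_const[of "pi / 2"] DERIV_chain2[OF DERIV_arctan this]]
    have "((\<lambda>t. pi / 2 - arctan (k' * tan t)) has_field_derivative
        - (k' / (cos t)\<^sup>2 / (D / (cos t)\<^sup>2))) (at t)"
      unfolding 1 using c by (simp add: e)
    from DERIV_chain2[OF has_field_derivative_ellipticF[OF k0 k(2), of "pi / 2 - arctan (k' * tan t)", unfolded 2] this]
    have "((\<lambda>t. ellipticF (pi / 2 - arctan (k' * tan t)) k) has_field_derivative
        (1 / sqrt (k'\<^sup>2 / D)) * (- (k' / (cos t)\<^sup>2 / (D / (cos t)\<^sup>2)))) (at t)" .
    also have "(1 / sqrt (k'\<^sup>2 / D)) * (- (k' / (cos t)\<^sup>2 / (D / (cos t)\<^sup>2))) = - (1 / sqrt D)"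
    proof -
      have "sqrt D * sqrt D = D" using D by simp
      then show ?thesis using c k' D by (simp add: real_sqrt_divide field_simps)
    qed
    finally have "((\<lambda>t. ellipticF (pi / 2 - arctan (k' * tan t)) k) has_field_derivative - (1 / sqrt D)) (at t)" .
    from DERIV_add[OF this has_field_derivative_ellipticF[OF k0 k(2), of t]]
    show ?thesis by (simp add: g_def D_def)
  qed
  obtain c where c: "\<And>t. t \<in> {-(pi/2)<..<pi/2} \<Longrightarrow> g t = c"
    using has_field_derivative_zero_constant[OF _ has_field_derivative_at_within[OF D], of "{-(pi/2)<..<pi/2}"]
    by (auto simp: convex_real_interval)
  have "g \<phi> = g 0" using \<phi> c[of \<phi>] c[of 0] by simp
  then show ?thesis by (simp add: g_def k'_def ellipticK_def)
qed

lemma jacobi_am_quarter_minus: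
  assumes k: "0 < k" "k < 1" and "\<bar>jacobi_am v k\<bar> < pi / 2"
  shows "jacobi_am (ellipticK k - v) k = pi / 2 - arctan (compl_modulus k * tan (jacobi_am v k))"
proof (rule jacobi_am_eqI)
  show "ellipticF (pi / 2 - arctan (compl_modulus k * tan (jacobi_am v k))) k = ellipticK k - v"
    using assms ellipticF_jacobi_am[of k v] by (subst ellipticF_reflect) auto
qed (use k in auto)

lemma cn_pos: "\<bar>jacobi_am v k\<bar> < pi / 2 \<Longrightarrow> 0 < cn v k"
  by (auto simp: cn_def intro!: cos_gt_zero_pi)

lemma cn_square: "(cn v k)\<^sup>2 = 1 - (sn v k)\<^sup>2"
  by (simp add: sn_def cn_def cos_squared_eq)

lemma dn_square:
  assumes "0 \<le> k" "k < 1" shows "(dn v k)\<^sup>2 = 1 - k\<^sup>2 * (sn v k)\<^sup>2"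
  using one_minus_modulus_sin_pos[OF assms, of "jacobi_am v k"] by (simp add: dn_def sn_def)

lemma dn_pos:
  assumes "0 \<le> k" "k < 1" shows "0 < dn v k"
  using one_minus_modulus_sin_pos[OF assms, of "jacobi_am v k"] by (simp add: dn_def sn_def)

lemma jacobi_quarter_minus:
  assumes k: "0 < k" "k < 1" and am: "\<bar>jacobi_am v k\<bar> < pi / 2"
  shows "sn (ellipticK k - v) k = cn v k / dn v k"
    and "cn (ellipticK k - v) k = compl_modulus k * sn v k / dn v k"
    and "dn (ellipticK k - v) k = compl_modulus k / dn v k"
proof -
  define k' where "k' = compl_modulus k"
  have k': "0 < k'" "k'\<^sup>2 = 1 - k\<^sup>2"
    using k compl_modulus_bounds[of k] compl_modulus_square[of k] by (auto simp: k'_def)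
  have c: "0 < cn v k" by (rule cn_pos[OF am])
  have d: "0 < dn v k" "(dn v k)\<^sup>2 = 1 - k\<^sup>2 * (sn v k)\<^sup>2" using k by (auto intro: dn_pos dn_square)
  have tan: "tan (jacobi_am v k) = sn v k / cn v k" by (simp add: tan_def sn_def cn_def)
  have "1 + (k' * sn v k / cn v k)\<^sup>2 = (dn v k / cn v k)\<^sup>2"
    using c cn_square[of v k] by (simp add: d(2) k'(2) power_divide power_mult_distrib field_simps)
  then have root: "sqrt (1 + (k' * sn v k / cn v k)\<^sup>2) = dn v k / cn v k"
    using c d by simp
  show 1: "sn (ellipticK k - v) k = cn v k / dn v k"
    using jacobi_am_quarter_minus[OF k am]
    by (simp add: sn_def[of "ellipticK k - v"] sin_diff cos_arctan tan root flip: k'_def)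
  show "cn (ellipticK k - v) k = compl_modulus k * sn v k / dn v k"
    using jacobi_am_quarter_minus[OF k am] c
    by (simp add: cn_def[of "ellipticK k - v"] cos_diff sin_arctan tan root flip: k'_def)
  have "1 - k\<^sup>2 * (cn v k / dn v k)\<^sup>2 = (k' / dn v k)\<^sup>2"
    using d(1) by (simp add: k'(2) power_divide field_simps) (simp add: d(2) cn_square algebra_simps)
  then show "dn (ellipticK k - v) k = compl_modulus k / dn v k"
    using k' d(1) by (simp add: dn_def[of "ellipticK k - v"] 1 flip: k'_def)
qed

text \<open>
  The amplitude at \<open>K/2\<close> is the fixed point of the reflection, that is, \<open>tan\<^sup>2 \<phi> = 1 / k'\<close>.
\<close>

lemma jacobi_half_quarter:
  assumes k: "0 < k" "k < 1"
  shows "sn (ellipticK k / 2) k = 1 / sqrt (1 + compl_modulus k)"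
    and "cn (ellipticK k / 2) k = sqrt (compl_modulus k) / sqrt (1 + compl_modulus k)"
    and "dn (ellipticK k / 2) k = sqrt (compl_modulus k)"
proof -
  define k' where "k' = compl_modulus k"
  have k': "0 < k'" "k'\<^sup>2 = 1 - k\<^sup>2"
    using k compl_modulus_bounds[of k] compl_modulus_square[of k] by (auto simp: k'_def)
  define \<phi> where "\<phi> = arctan (1 / sqrt k')"
  have \<phi>: "-(pi/2) < \<phi>" "\<phi> < pi/2" using arctan_bounded by (auto simp: \<phi>_def)
  have "k' * tan \<phi> = sqrt k'" using k' by (simp add: \<phi>_def tan_arctan real_div_sqrt)
  moreover have "pi / 2 - arctan (sqrt k') = \<phi>"
    using k' arctan_inverse[of "1 / sqrt k'"] by (simp add: \<phi>_def)
  ultimately have "ellipticF \<phi> k = ellipticK k - ellipticF \<phi> k"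
    using ellipticF_reflect[OF k \<phi>] by (simp flip: k'_def)
  then have am: "jacobi_am (ellipticK k / 2) k = \<phi>"
    using k by (intro jacobi_am_eqI) auto
  have root: "sqrt (1 + 1 / k') = sqrt (1 + k') / sqrt k'"
    using k' by (simp add: add_divide_distrib flip: real_sqrt_divide)
  show 1: "sn (ellipticK k / 2) k = 1 / sqrt (1 + compl_modulus k)"
    using k' by (simp add: sn_def am \<phi>_def sin_arctan power_divide root flip: k'_def)
  show "cn (ellipticK k / 2) k = sqrt (compl_modulus k) / sqrt (1 + compl_modulus k)"
    using k' by (simp add: cn_def am \<phi>_def cos_arctan power_divide root flip: k'_def)
  have "1 - k\<^sup>2 * (1 / sqrt (1 + k'))\<^sup>2 = k'"
    using k' by (simp add: power_divide field_simps power2_eq_square)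
  then show "dn (ellipticK k / 2) k = sqrt (compl_modulus k)"
    by (simp add: dn_def 1 flip: k'_def)
qed

text \<open>
  Along the Gudermannian \<open>arctan (sinh v)\<close>, which is the amplitude of modulus one, the elliptic
  integral has derivative \<open>1 / sqrt (1 + \<epsilon>\<^sup>2 sinh\<^sup>2 v)\<close> with respect to \<open>v\<close>. It therefore differs from \<open>v\<close>
  by at most \<open>\<bar>v\<bar> \<epsilon>\<^sup>2 sinh\<^sup>2 v\<close>, and \<open>ellipticF_expanding_abs\<close> carries this bound over to the amplitude. The
  factor \<open>\<bar>v\<bar>\<close> gives an additional order for small arguments.
\<close>

lemma jacobi_am_near_gudermannian:
  assumes \<epsilon>: "0 < \<epsilon>" "\<epsilon> < 1"
  shows "\<bar>jacobi_am v (compl_modulus \<epsilon>) - arctan (sinh v)\<bar> \<le> \<bar>v\<bar> * (\<epsilon>\<^sup>2 * (sinh v)\<^sup>2)"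
proof -
  define k where "k = compl_modulus \<epsilon>"
  have k: "0 \<le> k" "k < 1" "k\<^sup>2 = 1 - \<epsilon>\<^sup>2"
    using \<epsilon> compl_modulus_bounds[of \<epsilon>] compl_modulus_square[of \<epsilon>] by (auto simp: k_def)
  define G where "G = (\<lambda>v. ellipticF (arctan (sinh v)) k)"
  have D: "(G has_field_derivative 1 / sqrt (1 + \<epsilon>\<^sup>2 * (sinh t)\<^sup>2)) (at t)" for t
  proof -
    have pos: "0 < 1 + (sinh t)\<^sup>2" by (simp add: add_pos_nonneg)
    have "1 - k\<^sup>2 * (sin (arctan (sinh t)))\<^sup>2 = (1 + \<epsilon>\<^sup>2 * (sinh t)\<^sup>2) / (cosh t)\<^sup>2"
      unfolding k(3) by (simp add: sin_arctan power_divide cosh_square_eq field_simps pos[THEN less_imp_neq, symmetric])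
    then have root: "1 / sqrt (1 - k\<^sup>2 * (sin (arctan (sinh t)))\<^sup>2) = cosh t / sqrt (1 + \<epsilon>\<^sup>2 * (sinh t)\<^sup>2)"
      by (simp add: real_sqrt_divide)
    have "((\<lambda>v. arctan (sinh v)) has_field_derivative 1 / cosh t) (at t)"
      using pos cosh_square_eq[of t]
      by (auto intro!: derivative_eq_intros simp: divide_simps) (auto simp: power2_eq_square)
    from DERIV_chain2[OF has_field_derivative_ellipticF[OF k(1,2)] this]
    show ?thesis unfolding G_def root by simp
  qed
  have slope: "\<bar>1 / sqrt (1 + \<epsilon>\<^sup>2 * (sinh t)\<^sup>2) - 1\<bar> \<le> \<epsilon>\<^sup>2 * (sinh v)\<^sup>2" if t: "\<bar>t\<bar> \<le> \<bar>v\<bar>" for t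
  proof -
    define y where "y = \<epsilon>\<^sup>2 * (sinh t)\<^sup>2"
    have y: "0 \<le> y" by (simp add: y_def)
    have "1 \<le> sqrt (1 + y)" "sqrt (1 + y) \<le> 1 + y" using y by (auto intro: real_le_lsqrt simp: power2_eq_square algebra_simps)
    moreover have "1 - 1 / w \<le> w - 1" if "1 \<le> w" for w :: real
      using that divide_left_mono[of 1 w "w - 1"] by (simp add: diff_divide_distrib)
    ultimately have "\<bar>1 / sqrt (1 + y) - 1\<bar> \<le> y" by fastforce
    moreover have "\<bar>sinh t\<bar> \<le> \<bar>sinh v\<bar>" using t by (simp flip: sinh_real_abs)
    then have "y \<le> \<epsilon>\<^sup>2 * (sinh v)\<^sup>2" unfolding y_def by (intro mult_left_mono) (auto simp: abs_le_square_iff)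
    ultimately show ?thesis unfolding y_def by linarith
  qed
  have D': "((\<lambda>v. G v - v) has_field_derivative 1 / sqrt (1 + \<epsilon>\<^sup>2 * (sinh t)\<^sup>2) - 1) (at t within {-\<bar>v\<bar>..\<bar>v\<bar>})" for t
    by (intro has_field_derivative_at_within[OF DERIV_diff[OF D DERIV_ident]])
  have "norm ((G v - v) - (G 0 - 0)) \<le> \<epsilon>\<^sup>2 * (sinh v)\<^sup>2 * norm (v - 0)"
    by (rule field_differentiable_bound[OF _ D']) (use slope in auto)
  then have "\<bar>G v - v\<bar> \<le> \<bar>v\<bar> * (\<epsilon>\<^sup>2 * (sinh v)\<^sup>2)"
    by (simp add: G_def mult.commute)
  moreover have "\<bar>jacobi_am v k - arctan (sinh v)\<bar> \<le> \<bar>v - G v\<bar>"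
    using ellipticF_expanding_abs[OF k(1,2), of "jacobi_am v k" "arctan (sinh v)"]
    by (simp add: ellipticF_jacobi_am[OF k(1,2)] G_def)
  ultimately show ?thesis unfolding k_def by linarith
qed

section \<open>The elliptic sine on the line of imaginary part K'/2\<close>

text \<open>
  The functions of the imaginary part \<open>\<plusminus>K'/2\<close> have modulus \<open>q'\<close>, so they are given by
  \<open>jacobi_half_quarter\<close> with \<open>q\<close> in the role of the complementary modulus. The sign \<open>\<sigma>\<close> covers the
  denominators of both ring equations.
\<close>

lemma csn_half_lattice:
  fixes a q \<sigma> :: real
  assumes q: "0 < q" "q < 1" and \<sigma>: "\<sigma> = 1 \<or> \<sigma> = -1"
  defines "s \<equiv> sn (a / 2) q" and "c \<equiv> cn (a / 2) q" and "d \<equiv> dn (a / 2) q"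
  shows "csn ((of_real a + of_real \<sigma> * (\<i> * of_real (ellipticK' q))) / 2) q
     = of_real (1 / (sqrt q * (1 + q * s\<^sup>2))) * Complex (s * (1 + q)) (\<sigma> * (c * d))"
proof -
  define k where "k = compl_modulus q"
  have k: "0 < k" "k < 1" "compl_modulus k = q"
    using q compl_modulus_bounds[of q] compl_modulus_compl_modulus[of q] by (auto simp: k_def)
  define y where "y = ellipticK k / 2"
  have y: "sn y k = 1 / sqrt (1 + q)" "cn y k = sqrt q / sqrt (1 + q)" "dn y k = sqrt q"
    using jacobi_half_quarter[OF k(1,2)] by (auto simp: y_def k(3))
  have y': "sn (\<sigma> * y) k = \<sigma> * (1 / sqrt (1 + q))" "cn (\<sigma> * y) k = sqrt q / sqrt (1 + q)" "dn (\<sigma> * y) k = sqrt q"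
    using \<sigma> y jacobi_am_minus[of k y] k by (auto simp: sn_def cn_def dn_def)
  define z where "z = (of_real a + of_real \<sigma> * (\<i> * of_real (ellipticK' q))) / 2"
  have z: "Re z = a / 2" "Im z = \<sigma> * y" by (auto simp: z_def y_def ellipticK'_def k_def)
  have s2: "\<sigma>\<^sup>2 = 1" using \<sigma> by auto
  have "csn z q = Complex (s * sqrt q) (c * d * (\<sigma> * (1 / sqrt (1 + q))) * (sqrt q / sqrt (1 + q)))
        / of_real ((sqrt q / sqrt (1 + q))\<^sup>2 + q\<^sup>2 * s\<^sup>2 * (\<sigma> * (1 / sqrt (1 + q)))\<^sup>2)"
    unfolding csn_def Let_def z k_def[symmetric] y' s_def c_def d_def ..
  also have "(sqrt q / sqrt (1 + q))\<^sup>2 + q\<^sup>2 * s\<^sup>2 * (\<sigma> * (1 / sqrt (1 + q)))\<^sup>2 = q * (1 + q * s\<^sup>2) / (1 + q)"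
    using q by (simp add: power_divide power_mult_distrib s2) (simp add: algebra_simps power2_eq_square flip: add_divide_distrib)
  also have "Complex (s * sqrt q) (c * d * (\<sigma> * (1 / sqrt (1 + q))) * (sqrt q / sqrt (1 + q)))
       = of_real (sqrt q / (1 + q)) * Complex (s * (1 + q)) (\<sigma> * (c * d))"
    using q by (simp add: complex_eq_iff field_simps)
  also have "\<dots> / of_real (q * (1 + q * s\<^sup>2) / (1 + q)) =
       of_real (sqrt q / (1 + q) / (q * (1 + q * s\<^sup>2) / (1 + q))) * Complex (s * (1 + q)) (\<sigma> * (c * d))"
    by (simp only: of_real_divide times_divide_eq_left)
  also have "sqrt q / (1 + q) / (q * (1 + q * s\<^sup>2) / (1 + q)) = 1 / (sqrt q * (1 + q * s\<^sup>2))"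
  proof -
    have "0 < 1 + q * s\<^sup>2" using q by (simp add: add_pos_nonneg)
    moreover have "sqrt q * sqrt q = q" using q by simp
    ultimately show ?thesis using q by (simp add: divide_simps) (simp add: algebra_simps)?
  qed
  finally show ?thesis unfolding z_def .
qed

lemma cmod_csn_half_lattice:
  assumes q: "0 < q" "q < 1" and \<sigma>: "\<sigma> = 1 \<or> \<sigma> = -1"
  shows "cmod (csn ((of_real a + of_real \<sigma> * (\<i> * of_real (ellipticK' q))) / 2) q) = 1 / sqrt q"
proof -
  define s c d where "s = sn (a / 2) q" and "c = cn (a / 2) q" and "d = dn (a / 2) q"
  have cd: "c\<^sup>2 = 1 - s\<^sup>2" "d\<^sup>2 = 1 - q\<^sup>2 * s\<^sup>2"
    using q cn_square dn_square[of q] by (auto simp: s_def c_def d_def)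
  have pos: "0 < 1 + q * s\<^sup>2" using q by (simp add: add_pos_nonneg)
  have "\<sigma>\<^sup>2 = 1" using \<sigma> by auto
  then have "(s * (1 + q))\<^sup>2 + (\<sigma> * (c * d))\<^sup>2 = (1 + q * s\<^sup>2)\<^sup>2"
    by (simp add: power_mult_distrib cd) (simp add: algebra_simps power2_eq_square)
  then have "cmod (Complex (s * (1 + q)) (\<sigma> * (c * d))) = 1 + q * s\<^sup>2"
    using pos by (simp add: cmod_def)
  then show ?thesis
    unfolding csn_half_lattice[OF q \<sigma>] norm_mult norm_of_real s_def[symmetric] c_def[symmetric] d_def[symmetric]
    using pos q by (simp add: abs_of_pos)
qed

section \<open>Agreement up to a power of the mesh size\<close>

text \<open>
  Congruence modulo \<open>O(\<epsilon>\<^sup>n)\<close> as \<open>\<epsilon>\<close> decreases to zero. All expansions are computed in this calculus.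
\<close>

definition agree :: "nat \<Rightarrow> (real \<Rightarrow> real) \<Rightarrow> (real \<Rightarrow> real) \<Rightarrow> bool" where
  "agree n f g \<longleftrightarrow> (\<lambda>\<epsilon>. f \<epsilon> - g \<epsilon>) \<in> O[at_right 0](\<lambda>\<epsilon>. \<epsilon> ^ n)"

lemma bigo_power_mono:
  assumes "f \<in> O[at_right 0](\<lambda>\<epsilon>::real. \<epsilon> ^ n)" "m \<le> n"
  shows "f \<in> O[at_right 0](\<lambda>\<epsilon>. \<epsilon> ^ m)"
proof (rule landau_o.big_trans[OF assms(1)])
  have "\<forall>\<^sub>F \<epsilon> in at_right (0::real). 0 < \<epsilon> \<and> \<epsilon> < 1"
    by (auto simp: eventually_at_right_field intro: exI[of _ 1])
  then show "(\<lambda>\<epsilon>::real. \<epsilon> ^ n) \<in> O[at_right 0](\<lambda>\<epsilon>. \<epsilon> ^ m)"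
    by (intro bigoI[where c=1]) (auto elim!: eventually_mono intro!: power_decreasing assms(2))
qed

lemma agree_refl [simp]: "agree n f f"
  by (simp add: agree_def)

lemma agree_sym: "agree n f g \<Longrightarrow> agree n g f"
  unfolding agree_def by (subst landau_o.big.uminus_in_iff [symmetric]) simp

lemma agree_trans [trans]: "agree n f g \<Longrightarrow> agree n g h \<Longrightarrow> agree n f h"
  unfolding agree_def by (drule (1) sum_in_bigo(1)) simp

lemma agree_mono: "agree n f g \<Longrightarrow> m \<le> n \<Longrightarrow> agree m f g"
  unfolding agree_def by (rule bigo_power_mono)

lemma agree_cong:
  assumes "agree n f g" "\<forall>\<^sub>F \<epsilon> in at_right 0. f \<epsilon> = f' \<epsilon>" "\<forall>\<^sub>F \<epsilon> in at_right 0. g \<epsilon> = g' \<epsilon>"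
  shows "agree n f' g'"
proof -
  have "\<forall>\<^sub>F \<epsilon> in at_right 0. f \<epsilon> - g \<epsilon> = f' \<epsilon> - g' \<epsilon>" using assms(2,3) by eventually_elim simp
  from landau_o.big.in_cong[OF this] show ?thesis using assms(1) unfolding agree_def by simp
qed

lemma agree_add: "agree n f f' \<Longrightarrow> agree n g g' \<Longrightarrow> agree n (\<lambda>\<epsilon>. f \<epsilon> + g \<epsilon>) (\<lambda>\<epsilon>. f' \<epsilon> + g' \<epsilon>)"
  unfolding agree_def by (drule (1) sum_in_bigo(1)) (simp add: algebra_simps)

lemma agree_diff: "agree n f f' \<Longrightarrow> agree n g g' \<Longrightarrow> agree n (\<lambda>\<epsilon>. f \<epsilon> - g \<epsilon>) (\<lambda>\<epsilon>. f' \<epsilon> - g' \<epsilon>)"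
  unfolding agree_def by (drule (1) sum_in_bigo(2)) (simp add: algebra_simps)

lemma agree_sum:
  "(\<And>k. k \<in> A \<Longrightarrow> agree n (f k) (g k)) \<Longrightarrow> agree n (\<lambda>\<epsilon>. \<Sum>k\<in>A. f k \<epsilon>) (\<lambda>\<epsilon>. \<Sum>k\<in>A. g k \<epsilon>)"
  unfolding agree_def by (simp add: big_sum_in_bigo flip: sum_subtractf)

lemma agree_scale:
  assumes "agree n f g" "h \<in> O[at_right 0](\<lambda>\<epsilon>. \<epsilon> ^ m)"
  shows "agree (m + n) (\<lambda>\<epsilon>. h \<epsilon> * f \<epsilon>) (\<lambda>\<epsilon>. h \<epsilon> * g \<epsilon>)"
  using landau_o.big.mult[OF assms(2) assms(1)[unfolded agree_def]]
  by (simp add: agree_def algebra_simps power_add)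

lemma tendsto_imp_bigo_1: "(f \<longlongrightarrow> (L::real)) F \<Longrightarrow> f \<in> O[F](\<lambda>_. 1)"
  by (rule bigoI_tendsto[where c=L]) simp_all

lemma agree_cmult: "agree n f g \<Longrightarrow> agree n (\<lambda>\<epsilon>. c * f \<epsilon>) (\<lambda>\<epsilon>. c * g \<epsilon>)"
  using agree_scale[of n f g "\<lambda>_. c" 0] by simp

lemma agree_mult:
  assumes "agree n f f'" "agree n g g'" "(f \<longlongrightarrow> a) (at_right 0)" "(g' \<longlongrightarrow> b) (at_right 0)"
  shows "agree n (\<lambda>\<epsilon>. f \<epsilon> * g \<epsilon>) (\<lambda>\<epsilon>. f' \<epsilon> * g' \<epsilon>)"
proof -
  have "agree (0 + n) (\<lambda>\<epsilon>. f \<epsilon> * g \<epsilon>) (\<lambda>\<epsilon>. f \<epsilon> * g' \<epsilon>)"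
    using assms by (intro agree_scale) (auto intro: tendsto_imp_bigo_1)
  moreover have "agree (0 + n) (\<lambda>\<epsilon>. g' \<epsilon> * f \<epsilon>) (\<lambda>\<epsilon>. g' \<epsilon> * f' \<epsilon>)"
    using assms by (intro agree_scale) (auto intro: tendsto_imp_bigo_1)
  then have "agree (0 + n) (\<lambda>\<epsilon>. f \<epsilon> * g' \<epsilon>) (\<lambda>\<epsilon>. f' \<epsilon> * g' \<epsilon>)"
    by (simp only: mult.commute[of "g' _"])
  ultimately have "agree (0 + n) (\<lambda>\<epsilon>. f \<epsilon> * g \<epsilon>) (\<lambda>\<epsilon>. f' \<epsilon> * g' \<epsilon>)"
    by (rule agree_trans)
  then show ?thesis by simp
qed

lemma power_tendsto_0: "0 < n \<Longrightarrow> ((\<lambda>\<epsilon>::real. \<epsilon> ^ n) \<longlongrightarrow> 0) (at_right 0)"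
  by (rule tendsto_eq_intros refl | simp)+

lemma bigo_power_tendsto_0:
  assumes "f \<in> O[at_right 0](\<lambda>\<epsilon>::real. \<epsilon> ^ n)" "0 < n"
  shows "(f \<longlongrightarrow> (0::real)) (at_right 0)"
proof -
  have "(\<lambda>\<epsilon>::real. \<epsilon> ^ n) \<in> o[at_right 0](\<lambda>_. 1)"
    using power_tendsto_0[OF assms(2)] by (intro smalloI_tendsto) auto
  from landau_o.big_small_trans[OF assms(1) this] show ?thesis
    by (auto dest: smalloD_tendsto)
qed

lemma agree_tendsto:
  assumes "agree n f g" "0 < n" "(g \<longlongrightarrow> L) (at_right 0)"
  shows "(f \<longlongrightarrow> L) (at_right 0)"
  using tendsto_add[OF bigo_power_tendsto_0[OF assms(1)[unfolded agree_def] assms(2)] assms(3)] by simp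

text \<open>
  Near the common limit a continuously differentiable function is Lipschitz continuous.
\<close>

lemma agree_compose:
  assumes fg: "agree n f g" and f: "(f \<longlongrightarrow> L) (at_right 0)" and g: "(g \<longlongrightarrow> L) (at_right 0)"
    and S: "open S" "L \<in> S" "\<And>x. x \<in> S \<Longrightarrow> (F has_field_derivative F' x) (at x)" "isCont F' L"
  shows "agree n (\<lambda>\<epsilon>. F (f \<epsilon>)) (\<lambda>\<epsilon>. F (g \<epsilon>))"
proof -
  define B where "B = \<bar>F' L\<bar> + 1"
  have "\<forall>\<^sub>F x in nhds L. \<bar>F' x\<bar> < B"
    using S(4) by (intro order_tendstoD(2)[where y="\<bar>F' L\<bar>"])
      (auto simp: B_def isCont_def tendsto_nhds_iff intro!: tendsto_rabs)
  moreover have "\<forall>\<^sub>F x in nhds L. x \<in> S" using S by (intro eventually_nhds_in_open)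
  ultimately have "\<forall>\<^sub>F x in nhds L. \<bar>F' x\<bar> < B \<and> x \<in> S" by eventually_elim simp
  then obtain d where d: "0 < d" "\<And>x. dist x L < d \<Longrightarrow> \<bar>F' x\<bar> < B \<and> x \<in> S"
    by (auto simp: eventually_nhds_metric)
  have lip: "\<bar>F x - F y\<bar> \<le> B * \<bar>x - y\<bar>" if "dist x L < d" "dist y L < d" for x y
    using field_differentiable_bound[of "ball L d" F F' B x y] that d S(3)
    by (auto simp: dist_commute less_imp_le has_field_derivative_at_within)
  have "\<forall>\<^sub>F \<epsilon> in at_right 0. dist (f \<epsilon>) L < d" "\<forall>\<^sub>F \<epsilon> in at_right 0. dist (g \<epsilon>) L < d"
    using f g d(1) by (auto dest: tendstoD)
  then have "\<forall>\<^sub>F \<epsilon> in at_right 0. norm (F (f \<epsilon>) - F (g \<epsilon>)) \<le> B * norm (f \<epsilon> - g \<epsilon>)"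
    by eventually_elim (use lip in auto)
  then have "(\<lambda>\<epsilon>. F (f \<epsilon>) - F (g \<epsilon>)) \<in> O[at_right 0](\<lambda>\<epsilon>. f \<epsilon> - g \<epsilon>)" by (rule bigoI)
  then show ?thesis using fg unfolding agree_def by (rule landau_o.big_trans)
qed

lemma agree_inverse:
  assumes "agree n f g" "(f \<longlongrightarrow> L) (at_right 0)" "(g \<longlongrightarrow> L) (at_right 0)" "L \<noteq> 0"
  shows "agree n (\<lambda>\<epsilon>. inverse (f \<epsilon>)) (\<lambda>\<epsilon>. inverse (g \<epsilon>))"
proof (rule agree_compose[OF assms(1-3), of "-{0}" _ "\<lambda>x. - (inverse x ^ Suc (Suc 0))"])
  show "isCont (\<lambda>x. - (inverse x ^ Suc (Suc 0))) L" using assms(4) by (intro continuous_intros)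
qed (use assms(4) in \<open>auto intro!: derivative_eq_intros\<close>)

lemma agree_divide:
  assumes "agree n f f'" "agree n g g'" "(f \<longlongrightarrow> a) (at_right 0)"
    "(g \<longlongrightarrow> b) (at_right 0)" "(g' \<longlongrightarrow> b) (at_right 0)" "b \<noteq> 0"
  shows "agree n (\<lambda>\<epsilon>. f \<epsilon> / g \<epsilon>) (\<lambda>\<epsilon>. f' \<epsilon> / g' \<epsilon>)"
  unfolding divide_inverse
  by (rule agree_mult[OF assms(1) agree_inverse[OF assms(2,4,5,6)] assms(3) tendsto_inverse[OF assms(5,6)]])

text \<open>
  The inner function may vanish at arbitrarily small \<open>\<epsilon>\<close>, where the punctured filter at zero says
  nothing about \<open>f\<close>; this is why the value at zero is prescribed.
\<close>

lemma bigo_compose_at_0: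
  fixes f a :: "real \<Rightarrow> real"
  assumes f: "f \<in> O[at 0](\<lambda>x. x ^ n)" "f 0 = 0" and a: "a \<in> O[at_right 0](\<lambda>\<epsilon>. \<epsilon> ^ m)" "0 < m"
  shows "(\<lambda>\<epsilon>. f (a \<epsilon>)) \<in> O[at_right 0](\<lambda>\<epsilon>. \<epsilon> ^ (m * n))"
proof -
  from f(1) obtain c where c: "0 < c" "\<forall>\<^sub>F x in at 0. norm (f x) \<le> c * norm (x ^ n)"
    by (elim landau_o.bigE)
  then have "\<forall>\<^sub>F x in nhds 0. x \<noteq> 0 \<longrightarrow> norm (f x) \<le> c * norm (x ^ n)"
    by (simp add: eventually_at_filter)
  then have "\<forall>\<^sub>F \<epsilon> in at_right 0. a \<epsilon> \<noteq> 0 \<longrightarrow> norm (f (a \<epsilon>)) \<le> c * norm (a \<epsilon> ^ n)"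
    using bigo_power_tendsto_0[OF a] unfolding filterlim_iff by blast
  then have "\<forall>\<^sub>F \<epsilon> in at_right 0. norm (f (a \<epsilon>)) \<le> c * norm (a \<epsilon> ^ n)"
  proof eventually_elim
    case (elim \<epsilon>)
    then show ?case using c(1) f(2) by (cases "a \<epsilon> = 0") auto
  qed
  then have "(\<lambda>\<epsilon>. f (a \<epsilon>)) \<in> O[at_right 0](\<lambda>\<epsilon>. a \<epsilon> ^ n)" by (rule bigoI)
  also have "(\<lambda>\<epsilon>. a \<epsilon> ^ n) \<in> O[at_right 0](\<lambda>\<epsilon>. (\<epsilon> ^ m) ^ n)" by (rule landau_o.big_power[OF a(1)])
  finally show ?thesis by (simp add: power_mult)
qed

lemma agree_compose_at_0:
  assumes "(\<lambda>x. f x - g x) \<in> O[at 0](\<lambda>x. x ^ n)" "f 0 = g 0"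
    and "a \<in> O[at_right 0](\<lambda>\<epsilon>. \<epsilon>)"
  shows "agree n (\<lambda>\<epsilon>. f (a \<epsilon>)) (\<lambda>\<epsilon>. g (a \<epsilon>))"
  using bigo_compose_at_0[OF assms(1), of a 1] assms(2,3) by (simp add: agree_def)

lemma agree_imp_bigo:
  assumes "agree n f g" "g \<in> O[at_right 0](\<lambda>\<epsilon>. \<epsilon> ^ n)"
  shows "f \<in> O[at_right 0](\<lambda>\<epsilon>. \<epsilon> ^ n)"
  using sum_in_bigo(1)[OF assms(1)[unfolded agree_def] assms(2)] by simp

section \<open>Taylor expansion on the grid\<close>

text \<open>
  The first-order terms cancel between the two sides, and a bounded third derivative controls the rest.
\<close>

lemma second_difference_agree:
  fixes g :: "real \<Rightarrow> real"
  assumes d: "0 < d"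
    and D: "\<And>t. \<bar>t\<bar> < d \<Longrightarrow> (g has_field_derivative g1 t) (at t)"
      "\<And>t. \<bar>t\<bar> < d \<Longrightarrow> (g1 has_field_derivative g2 t) (at t)"
      "\<And>t. \<bar>t\<bar> < d \<Longrightarrow> (g2 has_field_derivative g3 t) (at t)"
    and g3: "isCont g3 0"
  shows "agree 3 (\<lambda>\<epsilon>. (g \<epsilon> - g 0) + (g (-\<epsilon>) - g 0)) (\<lambda>\<epsilon>. \<epsilon>\<^sup>2 * g2 0)"
proof -
  define B where "B = \<bar>g3 0\<bar> + 1"
  have "\<forall>\<^sub>F x in nhds 0. \<bar>g3 x\<bar> < B"
    using g3 by (intro order_tendstoD(2)[where y="\<bar>g3 0\<bar>"])
      (auto simp: B_def isCont_def tendsto_nhds_iff intro!: tendsto_rabs)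
  then obtain d' where d': "0 < d'" "\<And>x. \<bar>x\<bar> < d' \<Longrightarrow> \<bar>g3 x\<bar> < B"
    by (auto simp: eventually_nhds_metric)
  define r where "r = min d d'"
  have r: "0 < r" "r \<le> d" "r \<le> d'" using d d'(1) by (auto simp: r_def)
  have taylor: "\<bar>g h - (g 0 + h * g1 0 + h\<^sup>2 / 2 * g2 0)\<bar> \<le> B * \<bar>h\<bar> ^ 3" if h: "\<bar>h\<bar> < r" "h \<noteq> 0" for h
  proof -
    define diff where "diff m = (if m = 0 then g else if m = 1 then g1 else if m = 2 then g2 else g3)" for m :: nat
    have "\<exists>t. (if h < 0 then h < t \<and> t < 0 else 0 < t \<and> t < h) \<and>
      g h = (\<Sum>m<3. (diff m 0 / fact m) * (h - 0)^m) + (diff 3 t / fact 3) * (h - 0)^3"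
      by (rule Taylor[where a="-\<bar>h\<bar>" and b="\<bar>h\<bar>"])
         (use h r D in \<open>auto simp: diff_def less_Suc_eq numeral_3_eq_3 numeral_2_eq_2\<close>)
    then obtain t where t: "\<bar>t\<bar> \<le> \<bar>h\<bar>"
      and "g h = (\<Sum>m<3. (diff m 0 / fact m) * (h - 0)^m) + (diff 3 t / fact 3) * (h - 0)^3"
      by (force split: if_splits)
    then have gh: "g h = g 0 + h * g1 0 + h\<^sup>2 / 2 * g2 0 + g3 t / 6 * h ^ 3"
      by (simp add: diff_def eval_nat_numeral)
    have "\<bar>g3 t\<bar> / 6 \<le> B" using d'(2)[of t] t h r by auto
    then have "\<bar>g3 t\<bar> / 6 * \<bar>h\<bar> ^ 3 \<le> B * \<bar>h\<bar> ^ 3" by (intro mult_right_mono) auto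
    then show ?thesis by (simp add: gh abs_mult power_abs)
  qed
  have "\<forall>\<^sub>F \<epsilon> in at_right (0::real). 0 < \<epsilon> \<and> \<epsilon> < r"
    using r(1) by (auto simp: eventually_at_right_field intro: exI[of _ r])
  then have "\<forall>\<^sub>F \<epsilon> in at_right 0. norm ((g \<epsilon> - g 0) + (g (-\<epsilon>) - g 0) - \<epsilon>\<^sup>2 * g2 0) \<le> (2 * B) * norm (\<epsilon> ^ 3)"
  proof eventually_elim
    case (elim \<epsilon>)
    then show ?case using taylor[of \<epsilon>] taylor[of "-\<epsilon>"] by (simp add: abs_le_iff)
  qed
  then show ?thesis unfolding agree_def by (rule bigoI)
qed

lemma partial_x_derivative:
  assumes "open D" "u differentiable_on D" "(x, y) \<in> D"
  shows "((\<lambda>t. u (t, y)) has_field_derivative partial_x u (x, y)) (at x)"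
proof -
  have "u differentiable at (x, y)" using assms by (simp add: differentiable_on_eq_differentiable_at)
  then obtain L where L: "(u has_derivative L) (at (x, y))" by (auto simp: differentiable_def)
  have "((\<lambda>t. (t, y)) has_derivative (\<lambda>h. (h, 0))) (at x)" by (auto intro!: derivative_eq_intros)
  from has_derivative_compose[OF this, of u L] L
  have "(\<lambda>t. u (t, y)) differentiable at x" by (auto simp: differentiable_def)
  then show ?thesis
    by (simp add: partial_x_def DERIV_deriv_iff_real_differentiable)
qed

lemma partial_y_derivative:
  assumes "open D" "u differentiable_on D" "(x, y) \<in> D"
  shows "((\<lambda>t. u (x, t)) has_field_derivative partial_y u (x, y)) (at y)"
proof -
  have "u differentiable at (x, y)" using assms by (simp add: differentiable_on_eq_differentiable_at)
  then obtain L where L: "(u has_derivative L) (at (x, y))" by (auto simp: differentiable_def)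
  have "((\<lambda>t. (x, t)) has_derivative (\<lambda>h. (0, h))) (at y)" by (auto intro!: derivative_eq_intros)
  from has_derivative_compose[OF this, of u L] L
  have "(\<lambda>t. u (x, t)) differentiable at y" by (auto simp: differentiable_def)
  then show ?thesis
    by (simp add: partial_y_def DERIV_deriv_iff_real_differentiable)
qed

lemma derivative_imp_increment_bigo:
  fixes g :: "real \<Rightarrow> real"
  assumes "(g has_field_derivative d) (at 0)"
  shows "(\<lambda>\<epsilon>. g \<epsilon> - g 0) \<in> O[at_right 0](\<lambda>\<epsilon>. \<epsilon>)"
proof (rule bigoI_tendsto)
  show "((\<lambda>\<epsilon>. (g \<epsilon> - g 0) / \<epsilon>) \<longlongrightarrow> d) (at_right 0)"
    using assms by (auto simp: DERIV_def intro: filterlim_mono at_le)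
  show "\<forall>\<^sub>F \<epsilon>::real in at_right 0. \<epsilon> \<noteq> 0" by (auto simp: eventually_at_filter)
qed

lemma stencil_neighbor_bigo:
  assumes D: "open D" "u differentiable_on D" "(x, y) \<in> D"
  shows "(\<lambda>\<epsilon>. stencil u x y \<epsilon> k - u (x, y)) \<in> O[at_right 0](\<lambda>\<epsilon>. \<epsilon>)"
proof -
  have x: "((\<lambda>\<epsilon>. u (x + c * \<epsilon>, y)) has_field_derivative partial_x u (x, y) * c) (at 0)" for c
    by (rule DERIV_chain2[where f="\<lambda>t. u (t, y)"])
       (use partial_x_derivative[OF D] in \<open>auto intro!: derivative_eq_intros\<close>)
  have y: "((\<lambda>\<epsilon>. u (x, y + c * \<epsilon>)) has_field_derivative partial_y u (x, y) * c) (at 0)" for c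
    by (rule DERIV_chain2[where f="\<lambda>t. u (x, t)"])
       (use partial_y_derivative[OF D] in \<open>auto intro!: derivative_eq_intros\<close>)
  show ?thesis
    using derivative_imp_increment_bigo[OF x[of 1]] derivative_imp_increment_bigo[OF x[of "-1"]]
      derivative_imp_increment_bigo[OF y[of 1]] derivative_imp_increment_bigo[OF y[of "-1"]]
    by (cases "k = 0"; cases "k = 1"; cases "k = 2"; cases "k = 3") (simp_all add: stencil_def)
qed

lemma stencil_sum_agree:
  assumes D: "open D" "smooth_on D u" "(x, y) \<in> D"
  shows "agree 3 (\<lambda>\<epsilon>. \<Sum>k=1..4. stencil u x y \<epsilon> k - u (x, y)) (\<lambda>\<epsilon>. \<epsilon>\<^sup>2 * laplacian u (x, y))"
proof -
  from D(1,3) obtain e where e: "0 < e" "ball (x, y) e \<subseteq> D" by (rule openE)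
  have near: "(x + t, y) \<in> D" "(x, y + t) \<in> D" if "\<bar>t\<bar> < e" for t
    using that e(2) by (auto simp: subset_eq dist_Pair_Pair dist_real_def)
  have Ck: "Ck_on 3 D u" using D(2) by (simp add: smooth_on_def)
  have x: "((\<lambda>t. v (x + t, y)) has_field_derivative partial_x v (x + t, y)) (at t)"
    if "v differentiable_on D" "\<bar>t\<bar> < e" for v t
    using DERIV_chain2[where f="\<lambda>s. v (s, y)" and g="\<lambda>t. x + t" and x=t and Db=1 and s=UNIV,
        OF partial_x_derivative[OF D(1) that(1) near(1)[OF that(2)]]]
    by (simp add: DERIV_cong[OF DERIV_add[OF DERIV_const DERIV_ident]])
  have y: "((\<lambda>t. v (x, y + t)) has_field_derivative partial_y v (x, y + t)) (at t)"
    if "v differentiable_on D" "\<bar>t\<bar> < e" for v t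
    using DERIV_chain2[where f="\<lambda>s. v (x, s)" and g="\<lambda>t. y + t" and x=t and Db=1 and s=UNIV,
        OF partial_y_derivative[OF D(1) that(1) near(2)[OF that(2)]]]
    by (simp add: DERIV_cong[OF DERIV_add[OF DERIV_const DERIV_ident]])
  have cont: "isCont (\<lambda>t. v (x + t, y)) 0" "isCont (\<lambda>t. v (x, y + t)) 0" if "continuous_on D v" for v
  proof -
    have "isCont v (x, y)" using that D by (simp add: continuous_on_eq_continuous_at)
    moreover have "isCont (\<lambda>t. (x + t, y)) 0" "isCont (\<lambda>t. (x, y + t)) 0"
      by (intro continuous_intros)+
    ultimately show "isCont (\<lambda>t. v (x + t, y)) 0" "isCont (\<lambda>t. v (x, y + t)) 0"
      using isCont_o2[of 0 "\<lambda>t. (x + t, y)" v] isCont_o2[of 0 "\<lambda>t. (x, y + t)" v]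
      by simp_all
  qed
  have "agree 3 (\<lambda>\<epsilon>. (u (x + \<epsilon>, y) - u (x + 0, y)) + (u (x + -\<epsilon>, y) - u (x + 0, y)))
      (\<lambda>\<epsilon>. \<epsilon>\<^sup>2 * partial_x (partial_x u) (x + 0, y))"
    using Ck e(1) by (intro second_difference_agree[OF e(1) x x x cont(1)]) (auto simp: eval_nat_numeral)
  moreover have "agree 3 (\<lambda>\<epsilon>. (u (x, y + \<epsilon>) - u (x, y + 0)) + (u (x, y + -\<epsilon>) - u (x, y + 0)))
      (\<lambda>\<epsilon>. \<epsilon>\<^sup>2 * partial_y (partial_y u) (x, y + 0))"
    using Ck e(1) by (intro second_difference_agree[OF e(1) y y y cont(2)]) (auto simp: eval_nat_numeral)
  ultimately show ?thesis
    by (rule agree_cong[OF agree_add])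
       (auto simp: stencil_def laplacian_def algebra_simps numeral_eq_Suc)
qed

section \<open>Elliptic functions of modulus close to one\<close>

lemma eventually_0_1: "\<forall>\<^sub>F \<epsilon> in at_right (0::real). 0 < \<epsilon> \<and> \<epsilon> < 1"
  by (auto simp: eventually_at_right_field intro: exI[of _ 1])

lemma arctan_sinh_sin_cos:
  fixes v :: real
  shows "sin (arctan (sinh v)) = tanh v" "cos (arctan (sinh v)) = 1 / cosh v"
  using cosh_square_eq[of v] real_sqrt_abs[of "cosh v"]
  by (auto simp: sin_arctan cos_arctan tanh_def add.commute)

lemma jacobi_am_bigo:
  "(\<lambda>\<epsilon>. jacobi_am (v \<epsilon>) (compl_modulus \<epsilon>) - arctan (sinh (v \<epsilon>)))
     \<in> O[at_right 0](\<lambda>\<epsilon>. \<epsilon>\<^sup>2 * (v \<epsilon> * (sinh (v \<epsilon>))\<^sup>2))"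
proof (rule bigoI)
  show "\<forall>\<^sub>F \<epsilon> in at_right 0. norm (jacobi_am (v \<epsilon>) (compl_modulus \<epsilon>) - arctan (sinh (v \<epsilon>)))
      \<le> 1 * norm (\<epsilon>\<^sup>2 * (v \<epsilon> * (sinh (v \<epsilon>))\<^sup>2))"
    using eventually_0_1
  proof eventually_elim
    case (elim \<epsilon>)
    then show ?case using jacobi_am_near_gudermannian[of \<epsilon> "v \<epsilon>"] by (simp add: abs_mult mult_ac)
  qed
qed

lemma jacobi_am_agree:
  assumes "(v \<longlongrightarrow> L) (at_right 0)"
  shows "agree 2 (\<lambda>\<epsilon>. jacobi_am (v \<epsilon>) (compl_modulus \<epsilon>)) (\<lambda>\<epsilon>. arctan (sinh (v \<epsilon>)))"
proof -
  have "(\<lambda>\<epsilon>. \<epsilon>\<^sup>2 * (v \<epsilon> * (sinh (v \<epsilon>))\<^sup>2)) \<in> O[at_right 0](\<lambda>\<epsilon>. \<epsilon>\<^sup>2 * 1)"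
    by (intro landau_o.big.mult landau_o.big_refl tendsto_imp_bigo_1[of _ "L * (sinh L)\<^sup>2"] tendsto_intros assms)
  then show ?thesis
    unfolding agree_def using landau_o.big_trans[OF jacobi_am_bigo] by simp
qed

lemma jacobi_limit_agree:
  assumes v: "(v \<longlongrightarrow> L) (at_right 0)"
  shows sn_agree: "agree 2 (\<lambda>\<epsilon>. sn (v \<epsilon>) (compl_modulus \<epsilon>)) (\<lambda>\<epsilon>. tanh (v \<epsilon>))"
    and cn_agree: "agree 2 (\<lambda>\<epsilon>. cn (v \<epsilon>) (compl_modulus \<epsilon>)) (\<lambda>\<epsilon>. 1 / cosh (v \<epsilon>))"
    and dn_agree: "agree 2 (\<lambda>\<epsilon>. dn (v \<epsilon>) (compl_modulus \<epsilon>)) (\<lambda>\<epsilon>. 1 / cosh (v \<epsilon>))"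
proof -
  have gd: "((\<lambda>\<epsilon>. arctan (sinh (v \<epsilon>))) \<longlongrightarrow> arctan (sinh L)) (at_right 0)"
    by (intro tendsto_intros v)
  have am: "((\<lambda>\<epsilon>. jacobi_am (v \<epsilon>) (compl_modulus \<epsilon>)) \<longlongrightarrow> arctan (sinh L)) (at_right 0)"
    by (rule agree_tendsto[OF jacobi_am_agree[OF v] _ gd]) simp
  have "agree 2 (\<lambda>\<epsilon>. sin (jacobi_am (v \<epsilon>) (compl_modulus \<epsilon>))) (\<lambda>\<epsilon>. sin (arctan (sinh (v \<epsilon>))))"
    by (rule agree_compose[OF jacobi_am_agree[OF v] am gd open_UNIV, where F'=cos]) (auto intro: DERIV_sin)
  then show sn: "agree 2 (\<lambda>\<epsilon>. sn (v \<epsilon>) (compl_modulus \<epsilon>)) (\<lambda>\<epsilon>. tanh (v \<epsilon>))"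
    by (simp add: sn_def arctan_sinh_sin_cos)
  have "agree 2 (\<lambda>\<epsilon>. cos (jacobi_am (v \<epsilon>) (compl_modulus \<epsilon>))) (\<lambda>\<epsilon>. cos (arctan (sinh (v \<epsilon>))))"
    by (rule agree_compose[OF jacobi_am_agree[OF v] am gd open_UNIV, where F'="\<lambda>x. - sin x"])
       (auto intro: DERIV_cos intro!: continuous_intros)
  then show "agree 2 (\<lambda>\<epsilon>. cn (v \<epsilon>) (compl_modulus \<epsilon>)) (\<lambda>\<epsilon>. 1 / cosh (v \<epsilon>))"
    by (simp add: cn_def arctan_sinh_sin_cos)
  have th: "((\<lambda>\<epsilon>. tanh (v \<epsilon>)) \<longlongrightarrow> tanh L) (at_right 0)"
    by (intro tendsto_intros v) simp
  have sn_lim: "((\<lambda>\<epsilon>. sn (v \<epsilon>) (compl_modulus \<epsilon>)) \<longlongrightarrow> tanh L) (at_right 0)"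
    by (rule agree_tendsto[OF sn _ th]) simp
  have 1: "agree 2 (\<lambda>\<epsilon>. (compl_modulus \<epsilon>)\<^sup>2) (\<lambda>\<epsilon>. 1)"
    by (rule agree_cong[of 2 "\<lambda>\<epsilon>. 1 - \<epsilon>\<^sup>2" "\<lambda>_. 1"])
       (auto simp: agree_def compl_modulus_square intro: eventually_mono[OF eventually_0_1])
  have 2: "agree 2 (\<lambda>\<epsilon>. 1 - (compl_modulus \<epsilon>)\<^sup>2 * (sn (v \<epsilon>) (compl_modulus \<epsilon>) * sn (v \<epsilon>) (compl_modulus \<epsilon>)))
     (\<lambda>\<epsilon>. 1 - 1 * (tanh (v \<epsilon>) * tanh (v \<epsilon>)))"
    by (intro agree_diff agree_refl agree_mult[OF 1 agree_mult[OF sn sn sn_lim th]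
          agree_tendsto[OF 1 _ tendsto_const] tendsto_mult[OF th th]]) simp
  have pos: "0 < 1 - 1 * (tanh L * tanh L)"
    using tanh_real_bounds[of L] by (auto simp: abs_square_less_1 power2_eq_square[symmetric])
  have lim: "((\<lambda>\<epsilon>. 1 - 1 * (tanh (v \<epsilon>) * tanh (v \<epsilon>))) \<longlongrightarrow> 1 - 1 * (tanh L * tanh L)) (at_right 0)"
    by (intro tendsto_intros th)
  have "agree 2 (\<lambda>\<epsilon>. sqrt (1 - (compl_modulus \<epsilon>)\<^sup>2 * (sn (v \<epsilon>) (compl_modulus \<epsilon>) * sn (v \<epsilon>) (compl_modulus \<epsilon>))))
     (\<lambda>\<epsilon>. sqrt (1 - 1 * (tanh (v \<epsilon>) * tanh (v \<epsilon>))))"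
    by (rule agree_compose[OF 2 agree_tendsto[OF 2 _ lim] lim, of "{0<..}" _ "\<lambda>x. inverse (sqrt x) / 2"])
       (use pos in \<open>auto intro!: DERIV_real_sqrt continuous_intros\<close>)
  moreover have "sqrt (1 - 1 * (tanh x * tanh x)) = 1 / cosh x" for x :: real
  proof -
    have "1 - 1 * (tanh x * tanh x) = ((cosh x)\<^sup>2 - (sinh x)\<^sup>2) / (cosh x)\<^sup>2"
      by (simp add: tanh_def diff_divide_distrib power2_eq_square)
    then have "1 - 1 * (tanh x * tanh x) = (1 / cosh x)\<^sup>2"
      by (simp add: cosh_square_eq power_divide)
    then show ?thesis by (simp add: real_sqrt_divide)
  qed
  ultimately show "agree 2 (\<lambda>\<epsilon>. dn (v \<epsilon>) (compl_modulus \<epsilon>)) (\<lambda>\<epsilon>. 1 / cosh (v \<epsilon>))"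
    by (simp add: dn_def power2_eq_square)
qed

lemma compl_modulus_agree: "agree 2 compl_modulus (\<lambda>_. 1)"
  unfolding agree_def compl_modulus_def by real_asymp

lemma eventually_abs_am_less:
  assumes "(v \<longlongrightarrow> L) (at_right 0)"
  shows "\<forall>\<^sub>F \<epsilon> in at_right 0. \<bar>jacobi_am (v \<epsilon>) (compl_modulus \<epsilon>)\<bar> < pi / 2"
proof -
  have "((\<lambda>\<epsilon>. \<bar>jacobi_am (v \<epsilon>) (compl_modulus \<epsilon>)\<bar>) \<longlongrightarrow> \<bar>arctan (sinh L)\<bar>) (at_right 0)"
    by (intro tendsto_rabs agree_tendsto[OF jacobi_am_agree[OF assms]] tendsto_intros assms) simp
  moreover have "\<bar>arctan (sinh L)\<bar> < pi / 2" using arctan_bounded[of "sinh L"] by auto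
  ultimately show ?thesis by (rule order_tendstoD(2))
qed

lemma sn_small_agree:
  assumes x: "x \<in> O[at_right 0](\<lambda>\<epsilon>. \<epsilon>)"
  shows "agree 3 (\<lambda>\<epsilon>. sn (x \<epsilon>) (compl_modulus \<epsilon>)) x"
proof -
  have lim: "(x \<longlongrightarrow> 0) (at_right 0)" using bigo_power_tendsto_0[of x 1] x by simp
  have "(\<lambda>\<epsilon>. \<epsilon>\<^sup>2 * (x \<epsilon> * (sinh (x \<epsilon>))\<^sup>2)) \<in> O[at_right 0](\<lambda>\<epsilon>. \<epsilon>\<^sup>2 * (\<epsilon> * 1))"
    by (intro landau_o.big.mult landau_o.big_refl x tendsto_imp_bigo_1[of _ "(sinh 0)\<^sup>2"] tendsto_intros lim)
  from landau_o.big_trans[OF jacobi_am_bigo this]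
  have am: "agree 3 (\<lambda>\<epsilon>. jacobi_am (x \<epsilon>) (compl_modulus \<epsilon>)) (\<lambda>\<epsilon>. arctan (sinh (x \<epsilon>)))"
    by (simp add: agree_def power2_eq_square power3_eq_cube mult.assoc)
  have gd: "((\<lambda>\<epsilon>. arctan (sinh (x \<epsilon>))) \<longlongrightarrow> arctan (sinh 0)) (at_right 0)"
    by (intro tendsto_intros lim)
  have "agree 3 (\<lambda>\<epsilon>. sin (jacobi_am (x \<epsilon>) (compl_modulus \<epsilon>))) (\<lambda>\<epsilon>. sin (arctan (sinh (x \<epsilon>))))"
    by (rule agree_compose[OF am agree_tendsto[OF am _ gd] gd open_UNIV, where F'=cos]) (auto intro: DERIV_sin)
  also have "agree 3 (\<lambda>\<epsilon>. sin (arctan (sinh (x \<epsilon>)))) x"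
    unfolding arctan_sinh_sin_cos
  proof (rule agree_compose_at_0[OF _ _ x])
    show "(\<lambda>x::real. tanh x - x) \<in> O[at 0](\<lambda>x. x ^ 3)" by real_asymp
  qed simp
  finally show ?thesis by (simp add: sn_def)
qed

section \<open>The argument of the ring equations\<close>

text \<open>
  For a small argument \<open>\<delta>/2\<close> the quotient is \<open>sn (\<delta>/2)\<close> times \<open>2 + O(\<epsilon>\<^sup>2)\<close>, which is \<open>\<delta> + O(\<epsilon>\<^sup>3)\<close>.
\<close>

lemma half_difference_phase_agree:
  assumes \<delta>: "\<delta> \<in> O[at_right 0](\<lambda>\<epsilon>. \<epsilon>)"
  defines "q \<equiv> compl_modulus"
  shows "agree 3 (\<lambda>\<epsilon>. arctan (sn (\<delta> \<epsilon> / 2) (q \<epsilon>) * (1 + q \<epsilon>) / (cn (\<delta> \<epsilon> / 2) (q \<epsilon>) * dn (\<delta> \<epsilon> / 2) (q \<epsilon>)))) \<delta>"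
proof -
  define x where "x = (\<lambda>\<epsilon>. \<delta> \<epsilon> / 2)"
  have x: "x \<in> O[at_right 0](\<lambda>\<epsilon>. \<epsilon>)" using \<delta> by (simp add: x_def)
  have lim: "(x \<longlongrightarrow> 0) (at_right 0)" using bigo_power_tendsto_0[of x 1] x by simp
  have "(\<lambda>x::real. cosh x - 1) \<in> O[at 0](\<lambda>x. x ^ 2)" by real_asymp
  from agree_compose_at_0[OF this _ x]
  have "agree 2 (\<lambda>\<epsilon>. cosh (x \<epsilon>)) (\<lambda>_. 1)" by simp
  then have cosh: "agree 2 (\<lambda>\<epsilon>. 1 / cosh (x \<epsilon>)) (\<lambda>_. 1)"
    using agree_divide[of 2 "\<lambda>_. 1" "\<lambda>_. 1" "\<lambda>\<epsilon>. cosh (x \<epsilon>)" "\<lambda>_. 1" 1 1] tendsto_cosh[OF lim] by simp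
  have cn: "agree 2 (\<lambda>\<epsilon>. cn (x \<epsilon>) (q \<epsilon>)) (\<lambda>_. 1)" and dn: "agree 2 (\<lambda>\<epsilon>. dn (x \<epsilon>) (q \<epsilon>)) (\<lambda>_. 1)"
    using agree_trans[OF cn_agree[OF lim] cosh] agree_trans[OF dn_agree[OF lim] cosh] by (auto simp: q_def)
  have cn1: "((\<lambda>\<epsilon>. cn (x \<epsilon>) (q \<epsilon>)) \<longlongrightarrow> 1) (at_right 0)" by (rule agree_tendsto[OF cn]) auto
  have cd: "agree 2 (\<lambda>\<epsilon>. cn (x \<epsilon>) (q \<epsilon>) * dn (x \<epsilon>) (q \<epsilon>)) (\<lambda>_. 1 * 1)"
    by (rule agree_mult[OF cn dn cn1]) auto
  have cd1: "((\<lambda>\<epsilon>. cn (x \<epsilon>) (q \<epsilon>) * dn (x \<epsilon>) (q \<epsilon>)) \<longlongrightarrow> 1) (at_right 0)"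
    by (rule agree_tendsto[OF cd]) auto
  have q2: "agree 2 (\<lambda>\<epsilon>. 1 + q \<epsilon>) (\<lambda>_. 1 + 1)"
    by (intro agree_add agree_refl) (simp add: q_def compl_modulus_agree)
  have q2': "((\<lambda>\<epsilon>. 1 + q \<epsilon>) \<longlongrightarrow> 2) (at_right 0)" by (rule agree_tendsto[OF q2]) auto
  have quot: "agree 2 (\<lambda>\<epsilon>. (1 + q \<epsilon>) / (cn (x \<epsilon>) (q \<epsilon>) * dn (x \<epsilon>) (q \<epsilon>))) (\<lambda>_. (1 + 1) / (1 * 1))"
    by (rule agree_divide[OF q2 cd q2' cd1]) auto
  have sn: "agree 3 (\<lambda>\<epsilon>. sn (x \<epsilon>) (q \<epsilon>)) x" unfolding q_def by (rule sn_small_agree[OF x])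
  have snO: "(\<lambda>\<epsilon>. sn (x \<epsilon>) (q \<epsilon>)) \<in> O[at_right 0](\<lambda>\<epsilon>. \<epsilon> ^ 1)"
    by (rule agree_imp_bigo[OF agree_mono[OF sn]]) (use x in auto)
  have "agree 3 (\<lambda>\<epsilon>. sn (x \<epsilon>) (q \<epsilon>) * ((1 + q \<epsilon>) / (cn (x \<epsilon>) (q \<epsilon>) * dn (x \<epsilon>) (q \<epsilon>)))) (\<lambda>\<epsilon>. sn (x \<epsilon>) (q \<epsilon>) * ((1 + 1) / (1 * 1)))"
    using agree_scale[OF quot snO] by (simp add: numeral_3_eq_3)
  also have "agree 3 (\<lambda>\<epsilon>. sn (x \<epsilon>) (q \<epsilon>) * ((1 + 1) / (1 * 1))) \<delta>"
    using agree_cmult[OF sn, of 2] by (simp add: x_def mult.commute)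
  finally have arg: "agree 3 (\<lambda>\<epsilon>. sn (x \<epsilon>) (q \<epsilon>) * (1 + q \<epsilon>) / (cn (x \<epsilon>) (q \<epsilon>) * dn (x \<epsilon>) (q \<epsilon>))) \<delta>"
    by simp
  have "agree 3 (\<lambda>\<epsilon>. arctan (sn (x \<epsilon>) (q \<epsilon>) * (1 + q \<epsilon>) / (cn (x \<epsilon>) (q \<epsilon>) * dn (x \<epsilon>) (q \<epsilon>))))
      (\<lambda>\<epsilon>. sn (x \<epsilon>) (q \<epsilon>) * (1 + q \<epsilon>) / (cn (x \<epsilon>) (q \<epsilon>) * dn (x \<epsilon>) (q \<epsilon>)))"
  proof (rule agree_compose_at_0)
    show "(\<lambda>x::real. arctan x - x) \<in> O[at 0](\<lambda>x. x ^ 3)" by real_asymp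
    show "(\<lambda>\<epsilon>. sn (x \<epsilon>) (q \<epsilon>) * (1 + q \<epsilon>) / (cn (x \<epsilon>) (q \<epsilon>) * dn (x \<epsilon>) (q \<epsilon>))) \<in> O[at_right 0](\<lambda>\<epsilon>. \<epsilon>)"
      using agree_imp_bigo[OF agree_mono[OF arg, of 1]] \<delta> by simp
  qed simp
  also note arg
  finally show ?thesis by (simp add: x_def)
qed

text \<open>
  The arctangent is that of \<open>cn dn / (sn (1 + q))\<close> at \<open>K - v\<close>, rewritten by \<open>jacobi_quarter_minus\<close>. In the
  limit the factor of \<open>\<epsilon>\<^sup>2\<close> is \<open>tanh u cosh\<^sup>2 u / 2\<close>.
\<close>

lemma half_sum_phase_agree:
  assumes v: "agree 1 v (\<lambda>_. u)"
  defines "q \<equiv> compl_modulus"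
  shows "agree 3 (\<lambda>\<epsilon>. arctan (\<epsilon>\<^sup>2 * (sn (v \<epsilon>) (q \<epsilon>) / (cn (v \<epsilon>) (q \<epsilon>) * dn (v \<epsilon>) (q \<epsilon>) * (1 + q \<epsilon>)))))
     (\<lambda>\<epsilon>. \<epsilon>\<^sup>2 * (sinh (2 * u) / 4))"
proof -
  have lim: "(v \<longlongrightarrow> u) (at_right 0)" by (rule agree_tendsto[OF v]) auto
  have lim': "((\<lambda>_. u) \<longlongrightarrow> u) (at_right 0)" by simp
  have C: "agree 1 (\<lambda>\<epsilon>. 1 / cosh (v \<epsilon>)) (\<lambda>\<epsilon>. 1 / cosh u)"
    by (rule agree_compose[OF v lim lim' open_UNIV, where F="\<lambda>x. 1 / cosh x" and F'="\<lambda>x. - (sinh x / (cosh x)\<^sup>2)"])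
       (auto intro!: derivative_eq_intros continuous_intros simp: power2_eq_square)
  have T: "agree 1 (\<lambda>\<epsilon>. tanh (v \<epsilon>)) (\<lambda>\<epsilon>. tanh u)"
    by (rule agree_compose[OF v lim lim' open_UNIV, where F=tanh and F'="\<lambda>x. 1 - (tanh x)\<^sup>2"])
       (auto intro!: derivative_eq_intros continuous_intros)
  have sn: "agree 1 (\<lambda>\<epsilon>. sn (v \<epsilon>) (q \<epsilon>)) (\<lambda>\<epsilon>. tanh u)"
    using agree_trans[OF agree_mono[OF sn_agree[OF lim]] T] by (simp add: q_def)
  have cn: "agree 1 (\<lambda>\<epsilon>. cn (v \<epsilon>) (q \<epsilon>)) (\<lambda>\<epsilon>. 1 / cosh u)"
    using agree_trans[OF agree_mono[OF cn_agree[OF lim]] C] by (simp add: q_def)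
  have dn: "agree 1 (\<lambda>\<epsilon>. dn (v \<epsilon>) (q \<epsilon>)) (\<lambda>\<epsilon>. 1 / cosh u)"
    using agree_trans[OF agree_mono[OF dn_agree[OF lim]] C] by (simp add: q_def)
  have q2: "agree 1 (\<lambda>\<epsilon>. 1 + q \<epsilon>) (\<lambda>_. 1 + 1)"
    by (intro agree_add agree_refl agree_mono[OF compl_modulus_agree[folded q_def]]) simp
  have const: "(f \<longlongrightarrow> c) (at_right 0)" if "agree 1 f (\<lambda>_. c)" for f c
    by (rule agree_tendsto[OF that]) auto
  have cd: "agree 1 (\<lambda>\<epsilon>. cn (v \<epsilon>) (q \<epsilon>) * dn (v \<epsilon>) (q \<epsilon>)) (\<lambda>_. 1 / cosh u * (1 / cosh u))"
    by (rule agree_mult[OF cn dn const[OF cn] tendsto_const])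
  have cdq: "agree 1 (\<lambda>\<epsilon>. cn (v \<epsilon>) (q \<epsilon>) * dn (v \<epsilon>) (q \<epsilon>) * (1 + q \<epsilon>)) (\<lambda>_. 1 / cosh u * (1 / cosh u) * (1 + 1))"
    by (rule agree_mult[OF cd q2 const[OF cd] tendsto_const])
  have "agree 1 (\<lambda>\<epsilon>. sn (v \<epsilon>) (q \<epsilon>) / (cn (v \<epsilon>) (q \<epsilon>) * dn (v \<epsilon>) (q \<epsilon>) * (1 + q \<epsilon>)))
      (\<lambda>_. tanh u / (1 / cosh u * (1 / cosh u) * (1 + 1)))"
    by (rule agree_divide[OF sn cdq const[OF sn] const[OF cdq] tendsto_const]) simp
  also have "tanh u / (1 / cosh u * (1 / cosh u) * (1 + 1)) = sinh (2 * u) / 4"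
    by (simp add: tanh_def sinh_double)
  finally have quot: "agree 1 (\<lambda>\<epsilon>. sn (v \<epsilon>) (q \<epsilon>) / (cn (v \<epsilon>) (q \<epsilon>) * dn (v \<epsilon>) (q \<epsilon>) * (1 + q \<epsilon>)))
      (\<lambda>_. sinh (2 * u) / 4)" .
  have arg: "agree 3 (\<lambda>\<epsilon>. \<epsilon>\<^sup>2 * (sn (v \<epsilon>) (q \<epsilon>) / (cn (v \<epsilon>) (q \<epsilon>) * dn (v \<epsilon>) (q \<epsilon>) * (1 + q \<epsilon>))))
      (\<lambda>\<epsilon>. \<epsilon>\<^sup>2 * (sinh (2 * u) / 4))"
    using agree_scale[OF quot, of "\<lambda>\<epsilon>. \<epsilon>\<^sup>2" 2] by simp
  have "(\<lambda>\<epsilon>. \<epsilon>\<^sup>2 * (sinh (2 * u) / 4)) \<in> O[at_right 0](\<lambda>\<epsilon>. \<epsilon> ^ 2)"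
    using landau_o.big.mult[OF landau_o.big_refl[of "\<lambda>\<epsilon>::real. \<epsilon>\<^sup>2" "at_right 0"] bigo_const[of "sinh (2 * u) / 4"]]
    by simp
  then have "(\<lambda>\<epsilon>. \<epsilon>\<^sup>2 * (sinh (2 * u) / 4)) \<in> O[at_right 0](\<lambda>\<epsilon>. \<epsilon> ^ 1)"
    by (rule bigo_power_mono) simp
  from agree_imp_bigo[OF agree_mono[OF arg] this]
  have small: "(\<lambda>\<epsilon>. \<epsilon>\<^sup>2 * (sn (v \<epsilon>) (q \<epsilon>) / (cn (v \<epsilon>) (q \<epsilon>) * dn (v \<epsilon>) (q \<epsilon>) * (1 + q \<epsilon>)))) \<in> O[at_right 0](\<lambda>\<epsilon>. \<epsilon>)"
    by simp
  have "(\<lambda>x::real. arctan x - x) \<in> O[at 0](\<lambda>x. x ^ 3)" by real_asymp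
  from agree_trans[OF agree_compose_at_0[OF this _ small] arg] show ?thesis by simp
qed

text \<open>
  This polar form and the next one have no branch ambiguity: the sign of one coordinate places the
  point in a half plane on which the argument is given by a single arctangent.
\<close>

lemma Complex_eq_cis_arctan:
  assumes "0 < X" shows "Complex X Y = of_real (cmod (Complex X Y)) * cis (arctan (Y / X))"
proof -
  have "1 + (Y / X)\<^sup>2 = (X\<^sup>2 + Y\<^sup>2) / X\<^sup>2" using assms by (simp add: field_simps)
  then have "sqrt (1 + (Y / X)\<^sup>2) = sqrt (X\<^sup>2 + Y\<^sup>2) / X" using assms by (simp add: real_sqrt_divide)
  moreover have "X\<^sup>2 + Y\<^sup>2 \<noteq> 0" using assms by (simp add: sum_power2_eq_zero_iff)
  ultimately show ?thesis using assms by (simp add: complex_eq_iff cos_arctan sin_arctan cmod_def)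
qed

lemma Complex_eq_cis_arccot:
  assumes "0 < Y" shows "Complex X Y = of_real (cmod (Complex X Y)) * cis (pi / 2 - arctan (X / Y))"
proof -
  have "1 + (X / Y)\<^sup>2 = (X\<^sup>2 + Y\<^sup>2) / Y\<^sup>2" using assms by (simp add: field_simps)
  then have "sqrt (1 + (X / Y)\<^sup>2) = sqrt (X\<^sup>2 + Y\<^sup>2) / Y" using assms by (simp add: real_sqrt_divide)
  moreover have "X\<^sup>2 + Y\<^sup>2 \<noteq> 0" using assms by (simp add: sum_power2_eq_zero_iff)
  ultimately show ?thesis using assms
    by (simp add: complex_eq_iff cos_arctan sin_arctan cmod_def cos_diff sin_diff)
qed

text \<open>
  The two ring equations differ only in the sign \<open>\<sigma>\<close> of \<open>\<i> K'\<close> in the denominators.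
\<close>

definition ring_lhs :: "real \<Rightarrow> real \<Rightarrow> (nat \<Rightarrow> real) \<Rightarrow> complex" where
  "ring_lhs \<sigma> q b =
    (\<Prod>k=1..4. csn ((of_real (b 0 - b k) + of_real 1 * (\<i> * of_real (ellipticK' q))) / 2) q
             / csn ((of_real (b 0 + b k) + of_real \<sigma> * (\<i> * of_real (ellipticK' q))) / 2) q)"

lemma ring_lhs_eqs: "spherical_ring_lhs q b = ring_lhs 1 q b" "hyperbolic_ring_lhs q b = ring_lhs (-1) q b"
  by (simp_all add: spherical_ring_lhs_def hyperbolic_ring_lhs_def ring_lhs_def)

lemma cmod_ring_lhs:
  assumes q: "0 < q" "q < 1" and \<sigma>: "\<sigma> = 1 \<or> \<sigma> = -1"
  shows "cmod (ring_lhs \<sigma> q b) = 1"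
proof -
  have "cmod (csn ((of_real a + of_real 1 * (\<i> * of_real (ellipticK' q))) / 2) q)
      / cmod (csn ((of_real c + of_real \<sigma> * (\<i> * of_real (ellipticK' q))) / 2) q) = 1" for a c
    using q by (simp only: cmod_csn_half_lattice[OF q disjI1[OF refl]] cmod_csn_half_lattice[OF q \<sigma>]) simp
  then show ?thesis
    by (simp only: ring_lhs_def prod_norm[symmetric] norm_divide prod.neutral_const)
qed

lemma csn_quotient_eq_cis:
  fixes x y q \<sigma> :: real
  assumes q: "0 < q" "q < 1" and \<sigma>: "\<sigma> = 1 \<or> \<sigma> = -1"
    and pos: "0 < cn (x / 2) q" "0 < sn (y / 2) q"
  shows "csn ((of_real x + of_real 1 * (\<i> * of_real (ellipticK' q))) / 2) q
       / csn ((of_real y + of_real \<sigma> * (\<i> * of_real (ellipticK' q))) / 2) q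
     = cis (pi / 2 - arctan (sn (x / 2) q * (1 + q) / (cn (x / 2) q * dn (x / 2) q))
            - \<sigma> * arctan (cn (y / 2) q * dn (y / 2) q / (sn (y / 2) q * (1 + q))))"
proof -
  define z where "z a \<tau> = csn ((of_real a + of_real \<tau> * (\<i> * of_real (ellipticK' q))) / 2) q" for a \<tau> :: real
  have scaled: "of_real t * w = of_real (cmod (of_real t * w)) * c"
    if "w = of_real (cmod w) * c" "0 < t" for t w c
    using that by (metis abs_of_pos mult.assoc norm_mult norm_of_real of_real_mult)
  have t: "0 < 1 / (sqrt q * (1 + q * (sn (a / 2) q)\<^sup>2))" for a
    using q by (simp add: add_pos_nonneg)
  have d: "0 < dn (a / 2) q" for a using q by (intro dn_pos) auto
  have "z x 1 = of_real (1 / sqrt q) * cis (pi / 2 - arctan (sn (x / 2) q * (1 + q) / (1 * (cn (x / 2) q * dn (x / 2) q))))"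
    using scaled[OF Complex_eq_cis_arccot t[of x], of "1 * (cn (x / 2) q * dn (x / 2) q)" "sn (x / 2) q * (1 + q)"]
      csn_half_lattice[OF q, of 1 x] cmod_csn_half_lattice[OF q, of 1 x] pos(1) d[of x]
    by (simp add: z_def)
  moreover have "z y \<sigma> = of_real (1 / sqrt q) * cis (arctan (\<sigma> * (cn (y / 2) q * dn (y / 2) q) / (sn (y / 2) q * (1 + q))))"
    using scaled[OF Complex_eq_cis_arctan t[of y], of "sn (y / 2) q * (1 + q)" "\<sigma> * (cn (y / 2) q * dn (y / 2) q)"]
      csn_half_lattice[OF q \<sigma>, of y] cmod_csn_half_lattice[OF q \<sigma>, of y] pos(2) q
    by (simp add: z_def)
  moreover have "arctan (\<sigma> * A / B) = \<sigma> * arctan (A / B)" for A B using \<sigma> by (auto simp: arctan_minus)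
  ultimately show ?thesis using q
    unfolding z_def[symmetric] by (simp add: cis_divide)
qed

definition ring_arg :: "real \<Rightarrow> (real \<Rightarrow> nat \<Rightarrow> real) \<Rightarrow> real \<Rightarrow> real" where
  "ring_arg \<sigma> w \<epsilon> = Arg (ring_lhs \<sigma> (compl_modulus \<epsilon>) (\<lambda>k. ellipticK (compl_modulus \<epsilon>) - w \<epsilon> k))"

text \<open>
  The four arguments add up to \<open>2 \<pi> - \<Theta>\<close> with \<open>\<Theta>\<close> tending to zero, so that eventually \<open>- \<Theta>\<close> is the
  principal value.
\<close>

lemma Arg_ring_lhs_agree:
  fixes u :: real and w :: "real \<Rightarrow> nat \<Rightarrow> real"
  assumes \<sigma>: "\<sigma> = 1 \<or> \<sigma> = -1" and w0: "\<And>\<epsilon>. w \<epsilon> 0 = u"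
    and w: "\<And>k. k \<in> {1..4} \<Longrightarrow> (\<lambda>\<epsilon>. w \<epsilon> k - u) \<in> O[at_right 0](\<lambda>\<epsilon>. \<epsilon>)"
  shows "agree 3 (ring_arg \<sigma> w)
     (\<lambda>\<epsilon>. - ((\<Sum>k=1..4. w \<epsilon> k - u) + \<sigma> * (\<epsilon>\<^sup>2 * sinh (2 * u))))"
proof -
  define q where "q = compl_modulus"
  define \<psi> where "\<psi> \<epsilon> k = arctan (sn ((w \<epsilon> k - u) / 2) (q \<epsilon>) * (1 + q \<epsilon>)
      / (cn ((w \<epsilon> k - u) / 2) (q \<epsilon>) * dn ((w \<epsilon> k - u) / 2) (q \<epsilon>)))" for \<epsilon> k
  define v where "v k \<epsilon> = (w \<epsilon> k + u) / 2" for \<epsilon> k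
  define \<eta> where "\<eta> \<epsilon> k = arctan (\<epsilon>\<^sup>2 * (sn (v k \<epsilon>) (q \<epsilon>) / (cn (v k \<epsilon>) (q \<epsilon>) * dn (v k \<epsilon>) (q \<epsilon>) * (1 + q \<epsilon>))))" for \<epsilon> k
  define \<Theta> where "\<Theta> \<epsilon> = (\<Sum>k=1..4. \<psi> \<epsilon> k + \<sigma> * \<eta> \<epsilon> k)" for \<epsilon>
  have \<psi>: "agree 3 (\<lambda>\<epsilon>. \<psi> \<epsilon> k) (\<lambda>\<epsilon>. w \<epsilon> k - u)" if "k \<in> {1..4}" for k
    unfolding \<psi>_def q_def by (rule half_difference_phase_agree[OF w[OF that]])
  have v: "agree 1 (v k) (\<lambda>_. u)" if "k \<in> {1..4}" for k
  proof -
    have "(\<lambda>\<epsilon>. v k \<epsilon> - u) = (\<lambda>\<epsilon>. 1 / 2 * (w \<epsilon> k - u))" by (simp add: v_def field_simps)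
    then show ?thesis unfolding agree_def using w[OF that] by simp
  qed
  have \<eta>: "agree 3 (\<lambda>\<epsilon>. \<eta> \<epsilon> k) (\<lambda>\<epsilon>. \<epsilon>\<^sup>2 * (sinh (2 * u) / 4))" if "k \<in> {1..4}" for k
    unfolding \<eta>_def q_def by (rule half_sum_phase_agree[OF v[OF that]])
  have "agree 3 \<Theta> (\<lambda>\<epsilon>. \<Sum>k=1..4. (w \<epsilon> k - u) + \<sigma> * (\<epsilon>\<^sup>2 * (sinh (2 * u) / 4)))"
    unfolding \<Theta>_def by (intro agree_sum agree_add agree_cmult \<psi> \<eta>)
  then have \<Theta>: "agree 3 \<Theta> (\<lambda>\<epsilon>. (\<Sum>k=1..4. w \<epsilon> k - u) + \<sigma> * (\<epsilon>\<^sup>2 * sinh (2 * u)))"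
    by (simp add: sum.distrib)
  have w': "((\<lambda>\<epsilon>. w \<epsilon> k - u) \<longlongrightarrow> 0) (at_right 0)" if "k \<in> {1..4}" for k
    using bigo_power_tendsto_0[of _ 1] w[OF that] by simp
  have "((\<lambda>\<epsilon>. (\<Sum>k=1..4. w \<epsilon> k - u) + \<sigma> * (\<epsilon>\<^sup>2 * sinh (2 * u))) \<longlongrightarrow> (\<Sum>k=(1::nat)..4. 0) + \<sigma> * (0\<^sup>2 * sinh (2 * u))) (at_right 0)"
    by (intro tendsto_intros w')
  then have "(\<Theta> \<longlongrightarrow> 0) (at_right 0)" using agree_tendsto[OF \<Theta>] by simp
  then have small: "\<forall>\<^sub>F \<epsilon> in at_right 0. dist (\<Theta> \<epsilon>) 0 < pi" by (rule tendstoD) simp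
  have pos: "\<forall>\<^sub>F \<epsilon> in at_right 0. 0 < cn ((w \<epsilon> k - u) / 2) (q \<epsilon>)" if "k \<in> {1..4}" for k
  proof -
    have lim: "((\<lambda>\<epsilon>. (w \<epsilon> k - u) / 2) \<longlongrightarrow> 0 / 2) (at_right 0)" by (intro tendsto_intros w' that) simp
    have "((\<lambda>\<epsilon>. 1 / cosh ((w \<epsilon> k - u) / 2)) \<longlongrightarrow> 1 / cosh (0 / 2)) (at_right 0)"
      by (intro tendsto_intros lim) simp
    from agree_tendsto[OF cn_agree[OF lim] _ this] show ?thesis
      unfolding q_def by (intro order_tendstoD(1)) auto
  qed
  have am: "\<forall>\<^sub>F \<epsilon> in at_right 0. \<bar>jacobi_am (v k \<epsilon>) (q \<epsilon>)\<bar> < pi / 2" if "k \<in> {1..4}" for k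
    unfolding q_def by (rule eventually_abs_am_less[OF agree_tendsto[OF v[OF that] _ tendsto_const]]) simp
  have pos_all: "\<forall>k\<in>{1..4}. \<forall>\<^sub>F \<epsilon> in at_right 0. 0 < cn ((w \<epsilon> k - u) / 2) (q \<epsilon>)"
    and am_all: "\<forall>k\<in>{1..4}. \<forall>\<^sub>F \<epsilon> in at_right 0. \<bar>jacobi_am (v k \<epsilon>) (q \<epsilon>)\<bar> < pi / 2"
    using pos am by blast+
  have "\<forall>\<^sub>F \<epsilon> in at_right 0. Arg (ring_lhs \<sigma> (q \<epsilon>) (\<lambda>k. ellipticK (q \<epsilon>) - w \<epsilon> k)) = - \<Theta> \<epsilon>"
    using small eventually_0_1
      eventually_ball_finite[OF finite_atLeastAtMost pos_all]
      eventually_ball_finite[OF finite_atLeastAtMost am_all]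
  proof eventually_elim
    case (elim \<epsilon>)
    have q: "0 < q \<epsilon>" "q \<epsilon> < 1" "compl_modulus (q \<epsilon>) = \<epsilon>"
      using elim compl_modulus_bounds[of \<epsilon>] compl_modulus_compl_modulus[of \<epsilon>] by (auto simp: q_def)
    have factor: "csn ((of_real ((ellipticK (q \<epsilon>) - w \<epsilon> 0) - (ellipticK (q \<epsilon>) - w \<epsilon> k)) + of_real 1 * (\<i> * of_real (ellipticK' (q \<epsilon>)))) / 2) (q \<epsilon>)
       / csn ((of_real ((ellipticK (q \<epsilon>) - w \<epsilon> 0) + (ellipticK (q \<epsilon>) - w \<epsilon> k)) + of_real \<sigma> * (\<i> * of_real (ellipticK' (q \<epsilon>)))) / 2) (q \<epsilon>)
       = cis (pi / 2 - (\<psi> \<epsilon> k + \<sigma> * \<eta> \<epsilon> k))" if k: "k \<in> {1..4}" for k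
    proof -
      define y where "y = (ellipticK (q \<epsilon>) - w \<epsilon> 0) + (ellipticK (q \<epsilon>) - w \<epsilon> k)"
      have y2: "y / 2 = ellipticK (q \<epsilon>) - v k \<epsilon>" by (simp add: y_def v_def w0 field_simps)
      have amk: "\<bar>jacobi_am (v k \<epsilon>) (q \<epsilon>)\<bar> < pi / 2" using elim k by blast
      note quarter = jacobi_quarter_minus[OF q(1,2) amk, folded y2, unfolded q(3)]
      have c: "0 < cn (v k \<epsilon>) (q \<epsilon>)" by (rule cn_pos[OF amk])
      have d: "0 < dn (v k \<epsilon>) (q \<epsilon>)" using q by (intro dn_pos) auto
      have quot: "cn (y / 2) (q \<epsilon>) * dn (y / 2) (q \<epsilon>) / (sn (y / 2) (q \<epsilon>) * (1 + q \<epsilon>))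
          = \<epsilon>\<^sup>2 * (sn (v k \<epsilon>) (q \<epsilon>) / (cn (v k \<epsilon>) (q \<epsilon>) * dn (v k \<epsilon>) (q \<epsilon>) * (1 + q \<epsilon>)))"
        unfolding quarter using c d q by (simp add: power2_eq_square mult_ac)
      have "0 < cn ((w \<epsilon> k - u) / 2) (q \<epsilon>)" using elim k by blast
      moreover have "0 < sn (y / 2) (q \<epsilon>)" unfolding quarter using c d by simp
      moreover have x: "(ellipticK (q \<epsilon>) - w \<epsilon> 0) - (ellipticK (q \<epsilon>) - w \<epsilon> k) = w \<epsilon> k - u"
        by (simp add: w0)
      ultimately show ?thesis
        using csn_quotient_eq_cis[OF q(1,2) \<sigma>, of "w \<epsilon> k - u" y, unfolded quot]
        unfolding x y_def[symmetric] \<psi>_def \<eta>_def diff_diff_eq[of "pi / 2"] by blast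
    qed
    have "ring_lhs \<sigma> (q \<epsilon>) (\<lambda>k. ellipticK (q \<epsilon>) - w \<epsilon> k) = (\<Prod>k=1..4. cis (pi / 2 - (\<psi> \<epsilon> k + \<sigma> * \<eta> \<epsilon> k)))"
      unfolding ring_lhs_def by (intro prod.cong refl factor)
    also have "\<dots> = cis (2 * pi) * cis (- \<Theta> \<epsilon>)"
      by (simp add: \<Theta>_def cis_mult numeral_eq_Suc del: cis_2pi)
         (simp add: algebra_simps)
    finally have "ring_lhs \<sigma> (q \<epsilon>) (\<lambda>k. ellipticK (q \<epsilon>) - w \<epsilon> k) = cis (- \<Theta> \<epsilon>)" by simp
    moreover have "- \<Theta> \<epsilon> \<in> {-pi<..pi}" using elim(1) by (auto simp: dist_real_def)
    ultimately show ?case by (simp add: Arg_cis)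
  qed
  then have "agree 3 (\<lambda>\<epsilon>. Arg (ring_lhs \<sigma> (q \<epsilon>) (\<lambda>k. ellipticK (q \<epsilon>) - w \<epsilon> k))) (\<lambda>\<epsilon>. - \<Theta> \<epsilon>)"
    by (intro agree_cong[OF agree_refl[of 3 "\<lambda>\<epsilon>. - \<Theta> \<epsilon>"]]) (auto elim: eventually_mono)
  also have "agree 3 (\<lambda>\<epsilon>. - \<Theta> \<epsilon>) (\<lambda>\<epsilon>. - ((\<Sum>k=1..4. w \<epsilon> k - u) + \<sigma> * (\<epsilon>\<^sup>2 * sinh (2 * u))))"
    using agree_cmult[OF \<Theta>, of "-1"] by simp
  finally show ?thesis unfolding q_def ring_arg_def .
qed

section \<open>A chain of rings around a center\<close>

text \<open>
  Points of the unit sphere and of the hyperboloid with the third axis through the center of the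
  central ring. Rotations about this axis multiply \<open>\<zeta>\<close> by \<open>cis \<theta>\<close>.
\<close>

definition pt :: "complex \<Rightarrow> real \<Rightarrow> real^3" where
  "pt \<zeta> z = vector [Re \<zeta>, Im \<zeta>, z]"

lemma pt_nth [simp]: "pt \<zeta> z $ 1 = Re \<zeta>" "pt \<zeta> z $ 2 = Im \<zeta>" "pt \<zeta> z $ 3 = z"
  by (simp_all add: pt_def)

lemma inner_pt: "pt \<zeta>1 z1 \<bullet> pt \<zeta>2 z2 = Re \<zeta>1 * Re \<zeta>2 + Im \<zeta>1 * Im \<zeta>2 + z1 * z2"
  by (simp add: inner_vec_def sum_3)

lemma norm_pt: "norm (pt \<zeta> z) = sqrt ((cmod \<zeta>)\<^sup>2 + z\<^sup>2)"
  by (simp only: norm_eq_sqrt_inner[of "pt \<zeta> z"] inner_pt cmod_power2) (simp only: power2_eq_square)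

lemma norm_cis_diff_le: "cmod (cis a - cis b) \<le> \<bar>a - b\<bar>"
proof -
  have "(cmod (cis a - cis b))\<^sup>2 = 2 - 2 * cos (a - b)"
    using sin_cos_squared_add[of a] sin_cos_squared_add[of b]
    by (simp add: cmod_power2 cos_diff power2_diff algebra_simps)
  also have "cos (a - b) = 1 - 2 * (sin ((a - b) / 2))\<^sup>2"
    using cos_double_sin[of "(a - b) / 2"] by (simp only: nonzero_mult_div_cancel_left times_divide_eq_right)
  finally have "(cmod (cis a - cis b))\<^sup>2 = (2 * \<bar>sin ((a - b) / 2)\<bar>)\<^sup>2"
    by (simp add: power_mult_distrib)
  then have "cmod (cis a - cis b) = 2 * \<bar>sin ((a - b) / 2)\<bar>"
    by (rule power2_eq_imp_eq) auto
  also have "\<dots> \<le> \<bar>a - b\<bar>" using abs_sin_x_le_abs_x[of "(a - b) / 2"] by simp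
  finally show ?thesis .
qed

text \<open>
  Consecutive neighbors are related by a touching point at direction \<open>\<theta> j\<close>, from which they are seen
  under the angles of \<open>A\<close> (touching points one and three, on the inner circle) or of \<open>B\<close> (two and four,
  on the outer circle). The directions are chosen such that the neighbors two, three and four are
  seen from both of their touching points in the same direction, so that only the radial mismatch of
  \<open>A\<close> and \<open>B\<close> remains for them. The angle defect is concentrated on the first neighbor, seen
  from the last touching point.
\<close>

lemma chain_of_rings:
  fixes A B :: "nat \<Rightarrow> complex" and \<phi> \<psi> :: "nat \<Rightarrow> real"
  assumes A: "\<And>k. k \<in> {1..4} \<Longrightarrow> A k = of_real (cmod (A k)) * cis (\<phi> k)"
    and B: "\<And>k. k \<in> {1..4} \<Longrightarrow> B k = of_real (cmod (B k)) * cis (\<psi> k)"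
    and AB: "\<And>k. k \<in> {1..4} \<Longrightarrow> \<bar>cmod (A k) - cmod (B k)\<bar> \<le> \<tau>"
    and closing: "cmod (A 1) * \<bar>(\<Sum>k=1..4. \<phi> k + \<psi> k) - 2 * pi\<bar> \<le> \<tau>"
  obtains \<zeta> :: "nat \<Rightarrow> complex" and \<theta> :: "nat \<Rightarrow> real" where
    "\<And>k. k \<in> {1..4} \<Longrightarrow> cmod (\<zeta> k) = cmod (A k)"
    "cmod (\<zeta> 1 - cis (\<theta> 1) * cnj (A 1)) \<le> 2 * \<tau>" "cmod (\<zeta> 2 - cis (\<theta> 1) * A 2) \<le> 2 * \<tau>"
    "cmod (\<zeta> 2 - cis (\<theta> 2) * cnj (B 2)) \<le> 2 * \<tau>" "cmod (\<zeta> 3 - cis (\<theta> 2) * B 3) \<le> 2 * \<tau>"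
    "cmod (\<zeta> 3 - cis (\<theta> 3) * cnj (A 3)) \<le> 2 * \<tau>" "cmod (\<zeta> 4 - cis (\<theta> 3) * A 4) \<le> 2 * \<tau>"
    "cmod (\<zeta> 4 - cis (\<theta> 4) * cnj (B 4)) \<le> 2 * \<tau>" "cmod (\<zeta> 1 - cis (\<theta> 4) * B 1) \<le> 2 * \<tau>"
proof -
  define \<alpha> where "\<alpha> = (\<lambda>k::nat. if k = 1 then - \<phi> 1 else if k = 2 then \<phi> 2
     else if k = 3 then \<phi> 2 + \<psi> 2 + \<psi> 3 else \<phi> 2 + \<psi> 2 + \<psi> 3 + \<phi> 3 + \<phi> 4)"
  define \<zeta> where "\<zeta> = (\<lambda>k. of_real (cmod (A k)) * cis (\<alpha> k))"
  define \<theta> where "\<theta> = (\<lambda>k::nat. if k = 1 then 0 else if k = 2 then \<phi> 2 + \<psi> 2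
     else if k = 3 then \<alpha> 3 + \<phi> 3 else \<alpha> 4 + \<psi> 4)"
  have \<tau>: "0 \<le> \<tau>" using order_trans[OF abs_ge_zero AB[of 1]] by simp
  have rot: "cis t * A k = of_real (cmod (A k)) * cis (t + \<phi> k)"
    "cis t * cnj (A k) = of_real (cmod (A k)) * cis (t - \<phi> k)"
    "cis t * B k = of_real (cmod (B k)) * cis (t + \<psi> k)"
    "cis t * cnj (B k) = of_real (cmod (B k)) * cis (t - \<psi> k)" if "k \<in> {1..4}" for t k
  proof -
    show "cis t * A k = of_real (cmod (A k)) * cis (t + \<phi> k)"
      by (subst A[OF that]) (simp add: cis_mult mult.left_commute)
    show "cis t * B k = of_real (cmod (B k)) * cis (t + \<psi> k)"
      by (subst B[OF that]) (simp add: cis_mult mult.left_commute)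
    show "cis t * cnj (A k) = of_real (cmod (A k)) * cis (t - \<phi> k)"
      by (subst A[OF that]) (simp add: cis_mult cis_cnj mult.left_commute)
    show "cis t * cnj (B k) = of_real (cmod (B k)) * cis (t - \<psi> k)"
      by (subst B[OF that]) (simp add: cis_mult cis_cnj mult.left_commute)
  qed
  \<comment> \<open>The neighbors sit exactly at the positions seen from the inner touching points.\<close>
  have same: "cmod (\<zeta> k - of_real (cmod (A k)) * cis t) \<le> 2 * \<tau>" if "t = \<alpha> k" for k t
    using that \<tau> by (simp add: \<zeta>_def)
  have other: "cmod (\<zeta> k - of_real (cmod (B k)) * cis t) \<le> 2 * \<tau>" if "k \<in> {1..4}" "t = \<alpha> k" for k t
  proof -
    have "\<zeta> k - of_real (cmod (B k)) * cis t = of_real (cmod (A k) - cmod (B k)) * cis t"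
      using that by (simp add: \<zeta>_def algebra_simps)
    then show ?thesis using AB[OF that(1)] \<tau> by (simp add: norm_mult del: of_real_diff)
  qed
  define t where "t = \<theta> 4 + \<psi> 1 - 2 * pi"
  have sum: "t - \<alpha> 1 = (\<Sum>k=1..4. \<phi> k + \<psi> k) - 2 * pi"
    by (simp add: t_def \<theta>_def \<alpha>_def numeral_eq_Suc)
  have "cis (\<theta> 4 + \<psi> 1) = cis (t + 2 * pi)" by (simp add: t_def)
  also have "\<dots> = cis t" by (simp add: cis_mult[symmetric])
  finally have "cis (\<theta> 4) * B 1 = of_real (cmod (B 1)) * cis t" using rot(3)[of 1 "\<theta> 4"] by simp
  then have "\<zeta> 1 - cis (\<theta> 4) * B 1 = of_real (cmod (A 1)) * (cis (\<alpha> 1) - cis t) + of_real (cmod (A 1) - cmod (B 1)) * cis t"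
    by (simp add: \<zeta>_def algebra_simps)
  also have "cmod \<dots> \<le> cmod (A 1) * cmod (cis (\<alpha> 1) - cis t) + \<bar>cmod (A 1) - cmod (B 1)\<bar>"
    by (rule order_trans[OF norm_triangle_ineq]) (simp add: norm_mult del: of_real_diff)
  also have "\<dots> \<le> cmod (A 1) * \<bar>t - \<alpha> 1\<bar> + \<bar>cmod (A 1) - cmod (B 1)\<bar>"
    using norm_cis_diff_le[of "\<alpha> 1" t] by (intro add_mono mult_left_mono) (auto simp: abs_minus_commute)
  also have "\<dots> \<le> 2 * \<tau>" using AB[of 1] closing unfolding sum by simp
  finally have last: "cmod (\<zeta> 1 - cis (\<theta> 4) * B 1) \<le> 2 * \<tau>" .
  show thesis
  proof (rule that[of \<zeta> \<theta>])
    show "cmod (\<zeta> k) = cmod (A k)" if "k \<in> {1..4}" for k by (simp add: \<zeta>_def norm_mult)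
    show "cmod (\<zeta> 1 - cis (\<theta> 1) * cnj (A 1)) \<le> 2 * \<tau>" "cmod (\<zeta> 2 - cis (\<theta> 1) * A 2) \<le> 2 * \<tau>"
      "cmod (\<zeta> 3 - cis (\<theta> 3) * cnj (A 3)) \<le> 2 * \<tau>" "cmod (\<zeta> 4 - cis (\<theta> 3) * A 4) \<le> 2 * \<tau>"
      by (subst rot, simp, rule same, simp add: \<theta>_def \<alpha>_def)+
    show "cmod (\<zeta> 2 - cis (\<theta> 2) * cnj (B 2)) \<le> 2 * \<tau>" "cmod (\<zeta> 3 - cis (\<theta> 2) * B 3) \<le> 2 * \<tau>"
      "cmod (\<zeta> 4 - cis (\<theta> 4) * cnj (B 4)) \<le> 2 * \<tau>"
      by (subst rot, simp, rule other, simp, simp add: \<theta>_def \<alpha>_def)+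
  qed (rule last)
qed

section \<open>Touching circles on the sphere\<close>

text \<open>
  With \<open>2 \<psi>\<close> the angle between two unit vectors, their chord is \<open>2 sin \<psi>\<close>; the bound is
  \<open>\<psi> \<le> 2 sin \<psi>\<close> on the interval from \<open>0\<close> to \<open>\<pi>/2\<close>.
\<close>

lemma sph_dist_le:
  assumes "norm a = 1" "norm b = 1"
  shows "sph_dist a b \<le> 2 * norm (a - b)"
proof -
  define \<psi> where "\<psi> = sph_dist a b / 2"
  have ab: "\<bar>a \<bullet> b\<bar> \<le> 1" using Cauchy_Schwarz_ineq2[of a b] assms by simp
  then have \<psi>: "0 \<le> \<psi>" "\<psi> \<le> pi / 2" "cos (2 * \<psi>) = a \<bullet> b"
    using arccos_lbound[of "a \<bullet> b"] arccos_ubound[of "a \<bullet> b"] cos_arccos_abs[of "a \<bullet> b"]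
    by (auto simp: \<psi>_def sph_dist_def)
  have "(norm (a - b))\<^sup>2 = 2 - 2 * (a \<bullet> b)"
    using dot_norm_neg[of a b] assms by simp
  also have "\<dots> = (2 * sin \<psi>)\<^sup>2" using cos_double_sin[of \<psi>] \<psi>(3) by (simp add: power_mult_distrib)
  finally have norm: "norm (a - b) = 2 * sin \<psi>"
    by (rule power2_eq_imp_eq) (use \<psi> in \<open>auto intro!: sin_ge_zero\<close>)
  \<comment> \<open>The cubic Taylor error suffices, as \<open>\<psi>\<^sup>2 \<le> 3\<close> on the range in question.\<close>
  have "\<bar>sin \<psi> - \<psi>\<bar> \<le> inverse 6 * \<bar>\<psi>\<bar> ^ 3"
    using Maclaurin_sin_bound[of \<psi> 3] by (simp add: sin_coeff_def eval_nat_numeral)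
  moreover have "\<psi>\<^sup>2 \<le> 3"
  proof -
    have "\<psi> \<le> 1.7" using \<psi>(2) pi_less_4 pi_approx by simp
    then have "\<psi>\<^sup>2 \<le> 1.7\<^sup>2" using \<psi>(1) by (intro power_mono) auto
    then show ?thesis by (simp add: power2_eq_square)
  qed
  then have "\<psi> * \<psi>\<^sup>2 \<le> \<psi> * 3" using \<psi>(1) by (intro mult_left_mono) auto
  ultimately have "\<bar>sin \<psi> - \<psi>\<bar> \<le> \<psi> / 2" using \<psi>(1) by (simp add: power3_eq_cube power2_eq_square mult.assoc)
  then have "- (sin \<psi> - \<psi>) \<le> \<psi> / 2" by (rule abs_le_D2)
  then have "\<psi> \<le> 2 * sin \<psi>" by simp
  then show ?thesis unfolding norm by (simp add: \<psi>_def)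
qed

lemma norm_pt_diff_le: "norm (pt \<zeta>1 z1 - pt \<zeta>2 z2) \<le> cmod (\<zeta>1 - \<zeta>2) + \<bar>z1 - z2\<bar>"
proof -
  have "pt \<zeta>1 z1 - pt \<zeta>2 z2 = pt (\<zeta>1 - \<zeta>2) (z1 - z2)"
    by (simp add: vec_eq_iff forall_3)
  then show ?thesis using sqrt_sum_squares_le_sum_abs[of "cmod (\<zeta>1 - \<zeta>2)" "z1 - z2"] by (simp add: norm_pt)
qed

text \<open>
  The contact element is the point at distance \<open>\<rho>0\<close> from the pole in the direction \<open>\<theta>\<close>, with the outward
  radial normal. The two touching circles have their centers on the great circle orthogonal to it.
\<close>

lemma sph_touch_pt:
  fixes \<theta> :: real
  assumes on: "(cmod \<zeta>1)\<^sup>2 + z1\<^sup>2 = 1" "(cmod \<zeta>2)\<^sup>2 + z2\<^sup>2 = 1"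
    and "cmod (\<zeta>1 - cis \<theta> * Complex (cos \<rho>1 * sin \<rho>0) (- sin \<rho>1)) \<le> \<tau>" "\<bar>z1 - cos \<rho>1 * cos \<rho>0\<bar> \<le> \<tau>"
    and "cmod (\<zeta>2 - cis \<theta> * Complex (cos \<rho>2 * sin \<rho>0) (sin \<rho>2)) \<le> \<tau>" "\<bar>z2 - cos \<rho>2 * cos \<rho>0\<bar> \<le> \<tau>"
  shows "sph_touch (4 * \<tau>) (pt 0 1) \<rho>0 (pt \<zeta>1 z1) \<rho>1 (pt \<zeta>2 z2) \<rho>2"
proof -
  define p where "p = pt (of_real (sin \<rho>0) * cis \<theta>) (cos \<rho>0)"
  define n where "n = pt (of_real (cos \<rho>0) * cis \<theta>) (- sin \<rho>0)"
  have sq: "cos t * cos t = 1 - sin t * sin t" for t :: real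
    using sin_cos_squared_add[of t] by (simp add: power2_eq_square)
  have sq2: "cos t * (cos t * x) = x - sin t * (sin t * x)" for t x :: real
    by (simp add: mult.assoc[symmetric] sq left_diff_distrib)
  have c0: "pt 0 1 = sph_center p n \<rho>0"
    by (simp add: p_def n_def sph_center_def vec_eq_iff forall_3 sq)
  have cross: "cross3 p n = pt (\<i> * cis \<theta>) 0"
    by (simp add: p_def n_def vec_eq_iff forall_3 cross3_def) (simp add: sq sq2 algebra_simps)
  have c1: "sph_center p (cross3 p n) \<rho> = pt (cis \<theta> * Complex (cos \<rho> * sin \<rho>0) (- sin \<rho>)) (cos \<rho> * cos \<rho>0)" for \<rho>
    unfolding cross by (simp add: p_def sph_center_def vec_eq_iff forall_3 algebra_simps)
  have c2: "sph_center p (- cross3 p n) \<rho> = pt (cis \<theta> * Complex (cos \<rho> * sin \<rho>0) (sin \<rho>)) (cos \<rho> * cos \<rho>0)" for \<rho>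
    unfolding cross by (simp add: p_def sph_center_def vec_eq_iff forall_3 algebra_simps)
  have unit: "norm (pt (cis \<theta> * Complex (cos \<rho> * sin \<rho>0) s) (cos \<rho> * cos \<rho>0)) = 1" if "s\<^sup>2 = (sin \<rho>)\<^sup>2" for \<rho> s
  proof -
    have "(cos \<rho> * sin \<rho>0)\<^sup>2 + s\<^sup>2 + (cos \<rho> * cos \<rho>0)\<^sup>2 = 1"
      using that by (simp add: power_mult_distrib cos_squared_eq algebra_simps)
    then show ?thesis by (simp add: norm_pt norm_mult cmod_power2)
  qed
  show ?thesis
    unfolding sph_touch_def
  proof (rule exI[of _ p], rule exI[of _ n], intro conjI)
    show "norm p = 1" "norm n = 1" by (simp_all add: p_def n_def norm_pt norm_mult)
    show "p \<bullet> n = 0" by (simp add: p_def n_def inner_pt) (simp add: sq sq2 algebra_simps)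
    show "pt 0 1 = sph_center p n \<rho>0" by (rule c0)
    show "sph_dist (pt \<zeta>1 z1) (sph_center p (cross3 p n) \<rho>1) \<le> 4 * \<tau>"
      using sph_dist_le[OF _ unit[of "- sin \<rho>1" \<rho>1], of "pt \<zeta>1 z1"] assms
        norm_pt_diff_le[of \<zeta>1 z1 "cis \<theta> * Complex (cos \<rho>1 * sin \<rho>0) (- sin \<rho>1)" "cos \<rho>1 * cos \<rho>0"]
      unfolding c1 by (simp add: norm_pt)
    show "sph_dist (pt \<zeta>2 z2) (sph_center p (- cross3 p n) \<rho>2) \<le> 4 * \<tau>"
      using sph_dist_le[OF _ unit[of "sin \<rho>2" \<rho>2], of "pt \<zeta>2 z2"] assms
        norm_pt_diff_le[of \<zeta>2 z2 "cis \<theta> * Complex (cos \<rho>2 * sin \<rho>0) (sin \<rho>2)" "cos \<rho>2 * cos \<rho>0"]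
      unfolding c2 by (simp add: norm_pt)
  qed
qed

section \<open>Touching circles in the hyperbolic plane\<close>

lemma lorentz_pt: "lorentz (pt \<zeta>1 z1) (pt \<zeta>2 z2) = Re \<zeta>1 * Re \<zeta>2 + Im \<zeta>1 * Im \<zeta>2 - z1 * z2"
  by (simp add: lorentz_def)

lemma pt_in_hyp_plane: "pt \<zeta> z \<in> hyp_plane \<longleftrightarrow> z\<^sup>2 = 1 + (cmod \<zeta>)\<^sup>2 \<and> 0 < z"
  by (auto simp: hyp_plane_def lorentz_pt cmod_power2 simp flip: power2_eq_square)

text \<open>
  The Lorentz square of the difference of two points of the hyperboloid is \<open>2 (cosh d - 1)\<close>, which is at
  least \<open>d\<^sup>2\<close> and at most the square of the horizontal distance.
\<close>

lemma hyp_dist_pt_le: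
  assumes a: "pt \<zeta>1 z1 \<in> hyp_plane" and b: "pt \<zeta>2 z2 \<in> hyp_plane"
  shows "hyp_dist (pt \<zeta>1 z1) (pt \<zeta>2 z2) \<le> cmod (\<zeta>1 - \<zeta>2)"
proof -
  define x where "x = - lorentz (pt \<zeta>1 z1) (pt \<zeta>2 z2)"
  have z: "z1\<^sup>2 = 1 + (cmod \<zeta>1)\<^sup>2" "z2\<^sup>2 = 1 + (cmod \<zeta>2)\<^sup>2" "0 < z1" "0 < z2"
    using a b by (auto simp: pt_in_hyp_plane)
  have "1 + cmod \<zeta>1 * cmod \<zeta>2 \<le> z1 * z2"
  proof (rule power2_le_imp_le)
    have "0 \<le> (cmod \<zeta>1 - cmod \<zeta>2)\<^sup>2" by simp
    then show "(1 + cmod \<zeta>1 * cmod \<zeta>2)\<^sup>2 \<le> (z1 * z2)\<^sup>2"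
      unfolding power_mult_distrib z by (simp add: power2_eq_square algebra_simps)
  qed (use z in simp)
  moreover have "Re \<zeta>1 * Re \<zeta>2 + Im \<zeta>1 * Im \<zeta>2 \<le> cmod \<zeta>1 * cmod \<zeta>2"
    using complex_Re_le_cmod[of "\<zeta>1 * cnj \<zeta>2"] by (simp add: norm_mult)
  ultimately have x1: "1 \<le> x" by (simp add: x_def lorentz_pt)
  define d where "d = hyp_dist (pt \<zeta>1 z1) (pt \<zeta>2 z2)"
  have d: "0 \<le> d" "cosh d = x" using x1 by (auto simp: d_def hyp_dist_def x_def[symmetric])
  have "(d / 2)\<^sup>2 \<le> (sinh (d / 2))\<^sup>2"
    using real_le_abs_sinh[of "d / 2"] d(1)
    by (simp add: sinh_field_def exp_minus abs_le_square_iff[symmetric])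
  then have "d\<^sup>2 \<le> 2 * x - 2"
    using cosh_double_cosh[of "d / 2"] d(2) by (simp add: sinh_square_eq power_divide)
  also have "2 * x - 2 = (cmod (\<zeta>1 - \<zeta>2))\<^sup>2 - (z1 - z2)\<^sup>2"
    using z(1,2) unfolding x_def lorentz_pt cmod_power2 by (simp add: power2_eq_square algebra_simps)
  also have "\<dots> \<le> (cmod (\<zeta>1 - \<zeta>2))\<^sup>2" by simp
  finally show ?thesis unfolding d_def by (rule power2_le_imp_le) simp
qed

lemma hyp_touch_pt:
  fixes \<theta> :: real
  assumes on: "pt \<zeta>1 z1 \<in> hyp_plane" "pt \<zeta>2 z2 \<in> hyp_plane"
    and "cmod (\<zeta>1 - cis \<theta> * Complex (cosh \<rho>1 * sinh \<rho>0) (- sinh \<rho>1)) \<le> \<tau>"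
    and "cmod (\<zeta>2 - cis \<theta> * Complex (cosh \<rho>2 * sinh \<rho>0) (sinh \<rho>2)) \<le> \<tau>"
  shows "hyp_touch \<tau> (pt 0 1) \<rho>0 (pt \<zeta>1 z1) \<rho>1 (pt \<zeta>2 z2) \<rho>2"
proof -
  define p where "p = pt (of_real (sinh \<rho>0) * cis \<theta>) (cosh \<rho>0)"
  define n where "n = pt (of_real (cosh \<rho>0) * cis \<theta>) (sinh \<rho>0)"
  have sq: "cosh t * cosh t = 1 + sinh t * sinh t" for t :: real
    using cosh_square_eq[of t] by (simp add: power2_eq_square)
  have sq': "cos t * cos t = 1 - sin t * sin t" for t :: real
    using sin_cos_squared_add[of t] by (simp add: power2_eq_square)
  have sq2: "cosh t * (cosh t * x) = x + sinh t * (sinh t * x)" for t x :: real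
    by (simp add: mult.assoc[symmetric] sq distrib_right)
  have sq2': "cos t * (cos t * x) = x - sin t * (sin t * x)" for t x :: real
    by (simp add: mult.assoc[symmetric] sq' left_diff_distrib)
  have c0: "pt 0 1 = hyp_center p n \<rho>0"
    by (simp add: p_def n_def hyp_center_def vec_eq_iff forall_3 sq)
  have cross: "lorentz_cross p n = pt (\<i> * cis \<theta>) 0"
    by (simp add: p_def n_def vec_eq_iff forall_3 lorentz_cross_def cross3_def) (simp add: algebra_simps sq sq2)
  have c1: "hyp_center p (lorentz_cross p n) \<rho> = pt (cis \<theta> * Complex (cosh \<rho> * sinh \<rho>0) (- sinh \<rho>)) (cosh \<rho> * cosh \<rho>0)" for \<rho>
    unfolding cross by (simp add: p_def hyp_center_def vec_eq_iff forall_3 algebra_simps)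
  have c2: "hyp_center p (- lorentz_cross p n) \<rho> = pt (cis \<theta> * Complex (cosh \<rho> * sinh \<rho>0) (sinh \<rho>)) (cosh \<rho> * cosh \<rho>0)" for \<rho>
    unfolding cross by (simp add: p_def hyp_center_def vec_eq_iff forall_3 algebra_simps)
  have unit: "pt (cis \<theta> * Complex (cosh \<rho> * sinh \<rho>0) s) (cosh \<rho> * cosh \<rho>0) \<in> hyp_plane" if "s\<^sup>2 = (sinh \<rho>)\<^sup>2" for \<rho> s
    using that by (simp add: pt_in_hyp_plane norm_mult cmod_power2 power_mult_distrib cosh_square_eq algebra_simps)
  show ?thesis
    unfolding hyp_touch_def
  proof (rule exI[of _ p], rule exI[of _ n], intro conjI)
    show "p \<in> hyp_plane" by (simp add: p_def pt_in_hyp_plane norm_mult cosh_square_eq)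
    show "lorentz n n = 1" "lorentz p n = 0" by (simp_all add: p_def n_def lorentz_pt) (simp_all add: algebra_simps sq sq' sq2 sq2')
    show "pt 0 1 = hyp_center p n \<rho>0" by (rule c0)
    show "hyp_dist (pt \<zeta>1 z1) (hyp_center p (lorentz_cross p n) \<rho>1) \<le> \<tau>"
      using hyp_dist_pt_le[OF on(1) unit[of "- sinh \<rho>1" \<rho>1]] assms(3) unfolding c1 by simp
    show "hyp_dist (pt \<zeta>2 z2) (hyp_center p (- lorentz_cross p n) \<rho>2) \<le> \<tau>"
      using hyp_dist_pt_le[OF on(2) unit[of "sinh \<rho>2" \<rho>2]] assms(4) unfolding c2 by simp
  qed
qed

section \<open>Angles and distances in a plane of constant curvature\<close>

lemma agree_divide_power:
  assumes f: "agree k f (\<lambda>\<epsilon>. \<epsilon> ^ m * g \<epsilon>)" and k: "n + m = k"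
  shows "agree n (\<lambda>\<epsilon>. f \<epsilon> / \<epsilon> ^ m) g"
proof -
  have pos: "\<forall>\<^sub>F \<epsilon> in at_right (0::real). 0 < \<epsilon>" using eventually_0_1 by (auto elim: eventually_mono)
  have "(\<lambda>\<epsilon>. (f \<epsilon> - \<epsilon> ^ m * g \<epsilon>) * inverse (\<epsilon> ^ m)) \<in> O[at_right 0](\<lambda>\<epsilon>. \<epsilon> ^ (n + m) * inverse (\<epsilon> ^ m))"
    using f unfolding agree_def k by (rule landau_o.big.mult_right)
  moreover have 1: "\<forall>\<^sub>F \<epsilon> in at_right 0. (f \<epsilon> - \<epsilon> ^ m * g \<epsilon>) * inverse (\<epsilon> ^ m) = f \<epsilon> / \<epsilon> ^ m - g \<epsilon>"
    using pos by eventually_elim (simp add: field_simps)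
  moreover have 2: "\<forall>\<^sub>F \<epsilon> in at_right (0::real). \<epsilon> ^ (n + m) * inverse (\<epsilon> ^ m) = \<epsilon> ^ n"
    using pos by eventually_elim (simp add: power_add)
  ultimately show ?thesis
    unfolding agree_def landau_o.big.in_cong[OF 1] landau_o.big.cong[OF 2] by simp
qed

lemma agree_divide_id: "agree (Suc n) f (\<lambda>\<epsilon>. \<epsilon> * g \<epsilon>) \<Longrightarrow> agree n (\<lambda>\<epsilon>. f \<epsilon> / \<epsilon>) g"
  using agree_divide_power[of "Suc n" f 1 g n] by simp

lemma bigo_id_mult:
  assumes "(X \<longlongrightarrow> (L::real)) (at_right 0)"
  shows "(\<lambda>\<epsilon>. \<epsilon> ^ n * X \<epsilon>) \<in> O[at_right 0](\<lambda>\<epsilon>. \<epsilon> ^ n)"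
  using landau_o.big.mult[OF landau_o.big_refl[of "\<lambda>\<epsilon>. \<epsilon> ^ n"] tendsto_imp_bigo_1[OF assms]] by simp

lemma agree_scaled_cubic:
  fixes f X :: "real \<Rightarrow> real"
  assumes f: "(\<lambda>x. f x - (x + c * x ^ 3)) \<in> O[at 0](\<lambda>x. x ^ 5)" "f 0 = 0"
    and X: "(X \<longlongrightarrow> L) (at_right 0)"
  shows "agree 3 (\<lambda>\<epsilon>. f (\<epsilon> * X \<epsilon>) / \<epsilon>) (\<lambda>\<epsilon>. X \<epsilon> + \<epsilon>\<^sup>2 * (c * X \<epsilon> ^ 3))"
    and "((\<lambda>\<epsilon>. f (\<epsilon> * X \<epsilon>) / \<epsilon>) \<longlongrightarrow> L) (at_right 0)"
proof -
  have "(\<lambda>\<epsilon>. \<epsilon> * X \<epsilon>) \<in> O[at_right 0](\<lambda>\<epsilon>. \<epsilon>)" using bigo_id_mult[OF X, of 1] by simp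
  from agree_compose_at_0[OF f(1) _ this] f(2)
  have "agree (Suc 4) (\<lambda>\<epsilon>. f (\<epsilon> * X \<epsilon>)) (\<lambda>\<epsilon>. \<epsilon> * (X \<epsilon> + \<epsilon>\<^sup>2 * (c * X \<epsilon> ^ 3)))"
    by (simp add: algebra_simps power2_eq_square power3_eq_cube)
  from agree_mono[OF agree_divide_id[OF this], of 3]
  show 1: "agree 3 (\<lambda>\<epsilon>. f (\<epsilon> * X \<epsilon>) / \<epsilon>) (\<lambda>\<epsilon>. X \<epsilon> + \<epsilon>\<^sup>2 * (c * X \<epsilon> ^ 3))" by simp
  have "((\<lambda>\<epsilon>. X \<epsilon> + \<epsilon>\<^sup>2 * (c * X \<epsilon> ^ 3)) \<longlongrightarrow> L + 0\<^sup>2 * (c * L ^ 3)) (at_right 0)"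
    by (intro tendsto_intros X)
  from agree_tendsto[OF 1 _ this] show "((\<lambda>\<epsilon>. f (\<epsilon> * X \<epsilon>) / \<epsilon>) \<longlongrightarrow> L) (at_right 0)" by simp
qed

lemma agree_perturb:
  assumes "(X \<longlongrightarrow> (L::real)) (at_right 0)" "(\<lambda>\<epsilon>. f \<epsilon> + \<epsilon> ^ n * X \<epsilon>) = g"
  shows "agree n g f"
  using bigo_id_mult[OF assms(1), of n] by (simp add: agree_def flip: assms(2))

lemma sinh_cosh_products:
  fixes x y :: real
  shows "sinh x * cosh x - sinh y * cosh y = sinh (x - y) * cosh (y + x)"
    and "sinh x * cosh x ^ 3 + sinh x ^ 3 * cosh x = sinh (4 * x) / 4"
proof -
  have sq: "(cosh t)\<^sup>2 = 1 + (sinh t)\<^sup>2" for t :: real by (simp add: cosh_square_eq)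
  have "sinh (x - y) * cosh (y + x) = (cosh y)\<^sup>2 * (sinh x * cosh x) - (sinh y)\<^sup>2 * (sinh x * cosh x)
      + (sinh x)\<^sup>2 * (sinh y * cosh y) - (cosh x)\<^sup>2 * (sinh y * cosh y)"
    by (simp add: sinh_diff cosh_add algebra_simps power2_eq_square)
  then show "sinh x * cosh x - sinh y * cosh y = sinh (x - y) * cosh (y + x)"
    by (simp add: sq algebra_simps)
  have "sinh (4 * x) = 2 * sinh (2 * x) * cosh (2 * x)" using sinh_double[of "2 * x"] by simp
  also have "\<dots> = 2 * (2 * sinh x * cosh x) * ((cosh x)\<^sup>2 + (sinh x)\<^sup>2)"
    unfolding sinh_double cosh_double ..
  finally show "sinh x * cosh x ^ 3 + sinh x ^ 3 * cosh x = sinh (4 * x) / 4"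
    by (simp add: algebra_simps power2_eq_square power3_eq_cube)
qed

text \<open>
  The horizontal position of the center of a circle of radius \<open>\<rho>\<close> that meets the circle of radius \<open>\<rho>0\<close>
  about the pole orthogonally, relative to the direction of the touching point.
\<close>

definition spoke :: "(real \<Rightarrow> real) \<Rightarrow> (real \<Rightarrow> real) \<Rightarrow> real \<Rightarrow> real \<Rightarrow> complex" where
  "spoke S C \<rho>0 \<rho> = Complex (C \<rho> * S \<rho>0) (S \<rho>)"

definition touch_chart ::
  "(real \<Rightarrow> real) \<Rightarrow> (real \<Rightarrow> real) \<Rightarrow> real \<Rightarrow> real \<Rightarrow> complex \<Rightarrow> real \<Rightarrow> complex \<Rightarrow> real \<Rightarrow> real \<Rightarrow> bool" where
  "touch_chart S C \<tau> \<rho>0 \<zeta>1 \<rho>1 \<zeta>2 \<rho>2 \<theta> \<longleftrightarrow>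
     cmod (\<zeta>1 - cis \<theta> * cnj (spoke S C \<rho>0 \<rho>1)) \<le> \<tau> \<and> cmod (\<zeta>2 - cis \<theta> * spoke S C \<rho>0 \<rho>2) \<le> \<tau>"

text \<open>
  The positions \<open>\<zeta> k\<close> of the neighbors and the directions \<open>\<theta> j\<close> of the touching points of an approximate
  flower. The heights of the neighbors are taken from the inner circle of the central ring; the bound
  on the heights is their error at the outer circle.
\<close>

definition flower_chart ::
  "(real \<Rightarrow> real) \<Rightarrow> (real \<Rightarrow> real) \<Rightarrow> real \<Rightarrow> (nat \<Rightarrow> real) \<Rightarrow> (nat \<Rightarrow> real) \<Rightarrow>
    (nat \<Rightarrow> complex) \<Rightarrow> (nat \<Rightarrow> real) \<Rightarrow> bool" where
  "flower_chart S C \<tau> r R \<zeta> \<theta> \<longleftrightarrow>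
     (\<forall>k\<in>{1..4}. cmod (\<zeta> k) = cmod (spoke S C (r 0) (R k)) \<and> \<bar>C (R k) * C (r 0) - C (r k) * C (R 0)\<bar> \<le> \<tau>) \<and>
     touch_chart S C \<tau> (r 0) (\<zeta> 1) (R 1) (\<zeta> 2) (R 2) (\<theta> 1) \<and>
     touch_chart S C \<tau> (R 0) (\<zeta> 2) (r 2) (\<zeta> 3) (r 3) (\<theta> 2) \<and>
     touch_chart S C \<tau> (r 0) (\<zeta> 3) (R 3) (\<zeta> 4) (R 4) (\<theta> 3) \<and>
     touch_chart S C \<tau> (R 0) (\<zeta> 4) (r 4) (\<zeta> 1) (r 1) (\<theta> 4)"

text \<open>
  The sine and cosine of the plane of curvature \<open>\<kappa>\<close>. The sign of the cubic terms of \<open>S\<close> and \<open>S / C\<close>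
  becomes the sign of \<open>sinh (2 u)\<close> in the differential equation.
\<close>

locale space_form =
  fixes \<kappa> :: real and S C :: "real \<Rightarrow> real"
  assumes curvature: "\<kappa> = 1 \<or> \<kappa> = -1"
    and S_expansion: "(\<lambda>x. S x - (x + (- \<kappa> / 6) * x ^ 3)) \<in> O[at 0](\<lambda>x. x ^ 5)"
    and T_expansion: "(\<lambda>x. S x / C x - (x + \<kappa> / 3 * x ^ 3)) \<in> O[at 0](\<lambda>x. x ^ 5)"
    and C_expansion: "(\<lambda>x. C x - (1 - \<kappa> / 2 * x\<^sup>2 + x ^ 4 / 24)) \<in> O[at 0](\<lambda>x. x ^ 6)"
    and S_0: "S 0 = 0" and C_0: "C 0 = 1"
    and pythagoras: "(C x)\<^sup>2 + \<kappa> * (S x)\<^sup>2 = 1"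
begin

lemma curvature_square: "\<kappa> * \<kappa> = 1" "\<kappa> * (\<kappa> * x) = x"
  using curvature by auto

text \<open>
  The contribution of one neighbor to the angle defect. After division by \<open>\<epsilon>\<^sup>2\<close>, the subtraction formula
  for arctan gives the argument \<open>N / D\<close> with
  \<open>N = sinh (W - u) cosh (W + u) + \<epsilon>\<^sup>2 \<kappa> sinh (2 u) cosh (2 u) / 4 + O(\<epsilon>\<^sup>3)\<close> and
  \<open>D = cosh (W + u) + O(\<epsilon>\<^sup>2)\<close>. The factor \<open>cosh (W + u)\<close> cancels, and \<open>sinh (W - u)\<close> may be replaced by \<open>W - u\<close>.
\<close>

lemma ring_angle_agree:
  fixes W :: "real \<Rightarrow> real"
  assumes W: "agree 1 W (\<lambda>_. u)"
  defines "a \<equiv> \<lambda>\<epsilon>. S (\<epsilon> * sinh (W \<epsilon>)) / C (\<epsilon> * sinh (W \<epsilon>))" and "b \<equiv> \<lambda>\<epsilon>. S (\<epsilon> * cosh u)"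
    and "c \<equiv> \<lambda>\<epsilon>. S (\<epsilon> * sinh u)" and "d \<equiv> \<lambda>\<epsilon>. S (\<epsilon> * cosh (W \<epsilon>)) / C (\<epsilon> * cosh (W \<epsilon>))"
  shows "agree 3 (\<lambda>\<epsilon>. arctan (a \<epsilon> / b \<epsilon>) - arctan (c \<epsilon> / d \<epsilon>)) (\<lambda>\<epsilon>. (W \<epsilon> - u) + \<epsilon>\<^sup>2 * (\<kappa> * sinh (2 * u) / 4))"
proof -
  have lim: "(W \<longlongrightarrow> u) (at_right 0)" by (rule agree_tendsto[OF W]) auto
  note lims = tendsto_sinh[OF lim] tendsto_cosh[OF lim]
  define a' where "a' \<epsilon> = sinh (W \<epsilon>) + \<epsilon>\<^sup>2 * (\<kappa> / 3 * sinh (W \<epsilon>) ^ 3)" for \<epsilon>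
  define b' where "b' \<epsilon> = cosh u + \<epsilon>\<^sup>2 * (- \<kappa> / 6 * cosh u ^ 3)" for \<epsilon>
  define c' where "c' \<epsilon> = sinh u + \<epsilon>\<^sup>2 * (- \<kappa> / 6 * sinh u ^ 3)" for \<epsilon>
  define d' where "d' \<epsilon> = cosh (W \<epsilon>) + \<epsilon>\<^sup>2 * (\<kappa> / 3 * cosh (W \<epsilon>) ^ 3)" for \<epsilon>
  have T_0: "S 0 / C 0 = 0" by (simp add: S_0)
  have a: "agree 3 (\<lambda>\<epsilon>. a \<epsilon> / \<epsilon>) a'" "((\<lambda>\<epsilon>. a \<epsilon> / \<epsilon>) \<longlongrightarrow> sinh u) (at_right 0)"
    unfolding a_def a'_def by (rule agree_scaled_cubic[OF T_expansion T_0 lims(1)])+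
  have b: "agree 3 (\<lambda>\<epsilon>. b \<epsilon> / \<epsilon>) b'" "((\<lambda>\<epsilon>. b \<epsilon> / \<epsilon>) \<longlongrightarrow> cosh u) (at_right 0)"
    unfolding b_def b'_def by (rule agree_scaled_cubic[OF S_expansion S_0 tendsto_const])+
  have c: "agree 3 (\<lambda>\<epsilon>. c \<epsilon> / \<epsilon>) c'" "((\<lambda>\<epsilon>. c \<epsilon> / \<epsilon>) \<longlongrightarrow> sinh u) (at_right 0)"
    unfolding c_def c'_def by (rule agree_scaled_cubic[OF S_expansion S_0 tendsto_const])+
  have d: "agree 3 (\<lambda>\<epsilon>. d \<epsilon> / \<epsilon>) d'" "((\<lambda>\<epsilon>. d \<epsilon> / \<epsilon>) \<longlongrightarrow> cosh u) (at_right 0)"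
    unfolding d_def d'_def by (rule agree_scaled_cubic[OF T_expansion T_0 lims(2)])+
  have lims': "(a' \<longlongrightarrow> sinh u) (at_right 0)" "(c' \<longlongrightarrow> sinh u) (at_right 0)" "(d' \<longlongrightarrow> cosh u) (at_right 0)"
    using agree_tendsto[OF agree_sym[OF a(1)] _ a(2)] agree_tendsto[OF agree_sym[OF c(1)] _ c(2)]
      agree_tendsto[OF agree_sym[OF d(1)] _ d(2)] by auto
  define N where "N \<epsilon> = a \<epsilon> / \<epsilon> * (d \<epsilon> / \<epsilon>) - b \<epsilon> / \<epsilon> * (c \<epsilon> / \<epsilon>)" for \<epsilon>
  define D where "D \<epsilon> = b \<epsilon> / \<epsilon> * (d \<epsilon> / \<epsilon>) + a \<epsilon> / \<epsilon> * (c \<epsilon> / \<epsilon>)" for \<epsilon>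
  define Q where "Q \<epsilon> = (sinh (W \<epsilon>) * cosh (W \<epsilon>)) ^ 3 / 9 - (sinh u * cosh u) ^ 3 / 36" for \<epsilon>
  \<comment> \<open>The expected quotient of \<open>N\<close> and \<open>D\<close>, multiplied back below to avoid expanding \<open>1 / D\<close>.\<close>
  define Y where "Y \<epsilon> = sinh (W \<epsilon> - u) + \<epsilon>\<^sup>2 * (\<kappa> * sinh (2 * u) / 4)" for \<epsilon>
  have D_lim: "(D \<longlongrightarrow> cosh u * cosh u + sinh u * sinh u) (at_right 0)"
    unfolding D_def by (intro tendsto_intros a b c d)
  have cosh2: "cosh u * cosh u + sinh u * sinh u = cosh (2 * u)"
    by (simp add: cosh_double power2_eq_square)
  have "agree 3 N (\<lambda>\<epsilon>. a' \<epsilon> * d' \<epsilon> - b' \<epsilon> * c' \<epsilon>)"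
    unfolding N_def by (intro agree_diff agree_mult[OF a(1) d(1) a(2) lims'(3)] agree_mult[OF b(1) c(1) b(2) lims'(2)])
  also have "(\<lambda>\<epsilon>. a' \<epsilon> * d' \<epsilon> - b' \<epsilon> * c' \<epsilon>) = (\<lambda>\<epsilon>. sinh (W \<epsilon> - u) * cosh (u + W \<epsilon>)
      + \<epsilon>\<^sup>2 * (\<kappa> / 12 * sinh (4 * W \<epsilon>) + \<kappa> / 24 * sinh (4 * u)
        + \<epsilon>\<^sup>2 * Q \<epsilon>))"
  proof
    fix \<epsilon>
    have "a' \<epsilon> * d' \<epsilon> - b' \<epsilon> * c' \<epsilon> = (sinh (W \<epsilon>) * cosh (W \<epsilon>) - sinh u * cosh u)
      + \<epsilon>\<^sup>2 * (\<kappa> / 3 * (sinh (W \<epsilon>) * cosh (W \<epsilon>) ^ 3 + sinh (W \<epsilon>) ^ 3 * cosh (W \<epsilon>))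
        + \<kappa> / 6 * (sinh u * cosh u ^ 3 + sinh u ^ 3 * cosh u)
        + \<epsilon>\<^sup>2 * (\<kappa> * \<kappa> * (sinh (W \<epsilon>) * cosh (W \<epsilon>)) ^ 3 / 9 - \<kappa> * \<kappa> * (sinh u * cosh u) ^ 3 / 36))"
      unfolding a'_def b'_def c'_def d'_def by (simp add: field_simps power2_eq_square power3_eq_cube)
    then show "a' \<epsilon> * d' \<epsilon> - b' \<epsilon> * c' \<epsilon> = sinh (W \<epsilon> - u) * cosh (u + W \<epsilon>)
      + \<epsilon>\<^sup>2 * (\<kappa> / 12 * sinh (4 * W \<epsilon>) + \<kappa> / 24 * sinh (4 * u)
        + \<epsilon>\<^sup>2 * Q \<epsilon>)"
      unfolding sinh_cosh_products curvature_square Q_def by simp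
  qed
  finally have N1: "agree 3 N \<dots>" .
  have "agree 1 (\<lambda>\<epsilon>. \<kappa> / 12 * sinh (4 * W \<epsilon>)) (\<lambda>\<epsilon>. \<kappa> / 12 * sinh (4 * u))"
    by (rule agree_compose[OF W lim tendsto_const open_UNIV, where F="\<lambda>x. \<kappa> / 12 * sinh (4 * x)" and F'="\<lambda>x. \<kappa> / 3 * cosh (4 * x)"])
       (auto intro!: derivative_eq_intros continuous_intros)
  moreover have "agree 2 (\<lambda>\<epsilon>. 0 + \<epsilon> ^ 2 * Q \<epsilon>) (\<lambda>_. 0)"
    by (rule agree_perturb[OF _ refl], unfold Q_def, (rule tendsto_intros lims | simp)+)
  from agree_mono[OF this, of 1]
  have "agree 1 (\<lambda>\<epsilon>. \<epsilon>\<^sup>2 * Q \<epsilon>) (\<lambda>_. 0)"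
    by simp
  ultimately have "agree 1 (\<lambda>\<epsilon>. \<kappa> / 12 * sinh (4 * W \<epsilon>) + \<kappa> / 24 * sinh (4 * u)
        + \<epsilon>\<^sup>2 * Q \<epsilon>)
      (\<lambda>\<epsilon>. \<kappa> / 12 * sinh (4 * u) + \<kappa> / 24 * sinh (4 * u) + 0)"
    by (intro agree_add agree_refl)
  from agree_add[OF agree_refl agree_scale[OF this landau_o.big_refl[of "\<lambda>\<epsilon>. \<epsilon>\<^sup>2"]]]
  have N2: "agree 3 (\<lambda>\<epsilon>. sinh (W \<epsilon> - u) * cosh (u + W \<epsilon>) + \<epsilon>\<^sup>2 * (\<kappa> / 12 * sinh (4 * W \<epsilon>) + \<kappa> / 24 * sinh (4 * u)
        + \<epsilon>\<^sup>2 * Q \<epsilon>))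
     (\<lambda>\<epsilon>. sinh (W \<epsilon> - u) * cosh (u + W \<epsilon>) + \<epsilon>\<^sup>2 * (\<kappa> / 12 * sinh (4 * u) + \<kappa> / 24 * sinh (4 * u) + 0))" by simp
  have quad: "\<kappa> / 12 * sinh (4 * u) + \<kappa> / 24 * sinh (4 * u) + 0 = \<kappa> * sinh (2 * u) / 4 * cosh (u + u)"
    using sinh_double[of "2 * u"] by (simp flip: mult_2)
  have N: "agree 3 N (\<lambda>\<epsilon>. sinh (W \<epsilon> - u) * cosh (u + W \<epsilon>) + \<epsilon>\<^sup>2 * (\<kappa> * sinh (2 * u) / 4 * cosh (u + u)))"
    using agree_trans[OF N1 N2] unfolding quad .
  have bD: "agree 2 (\<lambda>\<epsilon>. b \<epsilon> / \<epsilon>) (\<lambda>_. cosh u)"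
    by (rule agree_trans[OF agree_mono[OF b(1)] agree_perturb[OF tendsto_const[of "- \<kappa> / 6 * cosh u ^ 3"]]]) (auto simp: b'_def)
  have cD: "agree 2 (\<lambda>\<epsilon>. c \<epsilon> / \<epsilon>) (\<lambda>_. sinh u)"
    by (rule agree_trans[OF agree_mono[OF c(1)] agree_perturb[OF tendsto_const[of "- \<kappa> / 6 * sinh u ^ 3"]]]) (auto simp: c'_def)
  have aD: "agree 2 (\<lambda>\<epsilon>. a \<epsilon> / \<epsilon>) (\<lambda>\<epsilon>. sinh (W \<epsilon>))"
    by (rule agree_trans[OF agree_mono[OF a(1)] agree_perturb[of "\<lambda>\<epsilon>. \<kappa> / 3 * sinh (W \<epsilon>) ^ 3" "\<kappa> / 3 * sinh u ^ 3"]])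
       (auto simp: a'_def intro!: tendsto_intros lims)
  have dD: "agree 2 (\<lambda>\<epsilon>. d \<epsilon> / \<epsilon>) (\<lambda>\<epsilon>. cosh (W \<epsilon>))"
    by (rule agree_trans[OF agree_mono[OF d(1)] agree_perturb[of "\<lambda>\<epsilon>. \<kappa> / 3 * cosh (W \<epsilon>) ^ 3" "\<kappa> / 3 * cosh u ^ 3"]])
       (auto simp: d'_def intro!: tendsto_intros lims)
  have "agree 2 D (\<lambda>\<epsilon>. cosh u * cosh (W \<epsilon>) + sinh (W \<epsilon>) * sinh u)"
    unfolding D_def
    by (intro agree_add agree_mult[OF bD dD b(2) lims(2)] agree_mult[OF aD cD a(2) tendsto_const])
  then have D: "agree 2 D (\<lambda>\<epsilon>. cosh (u + W \<epsilon>))" by (simp add: cosh_add mult.commute)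
  have \<delta>: "(\<lambda>\<epsilon>. W \<epsilon> - u) \<in> O[at_right 0](\<lambda>\<epsilon>. \<epsilon>)" using W by (simp add: agree_def)
  have "(\<lambda>x::real. sinh x - x) \<in> O[at 0](\<lambda>x. x ^ 3)" by real_asymp
  from agree_add[OF agree_compose_at_0[OF this _ \<delta>] agree_refl]
  have Y: "agree 3 Y (\<lambda>\<epsilon>. (W \<epsilon> - u) + \<epsilon>\<^sup>2 * (\<kappa> * sinh (2 * u) / 4))" unfolding Y_def by simp
  have "(\<lambda>\<epsilon>. \<epsilon> ^ 2 * (\<kappa> * sinh (2 * u) / 4)) \<in> O[at_right 0](\<lambda>\<epsilon>. \<epsilon> ^ 1)"
    by (rule bigo_power_mono[OF bigo_id_mult[OF tendsto_const]]) simp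
  then have "(\<lambda>\<epsilon>. (W \<epsilon> - u) + \<epsilon>\<^sup>2 * (\<kappa> * sinh (2 * u) / 4)) \<in> O[at_right 0](\<lambda>\<epsilon>. \<epsilon> ^ 1)"
    by (rule sum_in_bigo(1)[rotated]) (use \<delta> in simp)
  from agree_imp_bigo[OF agree_mono[OF Y] this] have YO: "Y \<in> O[at_right 0](\<lambda>\<epsilon>. \<epsilon> ^ 1)" by simp
  have "agree 1 (\<lambda>\<epsilon>. cosh (u + W \<epsilon>)) (\<lambda>\<epsilon>. cosh (u + u))"
    by (rule agree_compose[OF W lim tendsto_const open_UNIV, where F="\<lambda>x. cosh (u + x)" and F'="\<lambda>x. sinh (u + x)"])
       (auto intro!: derivative_eq_intros continuous_intros)
  from agree_scale[OF this bigo_id_mult[OF tendsto_const, of 2 "\<kappa> * sinh (2 * u) / 4"]]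
  have "agree 3 (\<lambda>\<epsilon>. \<epsilon>\<^sup>2 * (\<kappa> * sinh (2 * u) / 4) * cosh (u + W \<epsilon>)) (\<lambda>\<epsilon>. \<epsilon>\<^sup>2 * (\<kappa> * sinh (2 * u) / 4) * cosh (u + u))" by simp
  from agree_add[OF agree_refl[of 3 "\<lambda>\<epsilon>. sinh (W \<epsilon> - u) * cosh (u + W \<epsilon>)"] this]
  have "agree 3 (\<lambda>\<epsilon>. Y \<epsilon> * cosh (u + W \<epsilon>)) (\<lambda>\<epsilon>. sinh (W \<epsilon> - u) * cosh (u + W \<epsilon>) + \<epsilon>\<^sup>2 * (\<kappa> * sinh (2 * u) / 4 * cosh (u + u)))"
    unfolding Y_def by (simp add: distrib_right mult.assoc)
  from agree_trans[OF N agree_sym[OF this]]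
  have "agree 3 N (\<lambda>\<epsilon>. Y \<epsilon> * cosh (u + W \<epsilon>))" .
  also have "agree 3 (\<lambda>\<epsilon>. Y \<epsilon> * cosh (u + W \<epsilon>)) (\<lambda>\<epsilon>. Y \<epsilon> * D \<epsilon>)"
    using agree_scale[OF agree_sym[OF D] YO] by (simp add: numeral_3_eq_3)
  finally have ND: "agree 3 N (\<lambda>\<epsilon>. Y \<epsilon> * D \<epsilon>)" .
  have inv: "((\<lambda>\<epsilon>. inverse (D \<epsilon>)) \<longlongrightarrow> inverse (cosh (2 * u))) (at_right 0)"
    using D_lim unfolding cosh2 by (intro tendsto_intros) auto
  have D_pos: "\<forall>\<^sub>F \<epsilon> in at_right 0. 0 < D \<epsilon>"
    using D_lim unfolding cosh2 by (rule order_tendstoD(1)) simp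
  have "agree (0 + 3) (\<lambda>\<epsilon>. inverse (D \<epsilon>) * N \<epsilon>) (\<lambda>\<epsilon>. inverse (D \<epsilon>) * (Y \<epsilon> * D \<epsilon>))"
    by (rule agree_scale[OF ND]) (use tendsto_imp_bigo_1[OF inv] in simp)
  moreover have "\<forall>\<^sub>F \<epsilon> in at_right 0. inverse (D \<epsilon>) * N \<epsilon> = N \<epsilon> / D \<epsilon>" by (simp add: field_simps)
  moreover have "\<forall>\<^sub>F \<epsilon> in at_right 0. inverse (D \<epsilon>) * (Y \<epsilon> * D \<epsilon>) = Y \<epsilon>"
    using D_pos by eventually_elim simp
  ultimately have "agree (0 + 3) (\<lambda>\<epsilon>. N \<epsilon> / D \<epsilon>) Y" by (rule agree_cong)
  then have "agree 3 (\<lambda>\<epsilon>. N \<epsilon> / D \<epsilon>) Y" by simp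
  then have NDY: "agree 3 (\<lambda>\<epsilon>. N \<epsilon> / D \<epsilon>) (\<lambda>\<epsilon>. (W \<epsilon> - u) + \<epsilon>\<^sup>2 * (\<kappa> * sinh (2 * u) / 4))"
    and NDO: "(\<lambda>\<epsilon>. N \<epsilon> / D \<epsilon>) \<in> O[at_right 0](\<lambda>\<epsilon>. \<epsilon>)"
    using Y agree_imp_bigo[OF agree_mono[of 3 "\<lambda>\<epsilon>. N \<epsilon> / D \<epsilon>" Y 1] YO] by (auto intro: agree_trans)
  have "(\<lambda>x::real. arctan x - x) \<in> O[at 0](\<lambda>x. x ^ 3)" by real_asymp
  from agree_trans[OF agree_compose_at_0[OF this _ NDO] NDY]
  have main: "agree 3 (\<lambda>\<epsilon>. arctan (N \<epsilon> / D \<epsilon>)) (\<lambda>\<epsilon>. (W \<epsilon> - u) + \<epsilon>\<^sup>2 * (\<kappa> * sinh (2 * u) / 4))" by simp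
  have "\<bar>tanh u\<bar> < 1" using tanh_real_bounds[of u] by (auto simp: abs_less_iff)
  then have th: "\<bar>sinh u / cosh u\<bar> < 1" by (simp only: tanh_def)
  have "\<forall>\<^sub>F \<epsilon> in at_right 0. \<bar>a \<epsilon> / \<epsilon> / (b \<epsilon> / \<epsilon>)\<bar> < 1" "\<forall>\<^sub>F \<epsilon> in at_right 0. \<bar>c \<epsilon> / \<epsilon> / (d \<epsilon> / \<epsilon>)\<bar> < 1"
    by (rule order_tendstoD(2)[OF tendsto_rabs[OF tendsto_divide[OF a(2) b(2)]] th], simp)
       (rule order_tendstoD(2)[OF tendsto_rabs[OF tendsto_divide[OF c(2) d(2)]] th], simp)
  moreover have "\<forall>\<^sub>F \<epsilon> in at_right 0. 0 < b \<epsilon> / \<epsilon>" "\<forall>\<^sub>F \<epsilon> in at_right 0. 0 < d \<epsilon> / \<epsilon>"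
    by (rule order_tendstoD(1)[OF b(2)], simp) (rule order_tendstoD(1)[OF d(2)], simp)
  ultimately have "\<forall>\<^sub>F \<epsilon> in at_right 0. arctan (N \<epsilon> / D \<epsilon>) = arctan (a \<epsilon> / b \<epsilon>) - arctan (c \<epsilon> / d \<epsilon>)"
    using D_pos eventually_0_1
  proof eventually_elim
    case (elim \<epsilon>)
    define a1 b1 c1 d1 where defs: "a1 = a \<epsilon> / \<epsilon>" "b1 = b \<epsilon> / \<epsilon>" "c1 = c \<epsilon> / \<epsilon>" "d1 = d \<epsilon> / \<epsilon>"
    have pos: "0 < b1" "0 < d1" "0 < b1 * d1 + a1 * c1" "\<bar>a1 / b1\<bar> < 1" "\<bar>c1 / d1\<bar> < 1"
      using elim by (auto simp: defs D_def)
    have "arctan (a1 / b1) + arctan (- (c1 / d1)) = arctan ((a1 / b1 + - (c1 / d1)) / (1 - a1 / b1 * - (c1 / d1)))"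
      using pos by (intro arctan_add) auto
    also have "(a1 / b1 + - (c1 / d1)) / (1 - a1 / b1 * - (c1 / d1)) = N \<epsilon> / D \<epsilon>"
    proof -
      have "a1 / b1 + - (c1 / d1) = (a1 * d1 - b1 * c1) / (b1 * d1)" using pos by (simp add: field_simps)
      moreover have "1 - a1 / b1 * - (c1 / d1) = (b1 * d1 + a1 * c1) / (b1 * d1)" using pos by (simp add: field_simps)
      ultimately show ?thesis using pos unfolding N_def D_def defs[symmetric] by simp
    qed
    finally show ?case using elim unfolding defs arctan_minus by simp
  qed
  from agree_cong[OF main this] show ?thesis by simp
qed

lemma C_tendsto_1:
  assumes "(X \<longlongrightarrow> L) (at_right 0)"
  shows "((\<lambda>\<epsilon>. C (\<epsilon> * X \<epsilon>)) \<longlongrightarrow> 1) (at_right 0)"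
proof -
  define a where "a = (\<lambda>\<epsilon>. \<epsilon> * X \<epsilon>)"
  have aO: "a \<in> O[at_right 0](\<lambda>\<epsilon>. \<epsilon>)" using bigo_id_mult[OF assms, of 1] by (simp add: a_def)
  have a0: "(a \<longlongrightarrow> 0) (at_right 0)" using bigo_power_tendsto_0[of a 1] aO by simp
  have "((\<lambda>\<epsilon>. 1 - \<kappa> / 2 * (a \<epsilon>)\<^sup>2 + a \<epsilon> ^ 4 / 24) \<longlongrightarrow> 1 - \<kappa> / 2 * 0\<^sup>2 + 0 ^ 4 / 24) (at_right 0)"
    by (intro tendsto_intros a0) simp
  from agree_tendsto[OF agree_compose_at_0[OF C_expansion _ aO] _ this] show ?thesis
    by (simp add: C_0 a_def)
qed

text \<open>
  The product \<open>C \<rho> * C \<rho>'\<close> is the height of the center of a neighbor, hence encodes its distance. The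
  terms of order \<open>\<epsilon>\<^sup>2\<close> of the two products coincide since \<open>cosh\<^sup>2 W + sinh\<^sup>2 u = sinh\<^sup>2 W + cosh\<^sup>2 u\<close>, and those of
  order \<open>\<epsilon>\<^sup>4\<close> differ by a multiple of \<open>sinh\<^sup>2 u - sinh\<^sup>2 W = O(\<epsilon>)\<close>.
\<close>

lemma center_height_agree:
  assumes W: "agree 1 W (\<lambda>_. u)"
  shows "agree 5 (\<lambda>\<epsilon>. C (\<epsilon> * cosh (W \<epsilon>)) * C (\<epsilon> * sinh u)) (\<lambda>\<epsilon>. C (\<epsilon> * sinh (W \<epsilon>)) * C (\<epsilon> * cosh u))"
proof -
  have lim: "(W \<longlongrightarrow> u) (at_right 0)" by (rule agree_tendsto[OF W]) auto
  note lims = tendsto_sinh[OF lim] tendsto_cosh[OF lim]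
  define P where "P y = 1 - \<kappa> / 2 * y + y\<^sup>2 / 24" for y
  have C: "agree 5 (\<lambda>\<epsilon>. C (\<epsilon> * X \<epsilon>)) (\<lambda>\<epsilon>. P (\<epsilon>\<^sup>2 * (X \<epsilon>)\<^sup>2))" and P: "((\<lambda>\<epsilon>. P (\<epsilon>\<^sup>2 * (X \<epsilon>)\<^sup>2)) \<longlongrightarrow> 1) (at_right 0)"
    if X: "(X \<longlongrightarrow> L) (at_right 0)" for X L
  proof -
    have "(\<lambda>\<epsilon>. \<epsilon> * X \<epsilon>) \<in> O[at_right 0](\<lambda>\<epsilon>. \<epsilon>)" using bigo_id_mult[OF X, of 1] by simp
    from agree_mono[OF agree_compose_at_0[OF C_expansion _ this], of 5]
    show "agree 5 (\<lambda>\<epsilon>. C (\<epsilon> * X \<epsilon>)) (\<lambda>\<epsilon>. P (\<epsilon>\<^sup>2 * (X \<epsilon>)\<^sup>2))"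
      by (simp add: C_0 P_def power_mult_distrib flip: power_mult)
    have "((\<lambda>\<epsilon>. P (\<epsilon>\<^sup>2 * (X \<epsilon>)\<^sup>2)) \<longlongrightarrow> 1 - \<kappa> / 2 * (0\<^sup>2 * L\<^sup>2) + (0\<^sup>2 * L\<^sup>2)\<^sup>2 / 24) (at_right 0)"
      unfolding P_def by (intro tendsto_intros X) simp
    then show "((\<lambda>\<epsilon>. P (\<epsilon>\<^sup>2 * (X \<epsilon>)\<^sup>2)) \<longlongrightarrow> 1) (at_right 0)" by simp
  qed
  note const = tendsto_const[of "sinh u"] tendsto_const[of "cosh u"]
  have L: "agree 5 (\<lambda>\<epsilon>. C (\<epsilon> * cosh (W \<epsilon>)) * C (\<epsilon> * sinh u)) (\<lambda>\<epsilon>. P (\<epsilon>\<^sup>2 * (cosh (W \<epsilon>))\<^sup>2) * P (\<epsilon>\<^sup>2 * (sinh u)\<^sup>2))"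
    by (rule agree_mult[OF C[OF lims(2)] C[OF const(1)] C_tendsto_1[OF lims(2)] P[OF const(1)]])
  have R: "agree 5 (\<lambda>\<epsilon>. C (\<epsilon> * sinh (W \<epsilon>)) * C (\<epsilon> * cosh u)) (\<lambda>\<epsilon>. P (\<epsilon>\<^sup>2 * (sinh (W \<epsilon>))\<^sup>2) * P (\<epsilon>\<^sup>2 * (cosh u)\<^sup>2))"
    by (rule agree_mult[OF C[OF lims(1)] C[OF const(2)] C_tendsto_1[OF lims(1)] P[OF const(2)]])
  define A where "A \<epsilon> = (sinh (W \<epsilon>))\<^sup>2" for \<epsilon>
  define B where "B = (sinh u)\<^sup>2"
  define M where "M \<epsilon> = 1 / 6 - \<kappa> * (\<epsilon>\<^sup>2 * (1 + A \<epsilon> + B)) / 48 + \<epsilon> ^ 4 * ((1 + A \<epsilon>) * B + A \<epsilon> * (1 + B)) / 576" for \<epsilon>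
  have Alim: "(A \<longlongrightarrow> B) (at_right 0)" unfolding A_def B_def by (intro tendsto_intros lims)
  have P_mult: "P x * P y = 1 - \<kappa> * (x + y) / 2 + (x + y)\<^sup>2 / 24 + x * y * (1 / 6 - \<kappa> * (x + y) / 48) + (x * y)\<^sup>2 / 576" for x y
  proof -
    have "P x * P y = 1 - \<kappa> * (x + y) / 2 + (x\<^sup>2 + y\<^sup>2) / 24 + (\<kappa> * \<kappa>) * (x * y) / 4 - \<kappa> * (x * y * (x + y)) / 48 + (x * y)\<^sup>2 / 576"
      unfolding P_def by (simp add: field_simps power2_eq_square)
    then show ?thesis unfolding curvature_square by (simp add: field_simps power2_eq_square)
  qed
  have diff: "P (\<epsilon>\<^sup>2 * (cosh (W \<epsilon>))\<^sup>2) * P (\<epsilon>\<^sup>2 * (sinh u)\<^sup>2) - P (\<epsilon>\<^sup>2 * (sinh (W \<epsilon>))\<^sup>2) * P (\<epsilon>\<^sup>2 * (cosh u)\<^sup>2)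
      = \<epsilon> ^ 4 * ((B - A \<epsilon>) * M \<epsilon>)" for \<epsilon>
  proof -
    define x y where "x = \<epsilon>\<^sup>2 * (1 + A \<epsilon>)" and "y = \<epsilon>\<^sup>2 * B"
    define x' y' where "x' = \<epsilon>\<^sup>2 * A \<epsilon>" and "y' = \<epsilon>\<^sup>2 * (1 + B)"
    have s: "x' + y' = x + y" by (simp add: x_def y_def x'_def y'_def algebra_simps)
    have "P x * P y - P x' * P y' = (x * y - x' * y') * (1 / 6 - \<kappa> * (x + y) / 48 + (x * y + x' * y') / 576)"
      unfolding P_mult s by (simp add: field_simps power2_eq_square)
    moreover have "x * y - x' * y' = \<epsilon> ^ 4 * (B - A \<epsilon>)"
      by (simp add: x_def y_def x'_def y'_def algebra_simps power2_eq_square power4_eq_xxxx)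
    moreover have "1 / 6 - \<kappa> * (x + y) / 48 + (x * y + x' * y') / 576 = M \<epsilon>"
      by (simp add: M_def x_def y_def x'_def y'_def algebra_simps power2_eq_square power4_eq_xxxx)
    ultimately have "P x * P y - P x' * P y' = \<epsilon> ^ 4 * ((B - A \<epsilon>) * M \<epsilon>)" by simp
    then show ?thesis by (simp add: x_def y_def x'_def y'_def A_def B_def cosh_square_eq add.commute)
  qed
  have "agree 1 A (\<lambda>_. B)"
    unfolding A_def B_def
    by (rule agree_compose[OF W lim tendsto_const open_UNIV, where F="\<lambda>x. (sinh x)\<^sup>2" and F'="\<lambda>x. 2 * (sinh x * cosh x)"])
       (auto intro!: derivative_eq_intros continuous_intros)
  then have "(\<lambda>\<epsilon>. B - A \<epsilon>) \<in> O[at_right 0](\<lambda>\<epsilon>. \<epsilon> ^ 1)" unfolding agree_def[symmetric] by (rule agree_sym)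
  moreover have "(M \<longlongrightarrow> 1 / 6 - \<kappa> * (0\<^sup>2 * (1 + B + B)) / 48 + 0 ^ 4 * ((1 + B) * B + B * (1 + B)) / 576) (at_right 0)"
    unfolding M_def by (intro tendsto_intros Alim) auto
  ultimately have "(\<lambda>\<epsilon>. \<epsilon> ^ 4 * ((B - A \<epsilon>) * M \<epsilon>)) \<in> O[at_right 0](\<lambda>\<epsilon>. \<epsilon> ^ 4 * (\<epsilon> ^ 1 * 1))"
    by (intro landau_o.big.mult landau_o.big_refl tendsto_imp_bigo_1)
  then have "agree 5 (\<lambda>\<epsilon>. P (\<epsilon>\<^sup>2 * (cosh (W \<epsilon>))\<^sup>2) * P (\<epsilon>\<^sup>2 * (sinh u)\<^sup>2)) (\<lambda>\<epsilon>. P (\<epsilon>\<^sup>2 * (sinh (W \<epsilon>))\<^sup>2) * P (\<epsilon>\<^sup>2 * (cosh u)\<^sup>2))"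
    unfolding agree_def diff by (simp add: power_Suc2[symmetric] del: power_Suc)
  from agree_trans[OF agree_trans[OF L this] agree_sym[OF R]] show ?thesis .
qed

lemma cmod_spoke_square: "\<kappa> * (cmod (spoke S C \<rho>0 \<rho>))\<^sup>2 = 1 - (C \<rho> * C \<rho>0)\<^sup>2"
proof -
  have "1 - \<kappa> * (S \<rho>0)\<^sup>2 = (C \<rho>0)\<^sup>2" using pythagoras[of \<rho>0] by simp
  then have "(C \<rho> * C \<rho>0)\<^sup>2 = (C \<rho>)\<^sup>2 * (1 - \<kappa> * (S \<rho>0)\<^sup>2)"
    by (simp add: power_mult_distrib)
  then show ?thesis
    using pythagoras[of \<rho>] by (simp add: spoke_def cmod_power2 power_mult_distrib algebra_simps)
qed

text \<open>
  By \<open>cmod_spoke_square\<close>, the difference of the squared moduli is that of the squared heights, up to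
  sign. Division by the sum of the moduli, which is of order \<open>\<epsilon>\<close>, costs one order.
\<close>

lemma center_distance_agree:
  assumes W: "agree 1 W (\<lambda>_. u)"
  shows "agree 4 (\<lambda>\<epsilon>. cmod (spoke S C (\<epsilon> * sinh u) (\<epsilon> * cosh (W \<epsilon>)))) (\<lambda>\<epsilon>. cmod (spoke S C (\<epsilon> * cosh u) (\<epsilon> * sinh (W \<epsilon>))))"
proof -
  have lim: "(W \<longlongrightarrow> u) (at_right 0)" by (rule agree_tendsto[OF W]) auto
  note lims = tendsto_sinh[OF lim] tendsto_cosh[OF lim]
  define hA hB where "hA \<epsilon> = cmod (spoke S C (\<epsilon> * sinh u) (\<epsilon> * cosh (W \<epsilon>)))"
    and "hB \<epsilon> = cmod (spoke S C (\<epsilon> * cosh u) (\<epsilon> * sinh (W \<epsilon>)))" for \<epsilon>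
  define zA zB where "zA \<epsilon> = C (\<epsilon> * cosh (W \<epsilon>)) * C (\<epsilon> * sinh u)"
    and "zB \<epsilon> = C (\<epsilon> * sinh (W \<epsilon>)) * C (\<epsilon> * cosh u)" for \<epsilon>
  have "(zA \<longlongrightarrow> 1 * 1) (at_right 0)" "(zB \<longlongrightarrow> 1 * 1) (at_right 0)"
    unfolding zA_def zB_def
    by (rule tendsto_mult[OF C_tendsto_1[OF lims(2)] C_tendsto_1[OF tendsto_const]]
        tendsto_mult[OF C_tendsto_1[OF lims(1)] C_tendsto_1[OF tendsto_const]])+
  then have "\<forall>\<^sub>F \<epsilon> in at_right 0. dist (zA \<epsilon>) 1 < 1" "\<forall>\<^sub>F \<epsilon> in at_right 0. dist (zB \<epsilon>) 1 < 1"
    by (auto dest: tendstoD[where e=1])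
  moreover have "\<forall>\<^sub>F \<epsilon> in at_right 0. 1 / 2 < S (\<epsilon> * cosh (W \<epsilon>)) / \<epsilon>"
    using agree_scaled_cubic(2)[OF S_expansion S_0 lims(2)]
    by (rule order_tendstoD(1)) (use cosh_real_ge_1[of u] in linarith)
  ultimately have "\<forall>\<^sub>F \<epsilon> in at_right 0. norm (hA \<epsilon> - hB \<epsilon>) \<le> 8 * norm ((zA \<epsilon> - zB \<epsilon>) / \<epsilon>)"
    using eventually_0_1
  proof eventually_elim
    case (elim \<epsilon>)
    have "\<epsilon> / 2 \<le> S (\<epsilon> * cosh (W \<epsilon>))" using elim by (simp add: field_simps)
    also have "\<dots> \<le> hA \<epsilon>" using abs_Im_le_cmod[of "spoke S C (\<epsilon> * sinh u) (\<epsilon> * cosh (W \<epsilon>))"]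
      by (simp add: hA_def) (simp add: spoke_def)
    finally have h: "\<epsilon> / 2 \<le> hA \<epsilon> + hB \<epsilon>" by (simp add: hB_def add_increasing2)
    have "\<kappa> * ((hA \<epsilon>)\<^sup>2 - (hB \<epsilon>)\<^sup>2) = (zB \<epsilon>)\<^sup>2 - (zA \<epsilon>)\<^sup>2"
      by (simp add: right_diff_distrib hA_def hB_def zA_def zB_def cmod_spoke_square)
    then have "\<bar>(hA \<epsilon>)\<^sup>2 - (hB \<epsilon>)\<^sup>2\<bar> = \<bar>(zA \<epsilon>)\<^sup>2 - (zB \<epsilon>)\<^sup>2\<bar>"
      using curvature by (auto simp: abs_if split: if_splits)
    then have prod: "\<bar>hA \<epsilon> - hB \<epsilon>\<bar> * \<bar>hA \<epsilon> + hB \<epsilon>\<bar> = \<bar>zA \<epsilon> - zB \<epsilon>\<bar> * \<bar>zA \<epsilon> + zB \<epsilon>\<bar>"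
      by (simp add: abs_mult[symmetric] power2_eq_square algebra_simps)
    have "\<bar>hA \<epsilon> - hB \<epsilon>\<bar> * (\<epsilon> / 2) \<le> \<bar>hA \<epsilon> - hB \<epsilon>\<bar> * \<bar>hA \<epsilon> + hB \<epsilon>\<bar>"
      using order_trans[OF h abs_ge_self] by (intro mult_left_mono) simp_all
    also have "\<dots> \<le> \<bar>zA \<epsilon> - zB \<epsilon>\<bar> * 4"
      unfolding prod using elim by (intro mult_left_mono) (auto simp: dist_real_def)
    finally show ?case using elim by (simp add: field_simps)
  qed
  then have "(\<lambda>\<epsilon>. hA \<epsilon> - hB \<epsilon>) \<in> O[at_right 0](\<lambda>\<epsilon>. (zA \<epsilon> - zB \<epsilon>) / \<epsilon>)" by (rule bigoI)
  moreover have "agree (Suc 4) (\<lambda>\<epsilon>. zA \<epsilon> - zB \<epsilon>) (\<lambda>\<epsilon>. \<epsilon> * 0)"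
    using center_height_agree[OF W] unfolding zA_def zB_def agree_def by simp
  from agree_divide_id[OF this] have "(\<lambda>\<epsilon>. (zA \<epsilon> - zB \<epsilon>) / \<epsilon>) \<in> O[at_right 0](\<lambda>\<epsilon>. \<epsilon> ^ 4)"
    by (simp add: agree_def)
  ultimately have "(\<lambda>\<epsilon>. hA \<epsilon> - hB \<epsilon>) \<in> O[at_right 0](\<lambda>\<epsilon>. \<epsilon> ^ 4)" by (rule landau_o.big_trans)
  then show ?thesis by (simp add: agree_def hA_def hB_def)
qed

text \<open>
  All errors are collected in one nonnegative function \<open>G\<close> of order \<open>\<epsilon>\<^sup>4\<close>, so that a single
  constant serves for all neighbors. The angle defect enters \<open>G\<close> with the distance of the first
  neighbor as a factor, which raises its order from three to four.
\<close>

lemma rings_close_up: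
  fixes w :: "real \<Rightarrow> nat \<Rightarrow> real"
  assumes w0: "\<And>\<epsilon>. w \<epsilon> 0 = u"
    and near: "\<And>k. k \<in> {1..4} \<Longrightarrow> agree 1 (\<lambda>\<epsilon>. w \<epsilon> k) (\<lambda>_. u)"
    and eqn: "agree 3 (\<lambda>\<epsilon>. (\<Sum>k=1..4. w \<epsilon> k - u) + \<kappa> * (\<epsilon>\<^sup>2 * sinh (2 * u))) (\<lambda>_. 0)"
  shows "\<exists>K. \<forall>\<^sub>F \<epsilon> in at_right 0. \<exists>\<zeta> \<theta>.
    flower_chart S C (K * \<epsilon> ^ 4) (\<lambda>k. \<epsilon> * sinh (w \<epsilon> k)) (\<lambda>k. \<epsilon> * cosh (w \<epsilon> k)) \<zeta> \<theta>"
proof -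
  define r R where "r \<epsilon> k = \<epsilon> * sinh (w \<epsilon> k)" and "R \<epsilon> k = \<epsilon> * cosh (w \<epsilon> k)" for \<epsilon> k
  define A B where "A \<epsilon> k = spoke S C (r \<epsilon> 0) (R \<epsilon> k)" and "B \<epsilon> k = spoke S C (R \<epsilon> 0) (r \<epsilon> k)" for \<epsilon> k
  define \<phi> where "\<phi> \<epsilon> k = pi / 2 - arctan (S (r \<epsilon> 0) / (S (R \<epsilon> k) / C (R \<epsilon> k)))" for \<epsilon> k
  define \<psi> where "\<psi> \<epsilon> k = arctan (S (r \<epsilon> k) / C (r \<epsilon> k) / S (R \<epsilon> 0))" for \<epsilon> k
  define \<eta> where "\<eta> \<epsilon> = (\<Sum>k=1..4. \<phi> \<epsilon> k + \<psi> \<epsilon> k) - 2 * pi" for \<epsilon>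
  define H Z where "H \<epsilon> k = cmod (A \<epsilon> k) - cmod (B \<epsilon> k)" and "Z \<epsilon> k = C (R \<epsilon> k) * C (r \<epsilon> 0) - C (r \<epsilon> k) * C (R \<epsilon> 0)" for \<epsilon> k
  define G where "G \<epsilon> = (\<Sum>k=1..4. \<bar>H \<epsilon> k\<bar> + \<bar>Z \<epsilon> k\<bar>)
     + cmod (A \<epsilon> 1) * \<bar>\<eta> \<epsilon>\<bar>" for \<epsilon>
  have lim: "((\<lambda>\<epsilon>. w \<epsilon> k) \<longlongrightarrow> u) (at_right 0)" if "k \<in> {0..4}" for k
  proof (cases "k = 0")
    case False
    with that have "k \<in> {1..4}" by auto
    from agree_tendsto[OF near[OF this]] show ?thesis by simp
  qed (simp add: w0)
  note lims = tendsto_sinh[OF lim] tendsto_cosh[OF lim]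

  have S_lim: "((\<lambda>\<epsilon>. S (R \<epsilon> k) / \<epsilon>) \<longlongrightarrow> cosh u) (at_right 0)" "((\<lambda>\<epsilon>. S (r \<epsilon> k) / \<epsilon>) \<longlongrightarrow> sinh u) (at_right 0)"
    if "k \<in> {0..4}" for k
    unfolding r_def R_def by (rule agree_scaled_cubic(2)[OF S_expansion S_0] lims that)+
  have C_lim: "((\<lambda>\<epsilon>. C (R \<epsilon> k)) \<longlongrightarrow> 1) (at_right 0)" "((\<lambda>\<epsilon>. C (r \<epsilon> k)) \<longlongrightarrow> 1) (at_right 0)"
    if "k \<in> {0..4}" for k
    unfolding r_def R_def by (rule C_tendsto_1 lims that)+

  have h: "(\<lambda>\<epsilon>. H \<epsilon> k) \<in> O[at_right 0](\<lambda>\<epsilon>. \<epsilon> ^ 4)" if "k \<in> {1..4}" for k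
    using center_distance_agree[OF near[OF that]] by (simp add: H_def A_def B_def r_def R_def w0 agree_def)
  have z: "(\<lambda>\<epsilon>. Z \<epsilon> k) \<in> O[at_right 0](\<lambda>\<epsilon>. \<epsilon> ^ 4)" if "k \<in> {1..4}" for k
    using agree_mono[OF center_height_agree[OF near[OF that]], of 4] by (simp add: Z_def r_def R_def w0 agree_def)

  have "agree 3 (\<lambda>\<epsilon>. \<Sum>k=1..4. arctan (S (r \<epsilon> k) / C (r \<epsilon> k) / S (R \<epsilon> 0)) - arctan (S (r \<epsilon> 0) / (S (R \<epsilon> k) / C (R \<epsilon> k))))
      (\<lambda>\<epsilon>. \<Sum>k=1..4. (w \<epsilon> k - u) + \<epsilon>\<^sup>2 * (\<kappa> * sinh (2 * u) / 4))"
    unfolding r_def R_def w0 by (intro agree_sum ring_angle_agree near)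
  also have "(\<lambda>\<epsilon>. \<Sum>k=1..4. (w \<epsilon> k - u) + \<epsilon>\<^sup>2 * (\<kappa> * sinh (2 * u) / 4))
      = (\<lambda>\<epsilon>. (\<Sum>k=1..4. w \<epsilon> k - u) + \<kappa> * (\<epsilon>\<^sup>2 * sinh (2 * u)))"
    by (simp add: sum.distrib mult.left_commute)
  also note eqn
  also have "(\<lambda>\<epsilon>. \<Sum>k=1..4. arctan (S (r \<epsilon> k) / C (r \<epsilon> k) / S (R \<epsilon> 0)) - arctan (S (r \<epsilon> 0) / (S (R \<epsilon> k) / C (R \<epsilon> k)))) = \<eta>"
    by (simp add: \<eta>_def \<phi>_def \<psi>_def sum.distrib sum_subtractf fun_eq_iff)
  finally have \<eta>: "\<eta> \<in> O[at_right 0](\<lambda>\<epsilon>. \<epsilon> ^ 3)" by (simp add: agree_def)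

  have A_scaled: "((\<lambda>\<epsilon>. cmod (Complex (C (R \<epsilon> 1) * (S (r \<epsilon> 0) / \<epsilon>)) (S (R \<epsilon> 1) / \<epsilon>))) \<longlongrightarrow> cmod (Complex (1 * sinh u) (cosh u))) (at_right 0)"
    by (intro tendsto_norm tendsto_Complex tendsto_mult S_lim C_lim) auto
  have "\<forall>\<^sub>F \<epsilon> in at_right 0. \<epsilon> ^ 1 * cmod (Complex (C (R \<epsilon> 1) * (S (r \<epsilon> 0) / \<epsilon>)) (S (R \<epsilon> 1) / \<epsilon>)) = cmod (A \<epsilon> 1)"
    using eventually_0_1
  proof eventually_elim
    case (elim \<epsilon>)
    have "A \<epsilon> 1 = of_real \<epsilon> * Complex (C (R \<epsilon> 1) * (S (r \<epsilon> 0) / \<epsilon>)) (S (R \<epsilon> 1) / \<epsilon>)"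
      using elim by (simp add: A_def spoke_def complex_eq_iff)
    then show ?case using elim by (simp add: norm_mult)
  qed
  from landau_o.big.in_cong[OF this] bigo_id_mult[OF A_scaled, of 1]
  have A1: "(\<lambda>\<epsilon>. cmod (A \<epsilon> 1)) \<in> O[at_right 0](\<lambda>\<epsilon>. \<epsilon> ^ 1)" by blast
  have "(\<lambda>\<epsilon>. cmod (A \<epsilon> 1) * \<bar>\<eta> \<epsilon>\<bar>) \<in> O[at_right 0](\<lambda>\<epsilon>. \<epsilon> ^ 1 * \<epsilon> ^ 3)"
    using A1 \<eta> by (intro landau_o.big.mult) simp_all
  then have "G \<in> O[at_right 0](\<lambda>\<epsilon>. \<epsilon> ^ 4)"
    unfolding G_def using h z
    by (intro sum_in_bigo(1) big_sum_in_bigo) (simp_all add: power_Suc2[symmetric] eval_nat_numeral)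
  then obtain K where K: "\<forall>\<^sub>F \<epsilon> in at_right 0. norm (G \<epsilon>) \<le> K * norm (\<epsilon> ^ 4)"
    by (elim landau_o.bigE)

  have SR_pos: "\<forall>\<^sub>F \<epsilon> in at_right 0. 0 < S (R \<epsilon> k) / \<epsilon>" if "k \<in> {0..4}" for k
    by (rule order_tendstoD(1)[OF S_lim(1)[OF that]]) simp
  have CR_pos: "\<forall>\<^sub>F \<epsilon> in at_right 0. 0 < C (R \<epsilon> k)" and Cr_pos: "\<forall>\<^sub>F \<epsilon> in at_right 0. 0 < C (r \<epsilon> k)" if "k \<in> {0..4}" for k
    by (rule order_tendstoD(1)[OF C_lim(1)[OF that]], simp) (rule order_tendstoD(1)[OF C_lim(2)[OF that]], simp)
  have "\<forall>\<^sub>F \<epsilon> in at_right 0. \<forall>k\<in>{0..4}. 0 < S (R \<epsilon> k) / \<epsilon> \<and> 0 < C (R \<epsilon> k) \<and> 0 < C (r \<epsilon> k)"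
    by (intro eventually_ball_finite ballI eventually_conj SR_pos CR_pos Cr_pos) auto
  then have "\<forall>\<^sub>F \<epsilon> in at_right 0. \<exists>\<zeta> \<theta>. flower_chart S C (2 * K * \<epsilon> ^ 4) (r \<epsilon>) (R \<epsilon>) \<zeta> \<theta>"
    using K eventually_0_1
  proof eventually_elim
    case (elim \<epsilon>)
    have pos: "0 < S (R \<epsilon> k)" "0 < C (R \<epsilon> k)" "0 < C (r \<epsilon> k)" if "k \<in> {0..4}" for k
      using elim(1,3) that by (auto simp: zero_less_divide_iff)
    have G: "G \<epsilon> \<le> K * \<epsilon> ^ 4" using elim by simp
    have summand: "\<bar>H \<epsilon> k\<bar> + \<bar>Z \<epsilon> k\<bar> \<le> G \<epsilon>" if "k \<in> {1..4}" for k
      unfolding G_def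
      by (rule order_trans[OF member_le_sum[OF that, where f="\<lambda>k. \<bar>H \<epsilon> k\<bar> + \<bar>Z \<epsilon> k\<bar>"]])
         auto
    have closing: "cmod (A \<epsilon> 1) * \<bar>\<eta> \<epsilon>\<bar> \<le> G \<epsilon>"
      unfolding G_def by (simp add: sum_nonneg)
    have A_cis: "A \<epsilon> k = of_real (cmod (A \<epsilon> k)) * cis (\<phi> \<epsilon> k)" if "k \<in> {1..4}" for k
      using Complex_eq_cis_arccot[of "S (R \<epsilon> k)" "C (R \<epsilon> k) * S (r \<epsilon> 0)"] pos[of k] that
      by (simp add: A_def spoke_def \<phi>_def mult.commute)
    have B_cis: "B \<epsilon> k = of_real (cmod (B \<epsilon> k)) * cis (\<psi> \<epsilon> k)" if "k \<in> {1..4}" for k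
      using Complex_eq_cis_arctan[of "C (r \<epsilon> k) * S (R \<epsilon> 0)" "S (r \<epsilon> k)"] pos[of k] pos[of 0] that
      by (simp add: B_def spoke_def \<psi>_def)
    have AB: "\<bar>cmod (A \<epsilon> k) - cmod (B \<epsilon> k)\<bar> \<le> G \<epsilon>"
      and zz: "\<bar>Z \<epsilon> k\<bar> \<le> G \<epsilon>" if "k \<in> {1..4}" for k
      using summand[OF that] unfolding H_def[symmetric] by linarith+
    have le: "2 * G \<epsilon> \<le> 2 * K * \<epsilon> ^ 4" and nn: "0 \<le> G \<epsilon>" using G AB[of 1] by auto
    obtain \<zeta> and \<theta> :: "nat \<Rightarrow> real" where \<zeta>: "\<And>k. k \<in> {1..4} \<Longrightarrow> cmod (\<zeta> k) = cmod (A \<epsilon> k)"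
      and bounds: "cmod (\<zeta> 1 - cis (\<theta> 1) * cnj (A \<epsilon> 1)) \<le> 2 * G \<epsilon>" "cmod (\<zeta> 2 - cis (\<theta> 1) * A \<epsilon> 2) \<le> 2 * G \<epsilon>"
        "cmod (\<zeta> 2 - cis (\<theta> 2) * cnj (B \<epsilon> 2)) \<le> 2 * G \<epsilon>" "cmod (\<zeta> 3 - cis (\<theta> 2) * B \<epsilon> 3) \<le> 2 * G \<epsilon>"
        "cmod (\<zeta> 3 - cis (\<theta> 3) * cnj (A \<epsilon> 3)) \<le> 2 * G \<epsilon>" "cmod (\<zeta> 4 - cis (\<theta> 3) * A \<epsilon> 4) \<le> 2 * G \<epsilon>"
        "cmod (\<zeta> 4 - cis (\<theta> 4) * cnj (B \<epsilon> 4)) \<le> 2 * G \<epsilon>" "cmod (\<zeta> 1 - cis (\<theta> 4) * B \<epsilon> 1) \<le> 2 * G \<epsilon>"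
      using chain_of_rings[of "A \<epsilon>" "\<phi> \<epsilon>" "B \<epsilon>" "\<psi> \<epsilon>" "G \<epsilon>", OF A_cis B_cis AB closing[unfolded \<eta>_def]] by blast
    have "flower_chart S C (2 * K * \<epsilon> ^ 4) (r \<epsilon>) (R \<epsilon>) \<zeta> \<theta>"
      unfolding flower_chart_def touch_chart_def A_def[symmetric] B_def[symmetric] Z_def[symmetric]
    proof (intro conjI ballI)
      fix k :: nat assume k: "k \<in> {1..4}"
      show "\<bar>Z \<epsilon> k\<bar> \<le> 2 * K * \<epsilon> ^ 4"
        using zz[OF k] le nn by linarith
    qed (use \<zeta> in blast, (rule order_trans[OF _ le], rule bounds)+)
    then show ?case by blast
  qed
  then show ?thesis unfolding r_def R_def by blast
qed
end

section \<open>Infinitesimal ring flowers\<close>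

interpretation sphere: space_form 1 sin cos
proof
  show "(\<lambda>x::real. sin x - (x + (- 1 / 6) * x ^ 3)) \<in> O[at 0](\<lambda>x. x ^ 5)" by real_asymp
  show "(\<lambda>x::real. sin x / cos x - (x + 1 / 3 * x ^ 3)) \<in> O[at 0](\<lambda>x. x ^ 5)" by real_asymp
  show "(\<lambda>x::real. cos x - (1 - 1 / 2 * x\<^sup>2 + x ^ 4 / 24)) \<in> O[at 0](\<lambda>x. x ^ 6)" by real_asymp
qed auto

interpretation hyperbolic_plane: space_form "-1" sinh cosh
proof
  show "(\<lambda>x::real. sinh x - (x + (- (-1) / 6) * x ^ 3)) \<in> O[at 0](\<lambda>x. x ^ 5)" by real_asymp
  show "(\<lambda>x::real. sinh x / cosh x - (x + (-1) / 3 * x ^ 3)) \<in> O[at 0](\<lambda>x. x ^ 5)" by real_asymp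
  show "(\<lambda>x::real. cosh x - (1 - (-1) / 2 * x\<^sup>2 + x ^ 4 / 24)) \<in> O[at 0](\<lambda>x. x ^ 6)" by real_asymp
qed (auto simp: cosh_square_eq)

lemma flower_chart_nonneg:
  "flower_chart S C \<tau> r R \<zeta> \<theta> \<Longrightarrow> 0 \<le> \<tau>"
  unfolding flower_chart_def touch_chart_def by (meson norm_ge_zero order_trans)

lemma flower_chart_imp_spherical:
  assumes chart: "flower_chart sin cos \<tau> r R \<zeta> \<theta>"
  shows "spherical_ring_flower_upto (4 * \<tau>) r R"
proof -
  have \<zeta>: "\<And>k. k \<in> {1..4} \<Longrightarrow> cmod (\<zeta> k) = cmod (spoke sin cos (r 0) (R k))"
    and z: "\<And>k. k \<in> {1..4} \<Longrightarrow> \<bar>cos (R k) * cos (r 0) - cos (r k) * cos (R 0)\<bar> \<le> \<tau>"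
    and b: "touch_chart sin cos \<tau> (r 0) (\<zeta> 1) (R 1) (\<zeta> 2) (R 2) (\<theta> 1)"
      "touch_chart sin cos \<tau> (R 0) (\<zeta> 2) (r 2) (\<zeta> 3) (r 3) (\<theta> 2)"
      "touch_chart sin cos \<tau> (r 0) (\<zeta> 3) (R 3) (\<zeta> 4) (R 4) (\<theta> 3)"
      "touch_chart sin cos \<tau> (R 0) (\<zeta> 4) (r 4) (\<zeta> 1) (r 1) (\<theta> 4)"
    using chart unfolding flower_chart_def by blast+
  define zz where "zz k = cos (R k) * cos (r 0)" for k
  define c where "c k = (if k = 0 then pt 0 1 else pt (\<zeta> k) (zz k))" for k :: nat
  have on: "(cmod (\<zeta> k))\<^sup>2 + (zz k)\<^sup>2 = 1" if "k \<in> {1..4}" for k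
    using sphere.cmod_spoke_square[of "r 0" "R k"] \<zeta>[OF that] by (simp add: zz_def)
  have same: "\<bar>zz k - cos (R k) * cos (r 0)\<bar> \<le> \<tau>" for k
    using flower_chart_nonneg[OF chart] by (simp add: zz_def)
  have other: "\<bar>zz k - cos (r k) * cos (R 0)\<bar> \<le> \<tau>" if "k \<in> {1..4}" for k
    using z[OF that] by (simp add: zz_def)
  note b' = b[unfolded touch_chart_def spoke_def complex_cnj]
  have "norm (c k) = 1" if "k \<le> 4" for k
    using on[of k] that by (auto simp: c_def norm_pt)
  moreover have "sph_touch (4 * \<tau>) (c 0) (r 0) (c 1) (R 1) (c 2) (R 2)"
    unfolding c_def using sph_touch_pt[OF on[of 1] on[of 2] b'(1)[THEN conjunct1] same b'(1)[THEN conjunct2] same] by simp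
  moreover have "sph_touch (4 * \<tau>) (c 0) (R 0) (c 2) (r 2) (c 3) (r 3)"
    unfolding c_def using sph_touch_pt[OF on[of 2] on[of 3] b'(2)[THEN conjunct1] other[of 2] b'(2)[THEN conjunct2] other[of 3]] by simp
  moreover have "sph_touch (4 * \<tau>) (c 0) (r 0) (c 3) (R 3) (c 4) (R 4)"
    unfolding c_def using sph_touch_pt[OF on[of 3] on[of 4] b'(3)[THEN conjunct1] same b'(3)[THEN conjunct2] same] by simp
  moreover have "sph_touch (4 * \<tau>) (c 0) (R 0) (c 4) (r 4) (c 1) (r 1)"
    unfolding c_def using sph_touch_pt[OF on[of 4] on[of 1] b'(4)[THEN conjunct1] other[of 4] b'(4)[THEN conjunct2] other[of 1]] by simp
  ultimately show ?thesis unfolding spherical_ring_flower_upto_def by blast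
qed

lemma flower_chart_imp_hyperbolic:
  assumes chart: "flower_chart sinh cosh \<tau> r R \<zeta> \<theta>"
  shows "hyperbolic_ring_flower_upto \<tau> r R"
proof -
  have \<zeta>: "\<And>k. k \<in> {1..4} \<Longrightarrow> cmod (\<zeta> k) = cmod (spoke sinh cosh (r 0) (R k))"
    and b: "touch_chart sinh cosh \<tau> (r 0) (\<zeta> 1) (R 1) (\<zeta> 2) (R 2) (\<theta> 1)"
      "touch_chart sinh cosh \<tau> (R 0) (\<zeta> 2) (r 2) (\<zeta> 3) (r 3) (\<theta> 2)"
      "touch_chart sinh cosh \<tau> (r 0) (\<zeta> 3) (R 3) (\<zeta> 4) (R 4) (\<theta> 3)"
      "touch_chart sinh cosh \<tau> (R 0) (\<zeta> 4) (r 4) (\<zeta> 1) (r 1) (\<theta> 4)"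
    using chart unfolding flower_chart_def by blast+
  define zz where "zz k = cosh (R k) * cosh (r 0)" for k
  define c where "c k = (if k = 0 then pt 0 1 else pt (\<zeta> k) (zz k))" for k :: nat
  have on: "pt (\<zeta> k) (zz k) \<in> hyp_plane" if "k \<in> {1..4}" for k
    using hyperbolic_plane.cmod_spoke_square[of "r 0" "R k"] \<zeta>[OF that] by (simp add: zz_def pt_in_hyp_plane)
  note b' = b[unfolded touch_chart_def spoke_def complex_cnj]
  have "c k \<in> hyp_plane" if "k \<le> 4" for k
    using on[of k] that by (auto simp: c_def pt_in_hyp_plane)
  moreover have "hyp_touch \<tau> (c 0) (r 0) (c 1) (R 1) (c 2) (R 2)"
    unfolding c_def using hyp_touch_pt[OF on[of 1] on[of 2] b'(1)[THEN conjunct1] b'(1)[THEN conjunct2]] by simp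
  moreover have "hyp_touch \<tau> (c 0) (R 0) (c 2) (r 2) (c 3) (r 3)"
    unfolding c_def using hyp_touch_pt[OF on[of 2] on[of 3] b'(2)[THEN conjunct1] b'(2)[THEN conjunct2]] by simp
  moreover have "hyp_touch \<tau> (c 0) (r 0) (c 3) (R 3) (c 4) (R 4)"
    unfolding c_def using hyp_touch_pt[OF on[of 3] on[of 4] b'(3)[THEN conjunct1] b'(3)[THEN conjunct2]] by simp
  moreover have "hyp_touch \<tau> (c 0) (R 0) (c 4) (r 4) (c 1) (r 1)"
    unfolding c_def using hyp_touch_pt[OF on[of 4] on[of 1] b'(4)[THEN conjunct1] b'(4)[THEN conjunct2]] by simp
  ultimately show ?thesis unfolding hyperbolic_ring_flower_upto_def by blast
qed

section \<open>Radii of the rings\<close>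

lemma arcsin_expansion: "(\<lambda>x::real. arcsin x - x) \<in> O[at 0](\<lambda>x. x ^ 3)"
proof -
  have "\<forall>\<^sub>F x::real in at 0. x \<in> {-1<..<1}" by (intro eventually_at_in_open') auto
  then have "\<forall>\<^sub>F x::real in at 0. arcsin x - x = arctan (x / sqrt (1 - x\<^sup>2)) - x"
    by eventually_elim (simp add: arcsin_arctan)
  from landau_o.big.in_cong[OF this] show ?thesis by simp real_asymp
qed

lemma tanh_artanh:
  fixes x :: real
  assumes "\<bar>x\<bar> < 1" shows "tanh (artanh x) = x"
proof -
  have x: "0 < 1 + x" "0 < 1 - x" using assms by auto
  have e: "exp (- 2 * artanh x) = (1 - x) / (1 + x)"
    using x by (simp add: artanh_def exp_minus)
  have "1 - (1 - x) / (1 + x) = 2 * x / (1 + x)" "1 + (1 - x) / (1 + x) = 2 / (1 + x)"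
    using x by (simp_all add: field_simps)
  then show ?thesis unfolding tanh_real_altdef e using x by simp
qed

lemma agree_scale_id: "agree 2 f g \<Longrightarrow> agree 3 (\<lambda>\<epsilon>. \<epsilon> * f \<epsilon>) (\<lambda>\<epsilon>. \<epsilon> * g \<epsilon>)"
  using agree_scale[of 2 f g "\<lambda>\<epsilon>. \<epsilon>" 1] by (simp add: numeral_3_eq_3)

text \<open>
  By \<open>jacobi_quarter_minus\<close> these quotients are \<open>\<epsilon>\<close> times quotients of elliptic functions at \<open>W\<close>, which
  tend to \<open>sinh\<close> and \<open>cosh\<close> with an error \<open>O(\<epsilon>\<^sup>2)\<close>.
\<close>

lemma quarter_minus_limit_agree:
  assumes W: "(W \<longlongrightarrow> u) (at_right 0)"
  defines "q \<equiv> compl_modulus"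
  shows "agree 3 (\<lambda>\<epsilon>. cn (ellipticK (q \<epsilon>) - W \<epsilon>) (q \<epsilon>)) (\<lambda>\<epsilon>. \<epsilon> * sinh (W \<epsilon>))"
    and "agree 3 (\<lambda>\<epsilon>. dn (ellipticK (q \<epsilon>) - W \<epsilon>) (q \<epsilon>)) (\<lambda>\<epsilon>. \<epsilon> * cosh (W \<epsilon>))"
    and "agree 3 (\<lambda>\<epsilon>. cn (ellipticK (q \<epsilon>) - W \<epsilon>) (q \<epsilon>) / sn (ellipticK (q \<epsilon>) - W \<epsilon>) (q \<epsilon>)) (\<lambda>\<epsilon>. \<epsilon> * sinh (W \<epsilon>))"
    and "\<forall>\<^sub>F \<epsilon> in at_right 0. 0 < sn (ellipticK (q \<epsilon>) - W \<epsilon>) (q \<epsilon>)"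
proof -
  note sn = sn_agree[OF W, folded q_def] and cn = cn_agree[OF W, folded q_def] and dn = dn_agree[OF W, folded q_def]
  have T: "((\<lambda>\<epsilon>. tanh (W \<epsilon>)) \<longlongrightarrow> tanh u) (at_right 0)" and C: "((\<lambda>\<epsilon>. 1 / cosh (W \<epsilon>)) \<longlongrightarrow> 1 / cosh u) (at_right 0)"
    by (intro tendsto_intros W; simp)+
  note sn_lim = agree_tendsto[OF sn _ T, simplified] and cn_lim = agree_tendsto[OF cn _ C, simplified]
    and dn_lim = agree_tendsto[OF dn _ C, simplified]
  have inv: "1 / cosh u \<noteq> 0" by simp
  have sd: "agree 2 (\<lambda>\<epsilon>. sn (W \<epsilon>) (q \<epsilon>) / dn (W \<epsilon>) (q \<epsilon>)) (\<lambda>\<epsilon>. sinh (W \<epsilon>))"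
    using agree_divide[OF sn dn sn_lim dn_lim C inv] by (simp add: tanh_def)
  have id: "agree 2 (\<lambda>\<epsilon>. 1 / dn (W \<epsilon>) (q \<epsilon>)) (\<lambda>\<epsilon>. cosh (W \<epsilon>))"
    using agree_divide[OF agree_refl dn tendsto_const dn_lim C inv, of 1] by simp
  have sc: "agree 2 (\<lambda>\<epsilon>. sn (W \<epsilon>) (q \<epsilon>) / cn (W \<epsilon>) (q \<epsilon>)) (\<lambda>\<epsilon>. sinh (W \<epsilon>))"
    using agree_divide[OF sn cn sn_lim cn_lim C inv] by (simp add: tanh_def)
  have quarter: "\<forall>\<^sub>F \<epsilon> in at_right 0. 0 < cn (W \<epsilon>) (q \<epsilon>) \<and> 0 < dn (W \<epsilon>) (q \<epsilon>)
      \<and> sn (ellipticK (q \<epsilon>) - W \<epsilon>) (q \<epsilon>) = cn (W \<epsilon>) (q \<epsilon>) / dn (W \<epsilon>) (q \<epsilon>)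
      \<and> cn (ellipticK (q \<epsilon>) - W \<epsilon>) (q \<epsilon>) = \<epsilon> * sn (W \<epsilon>) (q \<epsilon>) / dn (W \<epsilon>) (q \<epsilon>)
      \<and> dn (ellipticK (q \<epsilon>) - W \<epsilon>) (q \<epsilon>) = \<epsilon> / dn (W \<epsilon>) (q \<epsilon>)"
    using eventually_0_1 eventually_abs_am_less[OF W, folded q_def]
  proof eventually_elim
    case (elim \<epsilon>)
    have q: "0 < q \<epsilon>" "q \<epsilon> < 1" "compl_modulus (q \<epsilon>) = \<epsilon>"
      using elim compl_modulus_bounds[of \<epsilon>] compl_modulus_compl_modulus[of \<epsilon>] by (auto simp: q_def)
    show ?case
      using jacobi_quarter_minus[OF q(1,2) elim(2)] cn_pos[OF elim(2)] dn_pos[of "q \<epsilon>" "W \<epsilon>"] q by simp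
  qed
  show "agree 3 (\<lambda>\<epsilon>. cn (ellipticK (q \<epsilon>) - W \<epsilon>) (q \<epsilon>)) (\<lambda>\<epsilon>. \<epsilon> * sinh (W \<epsilon>))"
    by (rule agree_cong[OF agree_scale_id[OF sd]])
      (use quarter in \<open>auto elim!: eventually_mono\<close>)
  show "agree 3 (\<lambda>\<epsilon>. dn (ellipticK (q \<epsilon>) - W \<epsilon>) (q \<epsilon>)) (\<lambda>\<epsilon>. \<epsilon> * cosh (W \<epsilon>))"
    by (rule agree_cong[OF agree_scale_id[OF id]])
      (use quarter in \<open>auto elim!: eventually_mono\<close>)
  show "agree 3 (\<lambda>\<epsilon>. cn (ellipticK (q \<epsilon>) - W \<epsilon>) (q \<epsilon>) / sn (ellipticK (q \<epsilon>) - W \<epsilon>) (q \<epsilon>)) (\<lambda>\<epsilon>. \<epsilon> * sinh (W \<epsilon>))"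
    by (rule agree_cong[OF agree_scale_id[OF sc]])
      (use quarter in \<open>auto elim!: eventually_mono\<close>)
  show "\<forall>\<^sub>F \<epsilon> in at_right 0. 0 < sn (ellipticK (q \<epsilon>) - W \<epsilon>) (q \<epsilon>)"
    using quarter by eventually_elim simp
qed

lemma agree_near_identity:
  assumes f: "agree 3 f (\<lambda>\<epsilon>. \<epsilon> * X \<epsilon>)" and X: "(X \<longlongrightarrow> L) (at_right 0)"
    and F: "(\<lambda>x. F x - x) \<in> O[at 0](\<lambda>x. x ^ 3)" "F 0 = 0"
  shows "agree 3 (\<lambda>\<epsilon>. F (f \<epsilon>)) (\<lambda>\<epsilon>. \<epsilon> * X \<epsilon>)"
proof -
  have "f \<in> O[at_right 0](\<lambda>\<epsilon>. \<epsilon>)"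
    using agree_imp_bigo[OF agree_mono[OF f, of 1]] bigo_id_mult[OF X, of 1] by simp
  from agree_trans[OF agree_compose_at_0[OF F(1) _ this] f] F(2) show ?thesis by simp
qed

text \<open>
  The arcsine inverts \<open>sin r = cn \<beta>\<close> and \<open>sin R = dn \<beta>\<close>. The cosines then have the right sign because
  \<open>sn \<beta>\<close> is positive.
\<close>

lemma spherical_ring_param_exists:
  assumes W: "\<And>k. k \<le> 4 \<Longrightarrow> ((\<lambda>\<epsilon>. W \<epsilon> k) \<longlongrightarrow> u) (at_right 0)"
  shows "\<exists>r R :: real \<Rightarrow> nat \<Rightarrow> real. \<forall>k\<le>4.
      (\<forall>\<^sub>F \<epsilon> in at_right 0. spherical_ring_param (compl_modulus \<epsilon>) (ellipticK (compl_modulus \<epsilon>) - W \<epsilon> k) (r \<epsilon> k) (R \<epsilon> k)) \<and>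
      (\<lambda>\<epsilon>. r \<epsilon> k - \<epsilon> * sinh (W \<epsilon> k)) \<in> O[at_right 0](\<lambda>\<epsilon>. \<epsilon> ^ 3) \<and>
      (\<lambda>\<epsilon>. R \<epsilon> k - \<epsilon> * cosh (W \<epsilon> k)) \<in> O[at_right 0](\<lambda>\<epsilon>. \<epsilon> ^ 3)"
proof -
  define q where "q = compl_modulus"
  define \<beta> where "\<beta> \<epsilon> k = ellipticK (q \<epsilon>) - W \<epsilon> k" for \<epsilon> k
  have "(\<forall>\<^sub>F \<epsilon> in at_right 0. spherical_ring_param (q \<epsilon>) (\<beta> \<epsilon> k) (arcsin (cn (\<beta> \<epsilon> k) (q \<epsilon>))) (arcsin (dn (\<beta> \<epsilon> k) (q \<epsilon>)))) \<and>
      agree 3 (\<lambda>\<epsilon>. arcsin (cn (\<beta> \<epsilon> k) (q \<epsilon>))) (\<lambda>\<epsilon>. \<epsilon> * sinh (W \<epsilon> k)) \<and>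
      agree 3 (\<lambda>\<epsilon>. arcsin (dn (\<beta> \<epsilon> k) (q \<epsilon>))) (\<lambda>\<epsilon>. \<epsilon> * cosh (W \<epsilon> k))" if k: "k \<le> 4" for k
  proof (intro conjI)
    note lim = quarter_minus_limit_agree[OF W[OF k], folded q_def, folded \<beta>_def]
    show "agree 3 (\<lambda>\<epsilon>. arcsin (cn (\<beta> \<epsilon> k) (q \<epsilon>))) (\<lambda>\<epsilon>. \<epsilon> * sinh (W \<epsilon> k))"
      by (rule agree_near_identity[OF lim(1) tendsto_sinh[OF W[OF k]] arcsin_expansion]) simp
    show "agree 3 (\<lambda>\<epsilon>. arcsin (dn (\<beta> \<epsilon> k) (q \<epsilon>))) (\<lambda>\<epsilon>. \<epsilon> * cosh (W \<epsilon> k))"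
      by (rule agree_near_identity[OF lim(2) tendsto_cosh[OF W[OF k]] arcsin_expansion]) simp
    show "\<forall>\<^sub>F \<epsilon> in at_right 0. spherical_ring_param (q \<epsilon>) (\<beta> \<epsilon> k) (arcsin (cn (\<beta> \<epsilon> k) (q \<epsilon>))) (arcsin (dn (\<beta> \<epsilon> k) (q \<epsilon>)))"
      using lim(4) eventually_0_1
    proof eventually_elim
      case (elim \<epsilon>)
      define s c d where "s = sn (\<beta> \<epsilon> k) (q \<epsilon>)" and "c = cn (\<beta> \<epsilon> k) (q \<epsilon>)" and "d = dn (\<beta> \<epsilon> k) (q \<epsilon>)"
      have q: "0 < q \<epsilon>" "q \<epsilon> < 1" using elim compl_modulus_bounds[of \<epsilon>] by (auto simp: q_def)
      have cd: "c\<^sup>2 = 1 - s\<^sup>2" "d\<^sup>2 = 1 - (q \<epsilon> * s)\<^sup>2" "0 < s"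
        using cn_square dn_square q elim by (auto simp: s_def c_def d_def power_mult_distrib)
      have "c\<^sup>2 \<le> 1" "d\<^sup>2 \<le> 1" by (simp_all add: cd)
      then have bd: "-1 \<le> c" "c \<le> 1" "-1 \<le> d" "d \<le> 1" by (auto simp: abs_square_le_1 abs_le_iff)
      have "cos (arcsin c) = s" "cos (arcsin d) = q \<epsilon> * s"
        using bd cd(3) q by (simp_all add: cos_arcsin cd(1,2))
      then show ?case
        unfolding spherical_ring_param_def s_def[symmetric] c_def[symmetric] d_def[symmetric] using bd by simp
    qed
  qed
  then show ?thesis
    unfolding agree_def
    by (intro exI[of _ "\<lambda>\<epsilon> k. arcsin (cn (\<beta> \<epsilon> k) (q \<epsilon>))"] exI[of _ "\<lambda>\<epsilon> k. arcsin (dn (\<beta> \<epsilon> k) (q \<epsilon>))"])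
      (simp add: \<beta>_def q_def)
qed

lemma hyperbolic_ring_param_exists:
  assumes W: "\<And>k. k \<le> 4 \<Longrightarrow> ((\<lambda>\<epsilon>. W \<epsilon> k) \<longlongrightarrow> u) (at_right 0)"
  shows "\<exists>r R :: real \<Rightarrow> nat \<Rightarrow> real. \<forall>k\<le>4.
      (\<forall>\<^sub>F \<epsilon> in at_right 0. hyperbolic_ring_param (compl_modulus \<epsilon>) (ellipticK (compl_modulus \<epsilon>) - W \<epsilon> k) (r \<epsilon> k) (R \<epsilon> k)) \<and>
      (\<lambda>\<epsilon>. r \<epsilon> k - \<epsilon> * sinh (W \<epsilon> k)) \<in> O[at_right 0](\<lambda>\<epsilon>. \<epsilon> ^ 3) \<and>
      (\<lambda>\<epsilon>. R \<epsilon> k - \<epsilon> * cosh (W \<epsilon> k)) \<in> O[at_right 0](\<lambda>\<epsilon>. \<epsilon> ^ 3)"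
proof -
  define q where "q = compl_modulus"
  define \<beta> where "\<beta> \<epsilon> k = ellipticK (q \<epsilon>) - W \<epsilon> k" for \<epsilon> k
  define r where "r \<epsilon> k = arsinh (cn (\<beta> \<epsilon> k) (q \<epsilon>) / sn (\<beta> \<epsilon> k) (q \<epsilon>))" for \<epsilon> k
  define R where "R \<epsilon> k = artanh (dn (\<beta> \<epsilon> k) (q \<epsilon>))" for \<epsilon> k
  have "(\<forall>\<^sub>F \<epsilon> in at_right 0. hyperbolic_ring_param (q \<epsilon>) (\<beta> \<epsilon> k) (r \<epsilon> k) (R \<epsilon> k)) \<and>
      agree 3 (\<lambda>\<epsilon>. r \<epsilon> k) (\<lambda>\<epsilon>. \<epsilon> * sinh (W \<epsilon> k)) \<and> agree 3 (\<lambda>\<epsilon>. R \<epsilon> k) (\<lambda>\<epsilon>. \<epsilon> * cosh (W \<epsilon> k))" if k: "k \<le> 4" for k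
  proof (intro conjI)
    note lim = quarter_minus_limit_agree[OF W[OF k], folded q_def, folded \<beta>_def]
    have arsinh: "(\<lambda>x::real. arsinh x - x) \<in> O[at 0](\<lambda>x. x ^ 3)" by real_asymp
    show "agree 3 (\<lambda>\<epsilon>. r \<epsilon> k) (\<lambda>\<epsilon>. \<epsilon> * sinh (W \<epsilon> k))"
      unfolding r_def by (rule agree_near_identity[OF lim(3) tendsto_sinh[OF W[OF k]] arsinh]) simp
    have artanh: "(\<lambda>x::real. artanh x - x) \<in> O[at 0](\<lambda>x. x ^ 3)" by real_asymp
    show "agree 3 (\<lambda>\<epsilon>. R \<epsilon> k) (\<lambda>\<epsilon>. \<epsilon> * cosh (W \<epsilon> k))"
      unfolding R_def by (rule agree_near_identity[OF lim(2) tendsto_cosh[OF W[OF k]] artanh]) simp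
    show "\<forall>\<^sub>F \<epsilon> in at_right 0. hyperbolic_ring_param (q \<epsilon>) (\<beta> \<epsilon> k) (r \<epsilon> k) (R \<epsilon> k)"
      using lim(4) eventually_0_1
    proof eventually_elim
      case (elim \<epsilon>)
      define s c d where "s = sn (\<beta> \<epsilon> k) (q \<epsilon>)" and "c = cn (\<beta> \<epsilon> k) (q \<epsilon>)" and "d = dn (\<beta> \<epsilon> k) (q \<epsilon>)"
      have q: "0 < q \<epsilon>" "q \<epsilon> < 1" using elim compl_modulus_bounds[of \<epsilon>] by (auto simp: q_def)
      have cd: "c\<^sup>2 = 1 - s\<^sup>2" "d\<^sup>2 = 1 - (q \<epsilon> * s)\<^sup>2" "0 < s"
        using cn_square dn_square q elim by (auto simp: s_def c_def d_def power_mult_distrib)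
      have "0 < (q \<epsilon> * s)\<^sup>2" using cd(3) q by simp
      then have "d\<^sup>2 < 1" by (simp add: cd)
      then have bd: "\<bar>d\<bar> < 1" by (simp add: abs_square_less_1)
      have "sinh (r \<epsilon> k) = c / s" by (simp add: r_def s_def c_def)
      moreover have "tanh (R \<epsilon> k) = d" using bd by (simp add: R_def d_def tanh_artanh)
      moreover have "cosh (r \<epsilon> k) = 1 / s"
      proof -
        have "(cosh (r \<epsilon> k))\<^sup>2 = (1 / s)\<^sup>2"
          unfolding cosh_square_eq \<open>sinh (r \<epsilon> k) = c / s\<close> power_divide cd(1)
          using cd(3) by (simp add: field_simps)
        then show ?thesis by (rule power2_eq_imp_eq) (use cd(3) in auto)
      qed
      moreover have "cosh (R \<epsilon> k) = 1 / (q \<epsilon> * s)"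
      proof -
        have "(tanh (R \<epsilon> k))\<^sup>2 * (cosh (R \<epsilon> k))\<^sup>2 = (cosh (R \<epsilon> k))\<^sup>2 - 1"
          by (simp add: tanh_def power_divide sinh_square_eq)
        then have "(q \<epsilon> * s)\<^sup>2 * (cosh (R \<epsilon> k))\<^sup>2 = 1"
          unfolding \<open>tanh (R \<epsilon> k) = d\<close> cd(2) by (simp add: left_diff_distrib)
        then have "(cosh (R \<epsilon> k))\<^sup>2 = (1 / (q \<epsilon> * s))\<^sup>2"
          using cd(3) q by (simp add: power_divide field_simps)
        then show ?thesis by (rule power2_eq_imp_eq) (use cd(3) q in auto)
      qed
      ultimately show ?case
        unfolding hyperbolic_ring_param_def s_def[symmetric] c_def[symmetric] d_def[symmetric] using q by simp
    qed
  qed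
  then show ?thesis
    unfolding agree_def by (intro exI[of _ r] exI[of _ R]) (simp add: \<beta>_def q_def)
qed

section \<open>Grid functions and the elliptic sinh-Gordon equations\<close>

lemma Arg_ring_lhs_normalized:
  fixes u :: real and w :: "real \<Rightarrow> nat \<Rightarrow> real"
  assumes \<sigma>: "\<sigma> = 1 \<or> \<sigma> = -1" and w: "\<forall>\<epsilon>. w \<epsilon> 0 = u" "\<forall>k\<in>{1..4}. (\<lambda>\<epsilon>. w \<epsilon> k - u) \<in> O[at_right 0](\<lambda>\<epsilon>. \<epsilon>)"
  shows "((\<lambda>\<epsilon>. ring_arg \<sigma> w \<epsilon> / \<epsilon>\<^sup>2
              + ((\<Sum>k=1..4. w \<epsilon> k - u) / \<epsilon>\<^sup>2 + \<sigma> * sinh (2 * u))) \<longlongrightarrow> 0) (at_right 0)"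
proof -
  have "agree 3 (ring_arg \<sigma> w) (\<lambda>\<epsilon>. - ((\<Sum>k=1..4. w \<epsilon> k - u) + \<sigma> * (\<epsilon>\<^sup>2 * sinh (2 * u))))"
    using w by (intro Arg_ring_lhs_agree \<sigma>) auto
  from agree_add[OF this agree_refl[of 3 "\<lambda>\<epsilon>. (\<Sum>k=1..4. w \<epsilon> k - u) + \<sigma> * (\<epsilon>\<^sup>2 * sinh (2 * u))"]]
  have "agree 3 (\<lambda>\<epsilon>. ring_arg \<sigma> w \<epsilon> + (\<Sum>k=1..4. w \<epsilon> k - u) + \<sigma> * (\<epsilon>\<^sup>2 * sinh (2 * u))) (\<lambda>\<epsilon>. \<epsilon>\<^sup>2 * 0)"
    by (simp add: add.assoc)
  from agree_divide_power[OF this, of 1]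
  have "agree 1 (\<lambda>\<epsilon>. (ring_arg \<sigma> w \<epsilon> + (\<Sum>k=1..4. w \<epsilon> k - u) + \<sigma> * (\<epsilon>\<^sup>2 * sinh (2 * u))) / \<epsilon>\<^sup>2) (\<lambda>_. 0)" by simp
  then have "((\<lambda>\<epsilon>. (ring_arg \<sigma> w \<epsilon> + (\<Sum>k=1..4. w \<epsilon> k - u) + \<sigma> * (\<epsilon>\<^sup>2 * sinh (2 * u))) / \<epsilon>\<^sup>2) \<longlongrightarrow> 0) (at_right 0)"
    by (rule agree_tendsto) auto
  moreover have "\<forall>\<^sub>F \<epsilon> in at_right 0. (ring_arg \<sigma> w \<epsilon> + (\<Sum>k=1..4. w \<epsilon> k - u) + \<sigma> * (\<epsilon>\<^sup>2 * sinh (2 * u))) / \<epsilon>\<^sup>2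
      = ring_arg \<sigma> w \<epsilon> / \<epsilon>\<^sup>2 + ((\<Sum>k=1..4. w \<epsilon> k - u) / \<epsilon>\<^sup>2 + \<sigma> * sinh (2 * u))"
    using eventually_0_1 by eventually_elim (simp add: add_divide_distrib)
  ultimately show ?thesis by (rule Lim_transform_eventually)
qed

lemma stencil_agree:
  assumes "open D" "smooth_on D u" "(x, y) \<in> D"
  shows "agree 1 (\<lambda>\<epsilon>. stencil u x y \<epsilon> k) (\<lambda>_. u (x, y))"
proof -
  have "Ck_on 1 D u" using assms(2) by (simp add: smooth_on_def)
  then have "u differentiable_on D" by simp
  from stencil_neighbor_bigo[OF assms(1) this assms(3)] show ?thesis by (simp add: agree_def)
qed

lemma Arg_ring_lhs_stencil:
  assumes \<sigma>: "\<sigma> = 1 \<or> \<sigma> = -1" and D: "open D" "smooth_on D u" "(x, y) \<in> D"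
  shows "agree 1 (\<lambda>\<epsilon>. ring_arg \<sigma> (stencil u x y) \<epsilon> / \<epsilon>\<^sup>2)
     (\<lambda>_. - (laplacian u (x, y) + \<sigma> * sinh (2 * u (x, y))))"
proof -
  have "agree 3 (ring_arg \<sigma> (stencil u x y)) (\<lambda>\<epsilon>. - ((\<Sum>k=1..4. stencil u x y \<epsilon> k - u (x, y)) + \<sigma> * (\<epsilon>\<^sup>2 * sinh (2 * u (x, y)))))"
    using stencil_agree[OF D]
    by (intro Arg_ring_lhs_agree \<sigma>) (auto simp: stencil_def[of _ _ _ _ 0] agree_def)
  also have "agree 3 \<dots> (\<lambda>\<epsilon>. - 1 * (\<epsilon>\<^sup>2 * laplacian u (x, y) + \<sigma> * (\<epsilon>\<^sup>2 * sinh (2 * u (x, y)))))"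
    using agree_cmult[OF agree_add[OF stencil_sum_agree[OF D] agree_refl], of "-1"] by simp
  also have "(\<lambda>\<epsilon>. - 1 * (\<epsilon>\<^sup>2 * laplacian u (x, y) + \<sigma> * (\<epsilon>\<^sup>2 * sinh (2 * u (x, y)))))
      = (\<lambda>\<epsilon>. \<epsilon> ^ 2 * - (laplacian u (x, y) + \<sigma> * sinh (2 * u (x, y))))"
    by (simp add: algebra_simps)
  finally have "agree 3 (ring_arg \<sigma> (stencil u x y)) \<dots>" .
  from agree_divide_power[OF this, of 1] show ?thesis by simp
qed

lemma stencil_residual_agree:
  assumes D: "open D" "smooth_on D u" "(x, y) \<in> D" and pde: "laplacian u (x, y) + \<sigma> * sinh (2 * u (x, y)) = 0"
  shows "agree 3 (\<lambda>\<epsilon>. (\<Sum>k=1..4. stencil u x y \<epsilon> k - u (x, y)) + \<sigma> * (\<epsilon>\<^sup>2 * sinh (2 * u (x, y)))) (\<lambda>_. 0)"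
proof -
  have "agree 3 (\<lambda>\<epsilon>. (\<Sum>k=1..4. stencil u x y \<epsilon> k - u (x, y)) + \<sigma> * (\<epsilon>\<^sup>2 * sinh (2 * u (x, y))))
     (\<lambda>\<epsilon>. \<epsilon>\<^sup>2 * laplacian u (x, y) + \<sigma> * (\<epsilon>\<^sup>2 * sinh (2 * u (x, y))))"
    by (rule agree_add[OF stencil_sum_agree[OF D] agree_refl])
  also have "(\<lambda>\<epsilon>. \<epsilon>\<^sup>2 * laplacian u (x, y) + \<sigma> * (\<epsilon>\<^sup>2 * sinh (2 * u (x, y)))) = (\<lambda>\<epsilon>. \<epsilon>\<^sup>2 * (laplacian u (x, y) + \<sigma> * sinh (2 * u (x, y))))"
    by (simp add: algebra_simps)
  finally show ?thesis by (simp add: pde)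
qed

lemma stencil_radii_bigo:
  assumes "open D" "smooth_on D u" "(x, y) \<in> D"
  shows "(\<lambda>\<epsilon>. \<epsilon> * sinh (stencil u x y \<epsilon> k)) \<in> O[at_right 0](\<lambda>\<epsilon>. \<epsilon>)"
    and "(\<lambda>\<epsilon>. \<epsilon> * cosh (stencil u x y \<epsilon> k)) \<in> O[at_right 0](\<lambda>\<epsilon>. \<epsilon>)"
proof -
  have "((\<lambda>\<epsilon>. stencil u x y \<epsilon> k) \<longlongrightarrow> u (x, y)) (at_right 0)"
    by (rule agree_tendsto[OF stencil_agree[OF assms]]) auto
  from bigo_id_mult[OF tendsto_sinh[OF this], of 1] bigo_id_mult[OF tendsto_cosh[OF this], of 1]
  show "(\<lambda>\<epsilon>. \<epsilon> * sinh (stencil u x y \<epsilon> k)) \<in> O[at_right 0](\<lambda>\<epsilon>. \<epsilon>)"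
    and "(\<lambda>\<epsilon>. \<epsilon> * cosh (stencil u x y \<epsilon> k)) \<in> O[at_right 0](\<lambda>\<epsilon>. \<epsilon>)" by simp_all
qed

lemma (in space_form) stencil_rings_close_up:
  assumes D: "open D" "smooth_on D u" "(x, y) \<in> D" and pde: "laplacian u (x, y) + \<kappa> * sinh (2 * u (x, y)) = 0"
  shows "\<exists>K. \<forall>\<^sub>F \<epsilon> in at_right 0. \<exists>\<zeta> \<theta>. flower_chart S C (K * \<epsilon> ^ 4)
      (\<lambda>k. \<epsilon> * sinh (stencil u x y \<epsilon> k)) (\<lambda>k. \<epsilon> * cosh (stencil u x y \<epsilon> k)) \<zeta> \<theta>"
  by (rule rings_close_up[of _ "u (x, y)"])
     (use stencil_agree[OF D] stencil_residual_agree[OF D pde] in \<open>auto simp: stencil_def[of _ _ _ _ 0]\<close>)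

lemma infinitesimal_spherical_flower_stencil:
  assumes D: "open D" "smooth_on D u" "(x, y) \<in> D" and pde: "laplacian u (x, y) + sinh (2 * u (x, y)) = 0"
  shows "infinitesimal_spherical_ring_flower (\<lambda>\<epsilon> k. \<epsilon> * sinh (stencil u x y \<epsilon> k)) (\<lambda>\<epsilon> k. \<epsilon> * cosh (stencil u x y \<epsilon> k))"
proof -
  obtain K where "\<forall>\<^sub>F \<epsilon> in at_right 0. \<exists>\<zeta> \<theta>. flower_chart sin cos (K * \<epsilon> ^ 4)
      (\<lambda>k. \<epsilon> * sinh (stencil u x y \<epsilon> k)) (\<lambda>k. \<epsilon> * cosh (stencil u x y \<epsilon> k)) \<zeta> \<theta>"
    using sphere.stencil_rings_close_up[OF D] pde by auto
  then have "\<forall>\<^sub>F \<epsilon> in at_right 0. spherical_ring_flower_upto (4 * K * \<epsilon> ^ 4)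
      (\<lambda>k. \<epsilon> * sinh (stencil u x y \<epsilon> k)) (\<lambda>k. \<epsilon> * cosh (stencil u x y \<epsilon> k))"
    by eventually_elim (use flower_chart_imp_spherical in \<open>fastforce simp: mult.assoc\<close>)
  then show ?thesis
    unfolding infinitesimal_spherical_ring_flower_def using stencil_radii_bigo[OF D] by blast
qed

lemma infinitesimal_hyperbolic_flower_stencil:
  assumes D: "open D" "smooth_on D u" "(x, y) \<in> D" and pde: "laplacian u (x, y) - sinh (2 * u (x, y)) = 0"
  shows "infinitesimal_hyperbolic_ring_flower (\<lambda>\<epsilon> k. \<epsilon> * sinh (stencil u x y \<epsilon> k)) (\<lambda>\<epsilon> k. \<epsilon> * cosh (stencil u x y \<epsilon> k))"
proof -
  obtain K where "\<forall>\<^sub>F \<epsilon> in at_right 0. \<exists>\<zeta> \<theta>. flower_chart sinh cosh (K * \<epsilon> ^ 4)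
      (\<lambda>k. \<epsilon> * sinh (stencil u x y \<epsilon> k)) (\<lambda>k. \<epsilon> * cosh (stencil u x y \<epsilon> k)) \<zeta> \<theta>"
    using hyperbolic_plane.stencil_rings_close_up[OF D] pde by auto
  then have "\<forall>\<^sub>F \<epsilon> in at_right 0. hyperbolic_ring_flower_upto (K * \<epsilon> ^ 4)
      (\<lambda>k. \<epsilon> * sinh (stencil u x y \<epsilon> k)) (\<lambda>k. \<epsilon> * cosh (stencil u x y \<epsilon> k))"
    by eventually_elim (use flower_chart_imp_hyperbolic in blast)
  then show ?thesis
    unfolding infinitesimal_hyperbolic_ring_flower_def using stencil_radii_bigo[OF D] by blast
qed

theorem theorem9p1:
  shows "
    (\<forall>q b. 0 < q \<and> q < 1 \<longrightarrow>
        cmod (spherical_ring_lhs q b) = 1 \<and> cmod (hyperbolic_ring_lhs q b) = 1) \<and>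
    (\<forall>(u::real) (w :: real \<Rightarrow> nat \<Rightarrow> real).
        (\<forall>\<epsilon>. w \<epsilon> 0 = u) \<and>
        (\<forall>k\<in>{1..4}. (\<lambda>\<epsilon>. w \<epsilon> k - u) \<in> O[at_right 0](\<lambda>\<epsilon>. \<epsilon>)) \<and>
        (\<lambda>\<epsilon>. \<Sum>k=1..4. w \<epsilon> k - u) \<in> O[at_right 0](\<lambda>\<epsilon>. \<epsilon>\<^sup>2) \<longrightarrow>
        ((\<lambda>\<epsilon>. Arg (spherical_ring_lhs (compl_modulus \<epsilon>) (\<lambda>k. ellipticK (compl_modulus \<epsilon>) - w \<epsilon> k)) / \<epsilon>\<^sup>2
              + ((\<Sum>k=1..4. w \<epsilon> k - u) / \<epsilon>\<^sup>2 + sinh (2 * u))) \<longlongrightarrow> 0) (at_right 0)) \<and>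
    (\<forall>D u. open D \<and> smooth_on D u \<longrightarrow> (\<forall>x y. (x, y) \<in> D \<longrightarrow>
        ((\<lambda>\<epsilon>. Arg (spherical_ring_lhs (compl_modulus \<epsilon>) (\<lambda>k. ellipticK (compl_modulus \<epsilon>) - stencil u x y \<epsilon> k)) / \<epsilon>\<^sup>2)
          \<longlongrightarrow> - (laplacian u (x, y) + sinh (2 * u (x, y)))) (at_right 0))) \<and>
    (\<forall>D u. open D \<and> smooth_on D u \<and> (\<forall>z\<in>D. laplacian u z + sinh (2 * u z) = 0) \<longrightarrow>
      (\<forall>x y. (x, y) \<in> D \<longrightarrow>
        (\<lambda>\<epsilon>. Arg (spherical_ring_lhs (compl_modulus \<epsilon>) (\<lambda>k. ellipticK (compl_modulus \<epsilon>) - stencil u x y \<epsilon> k)) / \<epsilon>\<^sup>2)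
          \<in> O[at_right 0](\<lambda>\<epsilon>. \<epsilon>) \<and>
        (\<exists>r R :: real \<Rightarrow> nat \<Rightarrow> real. \<forall>k\<le>4.
          (\<forall>\<^sub>F \<epsilon> in at_right 0.
            spherical_ring_param (compl_modulus \<epsilon>) (ellipticK (compl_modulus \<epsilon>) - stencil u x y \<epsilon> k) (r \<epsilon> k) (R \<epsilon> k)) \<and>
          (\<lambda>\<epsilon>. r \<epsilon> k - \<epsilon> * sinh (stencil u x y \<epsilon> k)) \<in> O[at_right 0](\<lambda>\<epsilon>. \<epsilon> ^ 3) \<and>
          (\<lambda>\<epsilon>. R \<epsilon> k - \<epsilon> * cosh (stencil u x y \<epsilon> k)) \<in> O[at_right 0](\<lambda>\<epsilon>. \<epsilon> ^ 3)) \<and>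
        infinitesimal_spherical_ring_flower
          (\<lambda>\<epsilon> k. \<epsilon> * sinh (stencil u x y \<epsilon> k)) (\<lambda>\<epsilon> k. \<epsilon> * cosh (stencil u x y \<epsilon> k)))) \<and>
    (\<forall>(u::real) (w :: real \<Rightarrow> nat \<Rightarrow> real).
        (\<forall>\<epsilon>. w \<epsilon> 0 = u) \<and>
        (\<forall>k\<in>{1..4}. (\<lambda>\<epsilon>. w \<epsilon> k - u) \<in> O[at_right 0](\<lambda>\<epsilon>. \<epsilon>)) \<and>
        (\<lambda>\<epsilon>. \<Sum>k=1..4. w \<epsilon> k - u) \<in> O[at_right 0](\<lambda>\<epsilon>. \<epsilon>\<^sup>2) \<longrightarrow>
        ((\<lambda>\<epsilon>. Arg (hyperbolic_ring_lhs (compl_modulus \<epsilon>) (\<lambda>k. ellipticK (compl_modulus \<epsilon>) - w \<epsilon> k)) / \<epsilon>\<^sup>2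
              + ((\<Sum>k=1..4. w \<epsilon> k - u) / \<epsilon>\<^sup>2 - sinh (2 * u))) \<longlongrightarrow> 0) (at_right 0)) \<and>
    (\<forall>D u. open D \<and> smooth_on D u \<longrightarrow> (\<forall>x y. (x, y) \<in> D \<longrightarrow>
        ((\<lambda>\<epsilon>. Arg (hyperbolic_ring_lhs (compl_modulus \<epsilon>) (\<lambda>k. ellipticK (compl_modulus \<epsilon>) - stencil u x y \<epsilon> k)) / \<epsilon>\<^sup>2)
          \<longlongrightarrow> - (laplacian u (x, y) - sinh (2 * u (x, y)))) (at_right 0))) \<and>
    (\<forall>D u. open D \<and> smooth_on D u \<and> (\<forall>z\<in>D. laplacian u z - sinh (2 * u z) = 0) \<longrightarrow>
      (\<forall>x y. (x, y) \<in> D \<longrightarrow>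
        (\<lambda>\<epsilon>. Arg (hyperbolic_ring_lhs (compl_modulus \<epsilon>) (\<lambda>k. ellipticK (compl_modulus \<epsilon>) - stencil u x y \<epsilon> k)) / \<epsilon>\<^sup>2)
          \<in> O[at_right 0](\<lambda>\<epsilon>. \<epsilon>) \<and>
        (\<exists>r R :: real \<Rightarrow> nat \<Rightarrow> real. \<forall>k\<le>4.
          (\<forall>\<^sub>F \<epsilon> in at_right 0.
            hyperbolic_ring_param (compl_modulus \<epsilon>) (ellipticK (compl_modulus \<epsilon>) - stencil u x y \<epsilon> k) (r \<epsilon> k) (R \<epsilon> k)) \<and>
          (\<lambda>\<epsilon>. r \<epsilon> k - \<epsilon> * sinh (stencil u x y \<epsilon> k)) \<in> O[at_right 0](\<lambda>\<epsilon>. \<epsilon> ^ 3) \<and>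
          (\<lambda>\<epsilon>. R \<epsilon> k - \<epsilon> * cosh (stencil u x y \<epsilon> k)) \<in> O[at_right 0](\<lambda>\<epsilon>. \<epsilon> ^ 3)) \<and>
        infinitesimal_hyperbolic_ring_flower
          (\<lambda>\<epsilon> k. \<epsilon> * sinh (stencil u x y \<epsilon> k)) (\<lambda>\<epsilon> k. \<epsilon> * cosh (stencil u x y \<epsilon> k))))"
proof (intro conjI allI impI; (elim conjE)?)
  fix q :: real and b :: "nat \<Rightarrow> real"
  assume "0 < q" "q < 1"
  then show "cmod (spherical_ring_lhs q b) = 1" "cmod (hyperbolic_ring_lhs q b) = 1"
    by (simp_all add: ring_lhs_eqs cmod_ring_lhs)
next
  fix u :: real and w :: "real \<Rightarrow> nat \<Rightarrow> real"
  assume w: "\<forall>\<epsilon>. w \<epsilon> 0 = u" "\<forall>k\<in>{1..4}. (\<lambda>\<epsilon>. w \<epsilon> k - u) \<in> O[at_right 0](\<lambda>\<epsilon>. \<epsilon>)"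
  show "((\<lambda>\<epsilon>. Arg (spherical_ring_lhs (compl_modulus \<epsilon>) (\<lambda>k. ellipticK (compl_modulus \<epsilon>) - w \<epsilon> k)) / \<epsilon>\<^sup>2
      + ((\<Sum>k=1..4. w \<epsilon> k - u) / \<epsilon>\<^sup>2 + sinh (2 * u))) \<longlongrightarrow> 0) (at_right 0)"
    using Arg_ring_lhs_normalized[OF _ w, of 1] by (simp add: ring_lhs_eqs ring_arg_def)
  show "((\<lambda>\<epsilon>. Arg (hyperbolic_ring_lhs (compl_modulus \<epsilon>) (\<lambda>k. ellipticK (compl_modulus \<epsilon>) - w \<epsilon> k)) / \<epsilon>\<^sup>2
      + ((\<Sum>k=1..4. w \<epsilon> k - u) / \<epsilon>\<^sup>2 - sinh (2 * u))) \<longlongrightarrow> 0) (at_right 0)"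
    using Arg_ring_lhs_normalized[OF _ w, of "-1"] by (simp add: ring_lhs_eqs ring_arg_def)
next
  fix D :: "(real \<times> real) set" and u :: "real \<times> real \<Rightarrow> real" and x y :: real
  assume D: "open D" "smooth_on D u" "(x, y) \<in> D"
  let ?b = "\<lambda>\<epsilon> k. ellipticK (compl_modulus \<epsilon>) - stencil u x y \<epsilon> k"
  have lim: "((\<lambda>\<epsilon>. ring_arg \<sigma> (stencil u x y) \<epsilon> / \<epsilon>\<^sup>2)
      \<longlongrightarrow> - (laplacian u (x, y) + \<sigma> * sinh (2 * u (x, y)))) (at_right 0)" if "\<sigma> = 1 \<or> \<sigma> = -1" for \<sigma>
    by (rule agree_tendsto[OF Arg_ring_lhs_stencil[OF that D] zero_less_one tendsto_const])
  show "((\<lambda>\<epsilon>. Arg (spherical_ring_lhs (compl_modulus \<epsilon>) (?b \<epsilon>)) / \<epsilon>\<^sup>2)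
      \<longlongrightarrow> - (laplacian u (x, y) + sinh (2 * u (x, y)))) (at_right 0)"
    using lim[of 1] by (simp add: ring_lhs_eqs ring_arg_def)
  show "((\<lambda>\<epsilon>. Arg (hyperbolic_ring_lhs (compl_modulus \<epsilon>) (?b \<epsilon>)) / \<epsilon>\<^sup>2)
      \<longlongrightarrow> - (laplacian u (x, y) - sinh (2 * u (x, y)))) (at_right 0)"
    using lim[of "-1"] by (simp add: ring_lhs_eqs ring_arg_def)
next
  fix D :: "(real \<times> real) set" and u :: "real \<times> real \<Rightarrow> real" and x y :: real
  assume D: "open D" "smooth_on D u" "(x, y) \<in> D"
  let ?b = "\<lambda>\<epsilon> k. ellipticK (compl_modulus \<epsilon>) - stencil u x y \<epsilon> k"
  have lim: "((\<lambda>\<epsilon>. stencil u x y \<epsilon> k) \<longlongrightarrow> u (x, y)) (at_right 0)" for k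
    by (rule agree_tendsto[OF stencil_agree[OF D] zero_less_one tendsto_const])
  {
    assume pde: "\<forall>z\<in>D. laplacian u z + sinh (2 * u z) = 0"
    show "(\<lambda>\<epsilon>. Arg (spherical_ring_lhs (compl_modulus \<epsilon>) (?b \<epsilon>)) / \<epsilon>\<^sup>2)
        \<in> O[at_right 0](\<lambda>\<epsilon>. \<epsilon>)"
      using Arg_ring_lhs_stencil[OF _ D, of 1] pde D(3) by (simp add: ring_lhs_eqs ring_arg_def agree_def)
    show "infinitesimal_spherical_ring_flower
        (\<lambda>\<epsilon> k. \<epsilon> * sinh (stencil u x y \<epsilon> k)) (\<lambda>\<epsilon> k. \<epsilon> * cosh (stencil u x y \<epsilon> k))"
      using pde D by (intro infinitesimal_spherical_flower_stencil) auto
  next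
    assume pde: "\<forall>z\<in>D. laplacian u z - sinh (2 * u z) = 0"
    show "(\<lambda>\<epsilon>. Arg (hyperbolic_ring_lhs (compl_modulus \<epsilon>) (?b \<epsilon>)) / \<epsilon>\<^sup>2)
        \<in> O[at_right 0](\<lambda>\<epsilon>. \<epsilon>)"
      using Arg_ring_lhs_stencil[OF _ D, of "-1"] pde D(3) by (simp add: ring_lhs_eqs ring_arg_def agree_def)
    show "infinitesimal_hyperbolic_ring_flower
        (\<lambda>\<epsilon> k. \<epsilon> * sinh (stencil u x y \<epsilon> k)) (\<lambda>\<epsilon> k. \<epsilon> * cosh (stencil u x y \<epsilon> k))"
      using pde D by (intro infinitesimal_hyperbolic_flower_stencil) auto
  }
  show "\<exists>r R :: real \<Rightarrow> nat \<Rightarrow> real. \<forall>k\<le>4.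
          (\<forall>\<^sub>F \<epsilon> in at_right 0.
            spherical_ring_param (compl_modulus \<epsilon>) (?b \<epsilon> k) (r \<epsilon> k) (R \<epsilon> k)) \<and>
          (\<lambda>\<epsilon>. r \<epsilon> k - \<epsilon> * sinh (stencil u x y \<epsilon> k)) \<in> O[at_right 0](\<lambda>\<epsilon>. \<epsilon> ^ 3) \<and>
          (\<lambda>\<epsilon>. R \<epsilon> k - \<epsilon> * cosh (stencil u x y \<epsilon> k)) \<in> O[at_right 0](\<lambda>\<epsilon>. \<epsilon> ^ 3)"
    by (rule spherical_ring_param_exists[OF lim])
  show "\<exists>r R :: real \<Rightarrow> nat \<Rightarrow> real. \<forall>k\<le>4.
          (\<forall>\<^sub>F \<epsilon> in at_right 0.
            hyperbolic_ring_param (compl_modulus \<epsilon>) (?b \<epsilon> k) (r \<epsilon> k) (R \<epsilon> k)) \<and>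
          (\<lambda>\<epsilon>. r \<epsilon> k - \<epsilon> * sinh (stencil u x y \<epsilon> k)) \<in> O[at_right 0](\<lambda>\<epsilon>. \<epsilon> ^ 3) \<and>
          (\<lambda>\<epsilon>. R \<epsilon> k - \<epsilon> * cosh (stencil u x y \<epsilon> k)) \<in> O[at_right 0](\<lambda>\<epsilon>. \<epsilon> ^ 3)"
    by (rule hyperbolic_ring_param_exists[OF lim])
qed

end
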